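(* Let $F=\alpha^2/\beta$ be a Kropina metric on an $n$-dimensional manifold $M$. Then the Ricci curvature tensor of $F$ is given by $$\begin{aligned} Ric_{kl}={}&{}^\alpha Ric_{kl}+F_{\cdot k\cdot l}\Big\{-\frac{n-5}{b^4F^3}r_{00}^2+\frac{2}{b^4F^2}r_{00}(s_0-2r_0)+\frac{1}{b^2F^2}r_{00|0}+\frac{n-1}{2b^2}s_ms^m_{\;0}+\frac{(b^2r^m_{\;m}-r)s_0}{2b^4}\\ &+\frac{n+1}{b^2F}r_{0m}s^m_{\;0}+\frac{1}{2b^2}\left(s_{0|m}b^m-r_ms^m_{\;0}-r_{0m}s^m\right)-\frac12\left(s^m_{\;0|m}+\frac{F}{b^2}s_ms^m+\frac F2s^t_{\;m}s^m_{\;t}\right)-\frac{n+1}{b^4F}s_0r_0\Big\}\\ &+F_{\cdot l}F_{\cdot k}\Big\{\frac{3(n-5)}{b^4F^4}r_{00}^2+\frac{4}{b^4F^3}r_{00}(2r_0-s_0)-\frac{2}{b^2F^3}r_{00|0}+\frac{n+1}{b^4F^2}s_0r_0-\frac{n+1}{b^2F^2}r_{0m}s^m_{\;0}-\frac{1}{2b^2}s^ms_m-\frac14s^t_{\;m}s^m_{\;t}\Big\}\\ &+F_{\cdot k}\Big\{-\frac{6(n-3)}{b^4F^3}r_{00}r_{l0}+\frac{n-7}{b^4F^2}r_{0l}r_0-\frac{n-3}{b^4F^2}r_{0l}s_0+\frac{n-3}{b^4F^2}r_{00}r_l+\frac{2}{b^4F^2}r_{00}s_l+\frac{2}{b^2F^2}r_{l0|0}-\frac{n-1}{2b^2F^2}r_{00|l}\\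 &\quad+\frac{n-1}{2b^2}s_ms^m_{\;l}+\frac{b^2r^m_{\;m}-r}{2b^4}s_l-\frac{r_ms^m_{\;l}}{2b^2}-\frac{r^m_{\;l}s_m}{2b^2}-\frac{s^m_{\;l|m}}{2}+\frac{s_{l|m}b^m}{2b^2}-\frac{n+1}{2b^4F}(s_lr_0+s_0r_l)+\frac{n+1}{2b^2F}(r_{lm}s^m_{\;0}+r_{0m}s^m_{\;l})\Big\}\\ &+F_{\cdot l}\Big\{-\frac{6(n-3)}{b^4F^3}r_{00}r_{k0}+\frac{n-7}{b^4F^2}r_{k0}r_0-\frac{n-3}{b^4F^2}r_{k0}s_0+\frac{n-3}{b^4F^2}r_{00}r_k+\frac{2}{b^4F^2}r_{00}s_k+\frac{2}{b^2F^2}r_{k0|0}-\frac{n-1}{2b^2F^2}r_{00|k}\\ &\quad+\frac{n-1}{2b^2}s_ms^m_{\;k}+\frac{b^2r^m_{\;m}-r}{2b^4}s_k-\frac{r_ms^m_{\;k}}{2b^2}-\frac{r_{km}s^m}{2b^2}-\frac{s^m_{\;k|m}}{2}+\frac{s_{k|m}b^m}{2b^2}-\frac{n+1}{2b^4F}(s_kr_0+s_0r_k)+\frac{n+1}{2b^2F}(r_{km}s^m_{\;0}+r_{0m}s^m_{\;k})\Big\}\\ &+\frac{8(n-2)}{b^4F^2}r_{k0}r_{l0}+\frac{4(n-2)}{b^4F^2}r_{00}r_{kl}+\frac{2(n-1)}{b^4F}r_{kl}s_0-\frac{2(n-3)}{b^4F}r_{kl}r_0-\frac{3n-5}{b^4F}(r_{l0}r_k+r_{k0}r_l)\\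 &+\frac{n-3}{b^4F}(r_{k0}s_l+r_{l0}s_k)-\frac{3n-7}{2b^4}(r_ks_l+r_ls_k)-\frac{n-2}{b^4}s_ks_l+\frac{r_kr_l}{b^4}-\frac{2r_{kl|0}}{b^2F}+\frac{n-1}{b^2F}(r_{k0|l}+r_{l0|k})\\ &+\frac{n-2}{2b^2}(s_{k|l}+s_{l|k})+\frac{b^2r^m_{\;m}-r}{b^4}r_{kl}+\frac{b^mr_{kl|m}}{b^2}-\frac{1}{2b^2}(r_{k|l}+r_{l|k})+\frac{n-1}{2b^2}(r_{km}s^m_{\;l}+r_{lm}s^m_{\;k}), \end{aligned}$$ where ${}^\alpha Ric_{kl}$ denotes the Ricci curvature tensor of $\alpha$.
   Context: Kropina metric: $F=\alpha^2/\beta$, where $\alpha=\sqrt{a_{ij}(x)y^iy^j}$ is a Riemannian metric and $\beta=b_i(x)y^i$ is a nowhere vanishing $1$-form on $M$; $F$ and its curvatures are considered at those $(x,y)\in TM$ with $\beta(x,y)>0$. Summation convention is used. $(a^{ij})=(a_{ij})^{-1}$; indices of $b_i,r_{ij},s_{ij},r_i,s_i$ are raised with $a^{ij}$; $b^i=a^{ij}b_j$, $b^2=a^{ij}b_ib_j$ and $b^4=(b^2)^2$. $F_{\cdot k}=\partial F/\partial y^k$ and $F_{\cdot k\cdot l}=\partial^2F/\partial y^k\partial y^l$. Finsler curvatures of $F$: $g_{ij}=\frac12(F^2)_{y^iy^j}$, $(g^{ij})=(g_{ij})^{-1}$; spray coefficients $G^i=\frac14g^{ik}[(F^2)_{x^jy^k}y^j-(F^2)_{x^k}]$;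 Riemann curvature $$R^i_{\;k}=2\frac{\partial G^i}{\partial x^k}-y^j\frac{\partial^2G^i}{\partial x^j\partial y^k}+2G^j\frac{\partial^2G^i}{\partial y^j\partial y^k}-\frac{\partial G^i}{\partial y^j}\frac{\partial G^j}{\partial y^k};$$ Riemann curvature tensor $R_{j\;kl}^{\;\,i}=\frac13\left\{\frac{\partial^2R^i_{\;k}}{\partial y^l\partial y^j}-\frac{\partial^2R^i_{\;l}}{\partial y^k\partial y^j}\right\}$; $\overline{Ric}_{ij}=R_{i\;mj}^{\;\,m}$; Ricci curvature tensor $Ric_{ij}=\frac12(\overline{Ric}_{ij}+\overline{Ric}_{ji})$. A bar $|$ denotes covariant derivative with respect to the Levi-Civita connection of $\alpha$, and a subscript $0$ denotes contraction with $y$ (e.g. $r_{k0}=r_{kj}y^j$, $r_{00|0}=r_{ij|k}y^iy^jy^k$, $r_{k0|l}=r_{kj|l}y^j$, $r_{l0|0}=r_{lj|k}y^jy^k$, $s^m_{\;0|m}=s^m_{\;j|m}y^j$, $s_{0|m}=s_{j|m}y^j$). $r_{ij}=\frac12(b_{i|j}+b_{j|i})$, $s_{ij}=\frac12(b_{i|j}-b_{j|i})$, $r_{00}=r_{ij}y^iy^j$, $r_i=b^jr_{ij}$, $r_0=r_iy^i$, $r^i=a^{ij}r_j$, $r=b^ir_i$, $r^i_{\;j}=a^{ik}r_{kj}$, $s^i_{\;j}=a^{ik}s_{kj}$, $s^i_{\;0}=a^{ij}s_{jk}y^k$, $s_i=b^js_{ji}$, $s_0=s_iy^i$, $s^i=a^{ij}s_j$.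 *)

theory Defs
  imports "HOL-Analysis.Analysis"
begin

section \<open>Smooth manifolds and covariant tensor fields\<close>

(* Only meant for open S, where it is the usual notion of a C^k (respectively C^infinity) map. *)
primrec Ck_on :: "nat \<Rightarrow> 'a::real_normed_vector set \<Rightarrow> ('a \<Rightarrow> 'b::real_normed_vector) \<Rightarrow> bool" where
  "Ck_on 0 S f \<longleftrightarrow> continuous_on S f"
| "Ck_on (Suc k) S f \<longleftrightarrow>
     (\<forall>x\<in>S. f differentiable (at x)) \<and> (\<forall>v. Ck_on k S (\<lambda>x. frechet_derivative f (at x) v))"

definition smooth_on :: "'a::real_normed_vector set \<Rightarrow> ('a \<Rightarrow> 'b::real_normed_vector) \<Rightarrow> bool" where
  "smooth_on S f \<longleftrightarrow> (\<forall>k. Ck_on k S f)"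

definition pd :: "'n::finite \<Rightarrow> (real^'n \<Rightarrow> real) \<Rightarrow> real^'n \<Rightarrow> real" where
  "pd i f x = frechet_derivative f (at x) (axis i 1)"

(* A chart is a pair (U, phi) of an open set U of the manifold and a coordinate map phi, whose
   values outside U are irrelevant. The dimension is CARD('n). *)
type_synonym ('m, 'n) chart = "'m set \<times> ('m \<Rightarrow> real^'n)"

definition chart_image :: "('m, 'n) chart \<Rightarrow> (real^'n) set" where
  "chart_image c = snd c ` fst c"

definition chart_overlap :: "('m, 'n) chart \<Rightarrow> ('m, 'n) chart \<Rightarrow> (real^'n) set" where
  "chart_overlap c c' = snd c ` (fst c \<inter> fst c')"

definition transition :: "('m, 'n) chart \<Rightarrow> ('m, 'n) chart \<Rightarrow> real^'n \<Rightarrow> real^'n" where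
  "transition c c' = snd c' \<circ> inv_into (fst c) (snd c)"

(* The atlas is not required to be maximal. *)
definition smooth_manifold :: "'m topology \<Rightarrow> ('m, 'n::finite) chart set \<Rightarrow> bool" where
  "smooth_manifold M \<A> \<longleftrightarrow>
     Hausdorff_space M \<and>
     (\<exists>\<B>. countable \<B> \<and> (\<forall>V\<in>\<B>. openin M V) \<and>
        (\<forall>U p. openin M U \<and> p \<in> U \<longrightarrow> (\<exists>V\<in>\<B>. p \<in> V \<and> V \<subseteq> U))) \<and>
     (\<Union>c\<in>\<A>. fst c) = topspace M \<and>
     (\<forall>c\<in>\<A>. openin M (fst c) \<and> open (chart_image c) \<and>
        homeomorphic_map (subtopology M (fst c)) (top_of_set (chart_image c)) (snd c)) \<and>
     (\<forall>c\<in>\<A>. \<forall>c'\<in>\<A>. smooth_on (chart_overlap c c') (transition c c'))"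

(* Tensor fields on the manifold are given by their components in every chart of the atlas,
   as functions of the coordinates x, subject to the covariant transformation law. *)
definition one_form :: "('m, 'n::finite) chart set \<Rightarrow> (('m, 'n) chart \<Rightarrow> real^'n \<Rightarrow> real^'n) \<Rightarrow> bool" where
  "one_form \<A> b \<longleftrightarrow>
     (\<forall>c\<in>\<A>. smooth_on (chart_image c) (b c)) \<and>
     (\<forall>c\<in>\<A>. \<forall>c'\<in>\<A>. \<forall>x\<in>chart_overlap c c'. \<forall>i.
        b c x $ i = (\<Sum>p\<in>UNIV. b c' (transition c c' x) $ p * pd i (\<lambda>z. transition c c' z $ p) x))"

definition nowhere_vanishing :: "('m, 'n::finite) chart set \<Rightarrow> (('m, 'n) chart \<Rightarrow> real^'n \<Rightarrow> real^'n) \<Rightarrow> bool" where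
  "nowhere_vanishing \<A> b \<longleftrightarrow> (\<forall>c\<in>\<A>. \<forall>x\<in>chart_image c. b c x \<noteq> 0)"

definition riemannian_metric :: "('m, 'n::finite) chart set \<Rightarrow> (('m, 'n) chart \<Rightarrow> real^'n \<Rightarrow> real^'n^'n) \<Rightarrow> bool" where
  "riemannian_metric \<A> a \<longleftrightarrow>
     (\<forall>c\<in>\<A>. smooth_on (chart_image c) (a c)) \<and>
     (\<forall>c\<in>\<A>. \<forall>x\<in>chart_image c.
        (\<forall>i j. a c x $ i $ j = a c x $ j $ i) \<and>
        (\<forall>v. v \<noteq> 0 \<longrightarrow> (\<Sum>i\<in>UNIV. \<Sum>j\<in>UNIV. a c x $ i $ j * v $ i * v $ j) > 0)) \<and>
     (\<forall>c\<in>\<A>. \<forall>c'\<in>\<A>. \<forall>x\<in>chart_overlap c c'. \<forall>i j.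
        a c x $ i $ j = (\<Sum>p\<in>UNIV. \<Sum>q\<in>UNIV. a c' (transition c c' x) $ p $ q
          * pd i (\<lambda>z. transition c c' z $ p) x * pd j (\<lambda>z. transition c c' z $ q) x))"

section \<open>Finsler curvatures in local coordinates\<close>

(* F x y is the value of the metric at the tangent vector y^i (d/dx^i) over the point with
   coordinates x. *)
type_synonym 'n finsler = "real^'n \<Rightarrow> real^'n \<Rightarrow> real"

definition fundamental_tensor :: "'n::finite finsler \<Rightarrow> real^'n \<Rightarrow> real^'n \<Rightarrow> real^'n^'n" where
  "fundamental_tensor F x y =
     (\<chi> i j. 1/2 * pd j (\<lambda>v. pd i (\<lambda>w. (F x w)\<^sup>2) v) y)"

definition spray :: "'n::finite finsler \<Rightarrow> 'n \<Rightarrow> real^'n \<Rightarrow> real^'n \<Rightarrow> real" where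
  "spray F i x y = 1/4 * (\<Sum>k\<in>UNIV. matrix_inv (fundamental_tensor F x y) $ i $ k *
     ((\<Sum>j\<in>UNIV. pd j (\<lambda>z. pd k (\<lambda>w. (F z w)\<^sup>2) y) x * y $ j) - pd k (\<lambda>z. (F z y)\<^sup>2) x))"

(* R^i_k *)
definition riemann_curvature :: "'n::finite finsler \<Rightarrow> 'n \<Rightarrow> 'n \<Rightarrow> real^'n \<Rightarrow> real^'n \<Rightarrow> real" where
  "riemann_curvature F i k x y =
     2 * pd k (\<lambda>z. spray F i z y) x
     - (\<Sum>j\<in>UNIV. y $ j * pd j (\<lambda>z. pd k (\<lambda>w. spray F i z w) y) x)
     + 2 * (\<Sum>j\<in>UNIV. spray F j x y * pd j (\<lambda>v. pd k (\<lambda>w. spray F i x w) v) y)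
     - (\<Sum>j\<in>UNIV. pd j (\<lambda>w. spray F i x w) y * pd k (\<lambda>w. spray F j x w) y)"

(* R_j^i_kl *)
definition riemann_curvature_tensor ::
  "'n::finite finsler \<Rightarrow> 'n \<Rightarrow> 'n \<Rightarrow> 'n \<Rightarrow> 'n \<Rightarrow> real^'n \<Rightarrow> real^'n \<Rightarrow> real" where
  "riemann_curvature_tensor F j i k l x y =
     1/3 * (pd l (\<lambda>v. pd j (\<lambda>w. riemann_curvature F i k x w) v) y
          - pd k (\<lambda>v. pd j (\<lambda>w. riemann_curvature F i l x w) v) y)"

definition Ric_bar :: "'n::finite finsler \<Rightarrow> 'n \<Rightarrow> 'n \<Rightarrow> real^'n \<Rightarrow> real^'n \<Rightarrow> real" where
  "Ric_bar F i j x y = (\<Sum>m\<in>UNIV. riemann_curvature_tensor F i m m j x y)"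

definition Ric :: "'n::finite finsler \<Rightarrow> 'n \<Rightarrow> 'n \<Rightarrow> real^'n \<Rightarrow> real^'n \<Rightarrow> real" where
  "Ric F i j x y = 1/2 * (Ric_bar F i j x y + Ric_bar F j i x y)"

section \<open>Riemannian geometry in local coordinates\<close>

type_synonym 'n metric_field = "real^'n \<Rightarrow> real^'n^'n"
type_synonym 'n covector_field = "real^'n \<Rightarrow> real^'n"

(* a^{ij} *)
definition a_uu :: "'n::finite metric_field \<Rightarrow> 'n \<Rightarrow> 'n \<Rightarrow> real^'n \<Rightarrow> real" where
  "a_uu a i j x = matrix_inv (a x) $ i $ j"

(* Gamma^i_{jk} of the Levi-Civita connection *)
definition christoffel :: "'n::finite metric_field \<Rightarrow> 'n \<Rightarrow> 'n \<Rightarrow> 'n \<Rightarrow> real^'n \<Rightarrow> real" where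
  "christoffel a i j k x = 1/2 * (\<Sum>m\<in>UNIV. a_uu a i m x *
     (pd k (\<lambda>z. a z $ m $ j) x + pd j (\<lambda>z. a z $ m $ k) x - pd m (\<lambda>z. a z $ j $ k) x))"

(* The sign is such that the unit sphere has Ric_{jk} = (n-1) a_{jk}, in agreement with Ric. *)
definition Ric_riem :: "'n::finite metric_field \<Rightarrow> 'n \<Rightarrow> 'n \<Rightarrow> real^'n \<Rightarrow> real" where
  "Ric_riem a j k x = (\<Sum>i\<in>UNIV.
     pd i (christoffel a i j k) x - pd k (christoffel a i i j) x
     + (\<Sum>p\<in>UNIV. christoffel a i i p x * christoffel a p j k x
                  - christoffel a i k p x * christoffel a p i j x))"

(* w_{i|j} *)
definition cov_d :: "'n::finite metric_field \<Rightarrow> ('n \<Rightarrow> real^'n \<Rightarrow> real) \<Rightarrow> 'n \<Rightarrow> 'n \<Rightarrow> real^'n \<Rightarrow> real" where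
  "cov_d a w i j x = pd j (w i) x - (\<Sum>m\<in>UNIV. christoffel a m i j x * w m x)"

(* t_{ij|k} *)
definition cov_dd :: "'n::finite metric_field \<Rightarrow> ('n \<Rightarrow> 'n \<Rightarrow> real^'n \<Rightarrow> real) \<Rightarrow> 'n \<Rightarrow> 'n \<Rightarrow> 'n \<Rightarrow> real^'n \<Rightarrow> real" where
  "cov_dd a t i j k x = pd k (t i j) x
     - (\<Sum>m\<in>UNIV. christoffel a m i k x * t m j x) - (\<Sum>m\<in>UNIV. christoffel a m j k x * t i m x)"

(* t^i_{j|k} *)
definition cov_ud :: "'n::finite metric_field \<Rightarrow> ('n \<Rightarrow> 'n \<Rightarrow> real^'n \<Rightarrow> real) \<Rightarrow> 'n \<Rightarrow> 'n \<Rightarrow> 'n \<Rightarrow> real^'n \<Rightarrow> real" where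
  "cov_ud a t i j k x = pd k (t i j) x
     + (\<Sum>m\<in>UNIV. christoffel a i m k x * t m j x) - (\<Sum>m\<in>UNIV. christoffel a m j k x * t i m x)"

section \<open>Kropina metrics\<close>

definition alpha :: "'n::finite metric_field \<Rightarrow> 'n finsler" where
  "alpha a x y = sqrt (\<Sum>i\<in>UNIV. \<Sum>j\<in>UNIV. a x $ i $ j * y $ i * y $ j)"

definition beta :: "'n::finite covector_field \<Rightarrow> 'n finsler" where
  "beta b x y = (\<Sum>i\<in>UNIV. b x $ i * y $ i)"

definition kropina :: "'n::finite metric_field \<Rightarrow> 'n covector_field \<Rightarrow> 'n finsler" where
  "kropina a b x y = (alpha a x y)\<^sup>2 / beta b x y"

(* Suffixes give the index positions, u for an upper and d for a lower index. *)
definition b_d :: "'n::finite covector_field \<Rightarrow> 'n \<Rightarrow> real^'n \<Rightarrow> real" where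
  "b_d b i x = b x $ i"

definition b_u :: "'n::finite metric_field \<Rightarrow> 'n covector_field \<Rightarrow> 'n \<Rightarrow> real^'n \<Rightarrow> real" where
  "b_u a b i x = (\<Sum>j\<in>UNIV. a_uu a i j x * b_d b j x)"

definition b_norm2 :: "'n::finite metric_field \<Rightarrow> 'n covector_field \<Rightarrow> real^'n \<Rightarrow> real" where
  "b_norm2 a b x = (\<Sum>i\<in>UNIV. \<Sum>j\<in>UNIV. a_uu a i j x * b_d b i x * b_d b j x)"

definition r_dd :: "'n::finite metric_field \<Rightarrow> 'n covector_field \<Rightarrow> 'n \<Rightarrow> 'n \<Rightarrow> real^'n \<Rightarrow> real" where
  "r_dd a b i j x = 1/2 * (cov_d a (b_d b) i j x + cov_d a (b_d b) j i x)"

definition s_dd :: "'n::finite metric_field \<Rightarrow> 'n covector_field \<Rightarrow> 'n \<Rightarrow> 'n \<Rightarrow> real^'n \<Rightarrow> real" where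
  "s_dd a b i j x = 1/2 * (cov_d a (b_d b) i j x - cov_d a (b_d b) j i x)"

definition r_ud :: "'n::finite metric_field \<Rightarrow> 'n covector_field \<Rightarrow> 'n \<Rightarrow> 'n \<Rightarrow> real^'n \<Rightarrow> real" where
  "r_ud a b i j x = (\<Sum>k\<in>UNIV. a_uu a i k x * r_dd a b k j x)"

definition s_ud :: "'n::finite metric_field \<Rightarrow> 'n covector_field \<Rightarrow> 'n \<Rightarrow> 'n \<Rightarrow> real^'n \<Rightarrow> real" where
  "s_ud a b i j x = (\<Sum>k\<in>UNIV. a_uu a i k x * s_dd a b k j x)"

definition r_d :: "'n::finite metric_field \<Rightarrow> 'n covector_field \<Rightarrow> 'n \<Rightarrow> real^'n \<Rightarrow> real" where
  "r_d a b i x = (\<Sum>j\<in>UNIV. b_u a b j x * r_dd a b i j x)"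

definition s_d :: "'n::finite metric_field \<Rightarrow> 'n covector_field \<Rightarrow> 'n \<Rightarrow> real^'n \<Rightarrow> real" where
  "s_d a b i x = (\<Sum>j\<in>UNIV. b_u a b j x * s_dd a b j i x)"

definition s_u :: "'n::finite metric_field \<Rightarrow> 'n covector_field \<Rightarrow> 'n \<Rightarrow> real^'n \<Rightarrow> real" where
  "s_u a b i x = (\<Sum>j\<in>UNIV. a_uu a i j x * s_d a b j x)"

definition r_scalar :: "'n::finite metric_field \<Rightarrow> 'n covector_field \<Rightarrow> real^'n \<Rightarrow> real" where
  "r_scalar a b x = (\<Sum>i\<in>UNIV. b_u a b i x * r_d a b i x)"

end

theory Submission
  imports Defs
begin

text \<open>
  For a spray \<open>G\<close> with \<open>N\<^sup>i\<^sub>k = \<partial>G\<^sup>i/\<partial>y\<^sup>k\<close>, the non-symmetrised Ricci tensor is the \<open>y\<^sup>k\<close>-derivative of the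
  trace \<open>X\<^sub>l\<close> of the curvature of \<open>N\<close>. Writing \<open>G\<^sup>i = 1/2 \<Gamma>\<^sup>i\<^sub>j\<^sub>k y\<^sup>j y\<^sup>k + Q\<^sup>i\<close> with the Levi-Civita connection of
  \<open>\<alpha>\<close>, the symbols \<open>\<Gamma>\<close> and \<open>Q\<close> separate:
  \<open>X\<^sub>l = Ric\<^sub>j\<^sub>l y\<^sup>j + \<partial>W/\<partial>y\<^sup>l - \<delta>\<^sub>l T\<close>, where \<open>T = \<partial>Q\<^sup>m/\<partial>y\<^sup>m\<close>, \<open>W\<close> is the horizontal divergence of \<open>Q\<close> minus half of
  the trace of the square of \<open>\<partial>Q/\<partial>y\<close>, and \<open>\<delta>\<close> is the horizontal derivative of \<open>G\<close>. For a Kropina metric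
  \<open>Q\<^sup>i = A b\<^sup>i - F/2 s\<^sup>i\<^sub>0 - C y\<^sup>i\<close> with \<open>A = (F s\<^sub>0 + r\<^sub>0\<^sub>0)/(2 b\<^sup>2)\<close> and \<open>C = (s\<^sub>0 + r\<^sub>0\<^sub>0/F)/b\<^sup>2\<close>, and
  \<open>T = (s\<^sub>0 + r\<^sub>0)/b\<^sup>2 - (n+1) C\<close>. Since \<open>\<delta>F = 0\<close>, neither \<open>\<delta>T\<close> nor \<open>W\<close> involves \<open>\<beta>\<close>, and two
  differentiations in \<open>y\<close> give the formula.
\<close>

section \<open>Smooth functions\<close>

text \<open>The explicit \<open>Q\<close> is verified, not derived: the fundamental tensor is
  invertible, so the spray is the only solution of a linear system, and no formula for the inverse
  tensor is required. The Hessian of \<open>F\<close> in y annihilates y and so leaves the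
  coefficient \<open>C\<close> of y open; the radial equation fixes it as \<open>2 A / F\<close>.
  Christoffel symbols are not tensorial and would swamp the coordinate definitions. They are
  absorbed into horizontal derivatives before any Kropina formula enters: on a tensor contracted
  with y, such a derivative is the contracted covariant derivative. The form \<beta> disappears from
  T and from W for different reasons. The derivative of T is taken along the full spray, for which
  \<open>F\<close> behaves like a constant. W is built with the connection alone, along which
  \<open>F\<close> varies through \<beta>; its divergence and its quadratic trace each contain
  \<beta>, and only their difference does not. The closing identity is too large to be normalised at
  once. Tensors become real variables, 1/F and 1/b^2 become letters, and the two sides are compared
  coefficient by coefficient in the derivatives of \<open>F\<close>.\<close>

abbreviation dd :: "('a::real_normed_vector \<Rightarrow> 'b::real_normed_vector) \<Rightarrow> 'a \<Rightarrow> 'a \<Rightarrow> 'b" where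
  "dd f x v \<equiv> frechet_derivative f (at x) v"

lemma dd_eqI: "(f has_derivative D) (at x) \<Longrightarrow> dd f x v = D v"
  using frechet_derivative_at[of f D x] by simp

text \<open>Holds even where \<open>f\<close> has no derivative: \<open>frechet_derivative\<close>
  is a choice among the derivatives, and \<open>f\<close> and \<open>g\<close> have the same
  ones.\<close>

lemma frechet_derivative_transform_open:
  assumes "open S" "x \<in> S" "\<And>z. z \<in> S \<Longrightarrow> f z = g z"
  shows "frechet_derivative f (at x) = frechet_derivative g (at x)"
proof -
  have "(f has_derivative D) (at x) \<longleftrightarrow> (g has_derivative D) (at x)" for D
    using assms has_derivative_transform_within_open[of f D x UNIV S g]
      has_derivative_transform_within_open[of g D x UNIV S f] by auto
  then show ?thesis unfolding frechet_derivative_def by simp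
qed

lemma differentiable_transform_open:
  assumes "f differentiable (at x)" "open S" "x \<in> S" "\<And>z. z \<in> S \<Longrightarrow> f z = g z"
  shows "g differentiable (at x)"
  using assms has_derivative_transform_within_open[of f _ x UNIV S g] unfolding differentiable_def by blast

lemma Ck_on_cong:
  assumes "open S" "\<And>z. z \<in> S \<Longrightarrow> f z = g z" "Ck_on k S f"
  shows "Ck_on k S g"
  using assms(2,3)
proof (induction k arbitrary: f g)
  case 0
  then show ?case by (simp cong: continuous_on_cong)
next
  case (Suc k)
  have eq: "dd f x v = dd g x v" if "x \<in> S" for x v
    using frechet_derivative_transform_open[OF assms(1) that, of f g] Suc.prems(1) by simp
  show ?case
  proof (simp, intro conjI ballI allI)
    fix x assume "x \<in> S"
    then show "g differentiable at x"
      using Suc.prems differentiable_transform_open[OF _ assms(1), of f x g] by simp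
  next
    fix v
    show "Ck_on k S (\<lambda>x. dd g x v)"
      by (rule Suc.IH[of "\<lambda>x. dd f x v"]) (use eq Suc.prems in auto)
  qed
qed

lemma Ck_on_Suc_imp: "Ck_on (Suc k) S f \<Longrightarrow> Ck_on k S f"
proof (induction k arbitrary: f)
  case 0
  then show ?case
    by (auto intro!: differentiable_imp_continuous_on simp: differentiable_on_def differentiable_at_withinI)
next
  case (Suc k)
  show ?case
  proof (subst Ck_on.simps(2), intro conjI ballI allI)
    fix v
    show "Ck_on k S (\<lambda>x. dd f x v)"
      by (rule Suc.IH) (use Suc.prems in auto)
  qed (use Suc.prems in simp)
qed

lemma Ck_on_const: "Ck_on k S (\<lambda>x. c)"
  by (induction k arbitrary: c) auto

lemma Ck_on_bounded_linear:
  assumes "bounded_linear L" shows "Ck_on k S L"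
proof (cases k)
  case 0
  then show ?thesis using assms by (simp add: linear_continuous_on)
next
  case (Suc m)
  have "dd L x v = L v" for x v
    by (rule dd_eqI) (rule bounded_linear_imp_has_derivative[OF assms])
  then show ?thesis using Suc
    by (simp add: Ck_on_const bounded_linear_imp_differentiable[OF assms])
qed

lemma Ck_on_linear_compose:
  assumes "open S" "bounded_linear L" "Ck_on k S f"
  shows "Ck_on k S (\<lambda>x. L (f x))"
  using assms(3)
proof (induction k arbitrary: f)
  case 0
  then show ?case by (simp add: bounded_linear.continuous_on[OF assms(2)])
next
  case (Suc k)
  have D: "((\<lambda>x. L (f x)) has_derivative (\<lambda>v. L (dd f x v))) (at x)" if "x \<in> S" for x
    using Suc.prems that by (auto intro!: bounded_linear.has_derivative[OF assms(2)] simp: frechet_derivative_works[symmetric])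
  show ?case
  proof (simp, intro conjI ballI allI)
    fix x assume "x \<in> S"
    then show "(\<lambda>x. L (f x)) differentiable at x" using D unfolding differentiable_def by blast
  next
    fix v
    have "dd (\<lambda>x. L (f x)) x v = L (dd f x v)" if "x \<in> S" for x
      by (rule dd_eqI) (rule D[OF that])
    then show "Ck_on k S (\<lambda>x. dd (\<lambda>x. L (f x)) x v)"
      by (intro Ck_on_cong[OF assms(1) _ Suc.IH[of "\<lambda>x. dd f x v"]]) (use Suc.prems in auto)
  qed
qed

text \<open>For a linear inner map the derivative of the composite is again a composite with the
  same inner map, so the induction closes without a general chain rule. It serves to pull fields on
  the base back along \<open>fst\<close>.\<close>

lemma Ck_on_compose_linear:
  assumes "open S" "open T" "bounded_linear L" "L ` S \<subseteq> T" "Ck_on k T f"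
  shows "Ck_on k S (\<lambda>x. f (L x))"
  using assms(5)
proof (induction k arbitrary: f)
  case 0
  then show ?case using assms(3,4)
    by (simp add: continuous_on_compose2[of T f S L] linear_continuous_on)
next
  case (Suc k)
  have D: "((\<lambda>x. f (L x)) has_derivative (\<lambda>v. dd f (L x) (L v))) (at x)" if "x \<in> S" for x
  proof -
    have "(f has_derivative dd f (L x)) (at (L x))"
      using Suc.prems that assms(4) by (auto simp: frechet_derivative_works[symmetric])
    then show ?thesis
      by (rule has_derivative_compose[OF bounded_linear_imp_has_derivative[OF assms(3)]])
  qed
  show ?case
  proof (simp, intro conjI ballI allI)
    fix x assume "x \<in> S"
    then show "(\<lambda>x. f (L x)) differentiable at x" using D unfolding differentiable_def by blast
  next
    fix v
    have "dd (\<lambda>x. f (L x)) x v = dd f (L x) (L v)" if "x \<in> S" for x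
      by (rule dd_eqI) (rule D[OF that])
    then show "Ck_on k S (\<lambda>x. dd (\<lambda>x. f (L x)) x v)"
      by (intro Ck_on_cong[OF assms(1) _ Suc.IH[of "\<lambda>x. dd f x (L v)"]]) (use Suc.prems in auto)
  qed
qed

lemma dd_add:
  "f differentiable at x \<Longrightarrow> g differentiable at x \<Longrightarrow> dd (\<lambda>x. f x + g x) x v = dd f x v + dd g x v"
  by (rule dd_eqI) (auto intro!: has_derivative_add simp: frechet_derivative_works[symmetric])

lemma dd_diff:
  "f differentiable at x \<Longrightarrow> g differentiable at x \<Longrightarrow> dd (\<lambda>x. f x - g x) x v = dd f x v - dd g x v"
  by (rule dd_eqI) (auto intro!: has_derivative_diff simp: frechet_derivative_works[symmetric])

lemma dd_mult:
  fixes f g :: "'a::real_normed_vector \<Rightarrow> real"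
  assumes "f differentiable at x" "g differentiable at x"
  shows "dd (\<lambda>x. f x * g x) x v = f x * dd g x v + dd f x v * g x"
  by (rule dd_eqI) (rule has_derivative_mult[OF assms[unfolded frechet_derivative_works]])

text \<open>Written with two copies of the inverse itself, so that the induction for
  \<open>Ck_on_inverse\<close> can feed its own hypothesis into the product rule.\<close>

lemma dd_inverse:
  fixes f :: "'a::real_normed_vector \<Rightarrow> real"
  assumes "f differentiable at x" "f x \<noteq> 0"
  shows "dd (\<lambda>x. inverse (f x)) x v = - (dd f x v * (inverse (f x) * inverse (f x)))"
  by (subst dd_eqI[OF Deriv.has_derivative_inverse[OF assms(2) assms(1)[unfolded frechet_derivative_works]]])
    (simp add: mult_ac)

lemma dd_divide:
  fixes f g :: "'a::real_normed_vector \<Rightarrow> real"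
  assumes "f differentiable at x" "g differentiable at x" "g x \<noteq> 0"
  shows "dd (\<lambda>x. f x / g x) x v = dd f x v / g x - f x * dd g x v / (g x)\<^sup>2"
proof -
  have "(\<lambda>x. inverse (g x)) differentiable at x" using assms(2,3) by simp
  from dd_mult[OF assms(1) this] show ?thesis
    using dd_inverse[OF assms(2,3), of v] by (simp add: field_simps power2_eq_square)
qed

lemma dd_sum:
  assumes "\<And>i. i \<in> I \<Longrightarrow> (f i) differentiable at x"
  shows "dd (\<lambda>x. \<Sum>i\<in>I. f i x) x v = (\<Sum>i\<in>I. dd (f i) x v)"
  by (rule dd_eqI) (use assms in \<open>auto intro!: has_derivative_sum simp: frechet_derivative_works[symmetric]\<close>)

lemma dd_const: "dd (\<lambda>x. c) x v = 0"
  by simp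

lemma dd_diff_dir: "f differentiable at x \<Longrightarrow> dd f x (u - v) = dd f x u - dd f x v"
  by (simp add: linear_diff linear_frechet_derivative)

lemma dd_scale_dir: "f differentiable at x \<Longrightarrow> dd f x (c *\<^sub>R u) = c *\<^sub>R dd f x u"
  by (simp add: linear_cmul linear_frechet_derivative)

lemma dd_sum_dir: "f differentiable at x \<Longrightarrow> dd f x (\<Sum>i\<in>I. u i) = (\<Sum>i\<in>I. dd f x (u i))"
  by (simp add: linear_sum linear_frechet_derivative)

lemma Ck_on_add:
  assumes "open S" "Ck_on k S f" "Ck_on k S g"
  shows "Ck_on k S (\<lambda>x. f x + g x)"
  using assms(2,3)
proof (induction k arbitrary: f g)
  case 0
  then show ?case by (simp add: continuous_on_add)
next
  case (Suc k)
  show ?case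
  proof (simp, intro conjI ballI allI)
    fix v
    show "Ck_on k S (\<lambda>x. dd (\<lambda>x. f x + g x) x v)"
      by (rule Ck_on_cong[OF assms(1) _ Suc.IH[of "\<lambda>x. dd f x v" "\<lambda>x. dd g x v"]])
        (use Suc.prems in \<open>auto simp: dd_add\<close>)
  qed (use Suc.prems in auto)
qed

lemma Ck_on_mult:
  fixes f g :: "'a::real_normed_vector \<Rightarrow> real"
  assumes "open S" "Ck_on k S f" "Ck_on k S g"
  shows "Ck_on k S (\<lambda>x. f x * g x)"
  using assms(2,3)
proof (induction k arbitrary: f g)
  case 0
  then show ?case by (simp add: continuous_on_mult)
next
  case (Suc k)
  show ?case
  proof (simp, intro conjI ballI allI)
    fix v
    show "Ck_on k S (\<lambda>x. dd (\<lambda>x. f x * g x) x v)"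
      by (rule Ck_on_cong[OF assms(1) _ Ck_on_add[OF assms(1) Suc.IH[of f "\<lambda>x. dd g x v"]
              Suc.IH[of "\<lambda>x. dd f x v" g]]])
        (use Suc.prems Ck_on_Suc_imp[of k S f] Ck_on_Suc_imp[of k S g] in \<open>auto simp: dd_mult\<close>)
  qed (use Suc.prems in auto)
qed

lemma Ck_on_inverse:
  fixes f :: "'a::real_normed_vector \<Rightarrow> real"
  assumes "open S" "Ck_on k S f" "\<And>x. x \<in> S \<Longrightarrow> f x \<noteq> 0"
  shows "Ck_on k S (\<lambda>x. inverse (f x))"
  using assms(2,3)
proof (induction k arbitrary: f)
  case 0
  then show ?case by (simp add: continuous_on_inverse)
next
  case (Suc k)
  show ?case
  proof (simp, intro conjI ballI allI)
    fix v
    have i: "Ck_on k S (\<lambda>x. inverse (f x))"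
      using Suc Ck_on_Suc_imp[of k S f] by blast
    have m: "Ck_on k S (\<lambda>x. (-1) * dd f x v)"
      by (rule Ck_on_mult[OF assms(1) Ck_on_const]) (use Suc.prems in simp)
    show "Ck_on k S (\<lambda>x. dd (\<lambda>x. inverse (f x)) x v)"
      by (rule Ck_on_cong[OF assms(1) _ Ck_on_mult[OF assms(1) m Ck_on_mult[OF assms(1) i i]]])
        (use Suc.prems in \<open>auto simp: dd_inverse\<close>)
  qed (use Suc.prems in auto)
qed

section \<open>Closure properties of smooth functions\<close>

lemma smooth_on_cong: "open S \<Longrightarrow> smooth_on S f \<Longrightarrow> (\<And>z. z \<in> S \<Longrightarrow> f z = g z) \<Longrightarrow> smooth_on S g"
  unfolding smooth_on_def by (auto intro: Ck_on_cong[of S f g])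

lemma smooth_on_differentiable: "smooth_on S f \<Longrightarrow> x \<in> S \<Longrightarrow> f differentiable at x"
  using Ck_on.simps(2)[of 0 S f] unfolding smooth_on_def by metis

lemma smooth_on_dd: "smooth_on S f \<Longrightarrow> smooth_on S (\<lambda>x. dd f x v)"
  unfolding smooth_on_def
proof
  fix k assume "\<forall>k. Ck_on k S f"
  then have "Ck_on (Suc k) S f" by blast
  then show "Ck_on k S (\<lambda>x. dd f x v)" by simp
qed

lemma smooth_on_const: "smooth_on S (\<lambda>x. c)"
  by (simp add: smooth_on_def Ck_on_const)

lemma smooth_on_bounded_linear: "bounded_linear L \<Longrightarrow> smooth_on S L"
  by (simp add: smooth_on_def Ck_on_bounded_linear)

lemma smooth_on_add: "open S \<Longrightarrow> smooth_on S f \<Longrightarrow> smooth_on S g \<Longrightarrow> smooth_on S (\<lambda>x. f x + g x)"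
  by (simp add: smooth_on_def Ck_on_add)

lemma smooth_on_mult:
  fixes f g :: "'a::real_normed_vector \<Rightarrow> real"
  shows "open S \<Longrightarrow> smooth_on S f \<Longrightarrow> smooth_on S g \<Longrightarrow> smooth_on S (\<lambda>x. f x * g x)"
  by (simp add: smooth_on_def Ck_on_mult)

lemma smooth_on_minus:
  fixes f :: "'a::real_normed_vector \<Rightarrow> real"
  shows "open S \<Longrightarrow> smooth_on S f \<Longrightarrow> smooth_on S (\<lambda>x. - f x)"
  using smooth_on_mult[OF _ smooth_on_const[of S "-1"], of f] by simp

lemma smooth_on_diff:
  fixes f g :: "'a::real_normed_vector \<Rightarrow> real"
  shows "open S \<Longrightarrow> smooth_on S f \<Longrightarrow> smooth_on S g \<Longrightarrow> smooth_on S (\<lambda>x. f x - g x)"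
  using smooth_on_add[of S f "\<lambda>x. - g x"] smooth_on_minus[of S g] by simp

lemma smooth_on_divide:
  fixes f g :: "'a::real_normed_vector \<Rightarrow> real"
  shows "open S \<Longrightarrow> smooth_on S f \<Longrightarrow> smooth_on S g \<Longrightarrow> (\<And>x. x \<in> S \<Longrightarrow> g x \<noteq> 0) \<Longrightarrow>
    smooth_on S (\<lambda>x. f x / g x)"
  using smooth_on_mult[of S f "\<lambda>x. inverse (g x)"] by (simp add: smooth_on_def Ck_on_inverse divide_inverse)

lemma smooth_on_sum: "open S \<Longrightarrow> (\<And>i. i \<in> I \<Longrightarrow> smooth_on S (f i)) \<Longrightarrow> smooth_on S (\<lambda>x. \<Sum>i\<in>I. f i x)"
  by (induction I rule: infinite_finite_induct) (auto simp: smooth_on_const intro!: smooth_on_add)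

lemma smooth_on_prod:
  fixes f :: "'i \<Rightarrow> 'a::real_normed_vector \<Rightarrow> real"
  shows "open S \<Longrightarrow> (\<And>i. i \<in> I \<Longrightarrow> smooth_on S (f i)) \<Longrightarrow> smooth_on S (\<lambda>x. \<Prod>i\<in>I. f i x)"
  by (induction I rule: infinite_finite_induct) (auto simp: smooth_on_const intro!: smooth_on_mult)

lemma smooth_on_nth: "open S \<Longrightarrow> smooth_on S f \<Longrightarrow> smooth_on S (\<lambda>x. f x $ i)"
  unfolding smooth_on_def using Ck_on_linear_compose[where L="\<lambda>x. x $ i", OF _ bounded_linear_vec_nth] by auto

lemma smooth_on_fst: "open S \<Longrightarrow> open T \<Longrightarrow> fst ` T \<subseteq> S \<Longrightarrow> smooth_on S f \<Longrightarrow> smooth_on T (\<lambda>p. f (fst p))"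
  unfolding smooth_on_def by (simp add: Ck_on_compose_linear[where T=S] bounded_linear_fst)

lemma smooth_on_det:
  fixes A :: "'a::real_normed_vector \<Rightarrow> real^'n^'n"
  assumes "open S" "\<And>i j. smooth_on S (\<lambda>x. A x $ i $ j)"
  shows "smooth_on S (\<lambda>x. det (A x))"
  unfolding det_def
  by (intro smooth_on_sum smooth_on_mult smooth_on_prod smooth_on_const assms)

lemma matrix_inv_works:
  assumes "invertible A"
  shows "A ** matrix_inv A = mat 1" "matrix_inv A ** A = mat 1"
  using someI_ex[OF assms[unfolded invertible_def]] unfolding matrix_inv_def by simp_all

text \<open>Cramer's rule: the entries of the inverse are quotients of determinants, and
  determinants are polynomials in the entries.\<close>

lemma smooth_on_matrix_inv:
  fixes A :: "'a::real_normed_vector \<Rightarrow> real^'n^'n"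
  assumes "open S" "\<And>i j. smooth_on S (\<lambda>x. A x $ i $ j)" "\<And>x. x \<in> S \<Longrightarrow> invertible (A x)"
  shows "smooth_on S (\<lambda>x. matrix_inv (A x) $ i $ j)"
proof -
  \<comment> \<open>Column \<open>i\<close> is replaced by the unit vector \<open>axis j 1\<close>,
    because column \<open>j\<close> of the inverse solves the system with that right-hand
    side.\<close>
  define B where "B x = (\<chi> p q. if q = i then axis j 1 $ p else A x $ p $ q)" for x
  have eq: "det (B x) / det (A x) = matrix_inv (A x) $ i $ j" if "x \<in> S" for x
  proof -
    have "det (A x) \<noteq> 0" using assms(3)[OF that] invertible_det_nz by blast
    moreover have "A x *v (matrix_inv (A x) *v axis j 1) = axis j 1"
      using matrix_inv_works(1)[OF assms(3)[OF that]] by (simp add: matrix_vector_mul_assoc)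
    ultimately have "matrix_inv (A x) *v axis j 1 = (\<chi> k. det (\<chi> p q. if q = k then axis j 1 $ p else A x $ p $ q) / det (A x))"
      by (rule iffD1[OF cramer])
    then have "(matrix_inv (A x) *v axis j 1) $ i = det (B x) / det (A x)" unfolding B_def by simp
    moreover have "(matrix_inv (A x) *v axis j 1) $ i = matrix_inv (A x) $ i $ j"
      by (simp add: matrix_vector_mul_component inner_axis)
    ultimately show ?thesis by simp
  qed
  have sB: "smooth_on S (\<lambda>x. B x $ p $ q)" for p q
    using assms(2) by (cases "q = i") (auto simp: B_def smooth_on_const)
  show ?thesis
    by (rule smooth_on_cong[OF assms(1) _ eq])
      (use assms(3) in \<open>auto intro!: smooth_on_divide smooth_on_det assms(1,2) sB dest: invertible_det_nz[THEN iffD1]\<close>)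
qed

section \<open>Symmetry of second derivatives\<close>

lemma MVT_dir:
  fixes g :: "real \<Rightarrow> real"
  assumes "0 < h" "\<And>t. 0 \<le> t \<Longrightarrow> t \<le> h \<Longrightarrow> (g has_real_derivative g' t) (at t)"
  obtains t where "0 < t" "t < h" "g h - g 0 = h * g' t"
  using MVT2[OF assms(1), of g g'] assms(2) by auto

lemma dd_has_real_derivative_line:
  fixes f :: "'a::real_normed_vector \<Rightarrow> real"
  assumes "f differentiable at (x + t *\<^sub>R u)"
  shows "((\<lambda>t. f (x + t *\<^sub>R u)) has_real_derivative dd f (x + t *\<^sub>R u) u) (at t)"
proof -
  have "((\<lambda>t. f (x + t *\<^sub>R u)) has_derivative (\<lambda>s. dd f (x + t *\<^sub>R u) (s *\<^sub>R u))) (at t)"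
    by (rule has_derivative_compose[of "\<lambda>t. x + t *\<^sub>R u", OF _ assms[unfolded frechet_derivative_works]])
      (auto intro!: derivative_eq_intros)
  moreover have "(\<lambda>s. dd f (x + t *\<^sub>R u) (s *\<^sub>R u)) = (*) (dd f (x + t *\<^sub>R u) u)"
    by (simp add: fun_eq_iff dd_scale_dir[OF assms])
  ultimately show ?thesis unfolding has_field_derivative_def by simp
qed

text \<open>The mean value theorem is used twice: in direction \<open>u\<close> on the difference of
  two translates of \<open>f\<close>, then in direction \<open>v\<close> on the derivative so
  obtained. The second difference is symmetric in \<open>u\<close> and \<open>v\<close>, which
  \<open>dd_commute\<close> exploits.\<close>

lemma second_difference_MVT:
  fixes f :: "'a::real_normed_vector \<Rightarrow> real"
  assumes h: "0 < h" and B: "\<And>s t. 0 \<le> s \<Longrightarrow> s \<le> h \<Longrightarrow> 0 \<le> t \<Longrightarrow> t \<le> h \<Longrightarrow> x + s *\<^sub>R u + t *\<^sub>R v \<in> S"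
    and "smooth_on S f"
  obtains s t where "0 < s" "s < h" "0 < t" "t < h"
    "f (x + h *\<^sub>R u + h *\<^sub>R v) - f (x + h *\<^sub>R u) - f (x + h *\<^sub>R v) + f x
      = h * (h * dd (\<lambda>z. dd f z u) (x + s *\<^sub>R u + t *\<^sub>R v) v)"
proof -
  have df: "f differentiable at (x + s *\<^sub>R u + t *\<^sub>R v)" if "0 \<le> s" "s \<le> h" "0 \<le> t" "t \<le> h" for s t
    by (rule smooth_on_differentiable[OF assms(3) B[OF that]])
  have df0: "f differentiable at (x + s *\<^sub>R u)" if "0 \<le> s" "s \<le> h" for s
    using df[OF that order_refl] h by simp
  have ddf: "(\<lambda>z. dd f z u) differentiable at (x + s *\<^sub>R u + t *\<^sub>R v)" if "0 \<le> s" "s \<le> h" "0 \<le> t" "t \<le> h" for s t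
    by (rule smooth_on_differentiable[OF smooth_on_dd[OF assms(3)] B[OF that]])
  define g where "g s = f ((x + h *\<^sub>R v) + s *\<^sub>R u) - f (x + s *\<^sub>R u)" for s
  have eq: "(x + h *\<^sub>R v) + s *\<^sub>R u = x + s *\<^sub>R u + h *\<^sub>R v" for s by simp
  have "(g has_real_derivative dd f ((x + h *\<^sub>R v) + s *\<^sub>R u) u - dd f (x + s *\<^sub>R u) u) (at s)"
    if "0 \<le> s" "s \<le> h" for s
    unfolding g_def
  proof (rule DERIV_diff; rule dd_has_real_derivative_line)
    show "f differentiable at ((x + h *\<^sub>R v) + s *\<^sub>R u)"
      unfolding eq by (rule df) (use that h in auto)
    show "f differentiable at (x + s *\<^sub>R u)" by (rule df0[OF that])
  qed
  then obtain s where s: "0 < s" "s < h"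
    "g h - g 0 = h * (dd f ((x + h *\<^sub>R v) + s *\<^sub>R u) u - dd f (x + s *\<^sub>R u) u)"
    by (rule MVT_dir[OF h])
  define k where "k t = dd f (x + s *\<^sub>R u + t *\<^sub>R v) u" for t
  have "(k has_real_derivative dd (\<lambda>z. dd f z u) (x + s *\<^sub>R u + t *\<^sub>R v) v) (at t)" if "0 \<le> t" "t \<le> h" for t
    unfolding k_def by (rule dd_has_real_derivative_line) (rule ddf, use that s in auto)
  then obtain t where t: "0 < t" "t < h"
    "k h - k 0 = h * dd (\<lambda>z. dd f z u) (x + s *\<^sub>R u + t *\<^sub>R v) v"
    by (rule MVT_dir[OF h])
  have "g h - g 0 = h * (k h - k 0)"
    unfolding s(3) k_def eq by simp
  moreover have "g h - g 0 = f (x + h *\<^sub>R u + h *\<^sub>R v) - f (x + h *\<^sub>R u) - f (x + h *\<^sub>R v) + f x"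
    unfolding g_def eq by simp
  ultimately show ?thesis using that[OF s(1,2) t(1,2)] unfolding t(3) by simp
qed

text \<open>Both mixed derivatives, at suitable points near \<open>x\<close>, equal the same second
  difference divided by the square of \<open>h\<close>. Continuity of the two at \<open>x\<close>
  then rules out a gap between their values there.\<close>

lemma dd_commute:
  fixes f :: "'a::real_normed_vector \<Rightarrow> real"
  assumes "open S" "smooth_on S f" "x \<in> S"
  shows "dd (\<lambda>z. dd f z u) x v = dd (\<lambda>z. dd f z v) x u"
proof (rule ccontr)
  define p where "p z = dd (\<lambda>z. dd f z u) z v" for z
  define q where "q z = dd (\<lambda>z. dd f z v) z u" for z
  assume "dd (\<lambda>z. dd f z u) x v \<noteq> dd (\<lambda>z. dd f z v) x u"
  then have ne: "\<bar>p x - q x\<bar> > 0" by (simp add: p_def q_def)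
  have "p differentiable at x" "q differentiable at x"
    unfolding p_def q_def by (intro smooth_on_differentiable[of S] smooth_on_dd assms)+
  then have cont: "isCont p x" "isCont q x"
    by (auto dest: differentiable_imp_continuous_within)
  obtain d1 where d1: "d1 > 0" "\<And>z. dist z x < d1 \<Longrightarrow> dist (p z) (p x) < \<bar>p x - q x\<bar>/2"
    using cont(1)[unfolded continuous_at_eps_delta, rule_format, OF half_gt_zero[OF ne]] by blast
  obtain d2 where d2: "d2 > 0" "\<And>z. dist z x < d2 \<Longrightarrow> dist (q z) (q x) < \<bar>p x - q x\<bar>/2"
    using cont(2)[unfolded continuous_at_eps_delta, rule_format, OF half_gt_zero[OF ne]] by blast
  obtain e where e: "e > 0" "ball x e \<subseteq> S" using assms(1,3) openE by blast
  define d where "d = min e (min d1 d2)"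
  have dpos: "d > 0" using e d1(1) d2(1) by (simp add: d_def)
  \<comment> \<open>Small enough that the parallelogram spanned at \<open>x\<close> by
    \<open>h *\<^sub>R u\<close> and \<open>h *\<^sub>R v\<close> stays within distance
    \<open>d\<close>; the summand 1 covers vanishing \<open>u\<close> and \<open>v\<close>.\<close>
  define h where "h = d / (2 * (norm u + norm v + 1))"
  have np: "norm u + norm v + 1 > 0" by (simp add: add_nonneg_pos)
  have h: "h > 0" unfolding h_def using dpos np by simp
  have near: "dist (x + s *\<^sub>R u + t *\<^sub>R v) x < d" if "0 \<le> s" "s \<le> h" "0 \<le> t" "t \<le> h" for s t
  proof -
    have "dist (x + s *\<^sub>R u + t *\<^sub>R v) x = norm (s *\<^sub>R u + t *\<^sub>R v)" by (simp add: dist_norm add.assoc)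
    also have "\<dots> \<le> norm (s *\<^sub>R u) + norm (t *\<^sub>R v)" by (rule norm_triangle_ineq)
    also have "\<dots> = s * norm u + t * norm v" using that by simp
    also have "\<dots> \<le> h * norm u + h * norm v" using that by (intro add_mono mult_right_mono) auto
    also have "\<dots> < h * (norm u + norm v + 1) * 2"
    proof -
      have "0 \<le> h * norm u" "0 \<le> h * norm v" using h by simp_all
      then have "0 < h + (h * norm u + h * norm v + h)"
        using h by (intro add_pos_nonneg add_nonneg_nonneg) auto
      then show ?thesis by (simp add: algebra_simps)
    qed
    also have "\<dots> = d" unfolding h_def using np by (simp add: field_simps)
    finally show ?thesis .
  qed
  have S: "x + s *\<^sub>R u + t *\<^sub>R v \<in> S" if "0 \<le> s" "s \<le> h" "0 \<le> t" "t \<le> h" for s t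
    using near[OF that] e(2) by (auto simp: d_def dist_commute mem_ball)
  obtain s t where st: "0 < s" "s < h" "0 < t" "t < h"
    "f (x + h *\<^sub>R u + h *\<^sub>R v) - f (x + h *\<^sub>R u) - f (x + h *\<^sub>R v) + f x = h * (h * p (x + s *\<^sub>R u + t *\<^sub>R v))"
    unfolding p_def by (rule second_difference_MVT[OF h S assms(2)])
  have S': "x + s *\<^sub>R v + t *\<^sub>R u \<in> S" if "0 \<le> s" "s \<le> h" "0 \<le> t" "t \<le> h" for s t
    using S[OF that(3,4,1,2)] by (simp add: add.commute add.left_commute)
  obtain s' t' where st': "0 < s'" "s' < h" "0 < t'" "t' < h"
    "f (x + h *\<^sub>R v + h *\<^sub>R u) - f (x + h *\<^sub>R v) - f (x + h *\<^sub>R u) + f x = h * (h * q (x + s' *\<^sub>R v + t' *\<^sub>R u))"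
    unfolding q_def by (rule second_difference_MVT[OF h S' assms(2)])
  have "h * (h * p (x + s *\<^sub>R u + t *\<^sub>R v)) = h * (h * q (x + s' *\<^sub>R v + t' *\<^sub>R u))"
  proof -
    have "f (x + h *\<^sub>R v + h *\<^sub>R u) = f (x + h *\<^sub>R u + h *\<^sub>R v)" by (simp add: add.commute add.left_commute)
    then show ?thesis using st(5) st'(5) by linarith
  qed
  then have "p (x + s *\<^sub>R u + t *\<^sub>R v) = q (x + s' *\<^sub>R v + t' *\<^sub>R u)" using h by simp
  moreover have "dist (p (x + s *\<^sub>R u + t *\<^sub>R v)) (p x) < \<bar>p x - q x\<bar>/2"
    by (rule d1(2)) (use near[of s t] st in \<open>auto simp: d_def\<close>)
  moreover have "dist (q (x + s' *\<^sub>R v + t' *\<^sub>R u)) (q x) < \<bar>p x - q x\<bar>/2"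
    by (rule d2(2)) (use near[of t' s'] st' in \<open>auto simp: d_def add.commute add.left_commute\<close>)
  \<comment> \<open>The common value would lie within half the gap of both ends, against the
    triangle inequality.\<close>
  moreover have "False" if "\<bar>c - a\<bar> < \<bar>a - b\<bar> / 2" "\<bar>c - b\<bar> < \<bar>a - b\<bar> / 2" for a b c :: real
    using that abs_triangle_ineq4[of "a - c" "b - c"] by (simp add: abs_minus_commute)
  ultimately show False unfolding dist_real_def by metis
qed

section \<open>Partial derivatives on the tangent bundle\<close>

text \<open>Functions on the tangent bundle are taken on pairs of a base point and a fibre vector, so that
  the partial derivatives commute by symmetry of the second derivative.\<close>

definition dx :: "'n::finite \<Rightarrow> ((real^'n) \<times> (real^'n) \<Rightarrow> real) \<Rightarrow> (real^'n) \<times> (real^'n) \<Rightarrow> real" where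
  "dx i f p = dd f p (axis i 1, 0)"

definition dy :: "'n::finite \<Rightarrow> ((real^'n) \<times> (real^'n) \<Rightarrow> real) \<Rightarrow> (real^'n) \<times> (real^'n) \<Rightarrow> real" where
  "dy i f p = dd f p (0, axis i 1)"

lemma pd_fst:
  assumes "f differentiable at (x, y)"
  shows "pd i (\<lambda>z. f (z, y)) x = dx i f (x, y)"
proof -
  have "((\<lambda>z. f (z, y)) has_derivative (\<lambda>u. dd f (x, y) (u, 0))) (at x)"
    by (rule has_derivative_compose[of "\<lambda>z. (z, y)", OF _ assms[unfolded frechet_derivative_works]])
      (auto intro!: derivative_eq_intros)
  from dd_eqI[OF this] show ?thesis by (simp add: pd_def dx_def)
qed

lemma pd_snd:
  assumes "f differentiable at (x, y)"
  shows "pd i (\<lambda>w. f (x, w)) y = dy i f (x, y)"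
proof -
  have "((\<lambda>w. f (x, w)) has_derivative (\<lambda>u. dd f (x, y) (0, u))) (at y)"
    by (rule has_derivative_compose[of "\<lambda>w. (x, w)", OF _ assms[unfolded frechet_derivative_works]])
      (auto intro!: derivative_eq_intros)
  from dd_eqI[OF this] show ?thesis by (simp add: pd_def dy_def)
qed

lemma open_section_fst: "open (S :: ('a::topological_space \<times> 'b::topological_space) set) \<Longrightarrow> open {z. (z, y) \<in> S}"
  using open_vimage[of S "\<lambda>z. (z, y)"] by (simp add: vimage_def continuous_on_Pair)

lemma open_section_snd: "open (S :: ('a::topological_space \<times> 'b::topological_space) set) \<Longrightarrow> open {w. (x, w) \<in> S}"
  using open_vimage[of S "\<lambda>w. (x, w)"] by (simp add: vimage_def continuous_on_Pair)

text \<open>Agreement on a slice of \<open>S\<close> suffices because slices of open sets are open.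
  The curvature definitions nest \<open>pd\<close> around functions that are identified only on the
  domain, so this form is the one that can be iterated.\<close>

lemma pd_fst_on:
  assumes "open S" "(x, y) \<in> S" "smooth_on S f" "\<And>z. (z, y) \<in> S \<Longrightarrow> g z = f (z, y)"
  shows "pd i g x = dx i f (x, y)"
proof -
  have "pd i g x = pd i (\<lambda>z. f (z, y)) x"
    unfolding pd_def using frechet_derivative_transform_open[OF open_section_fst[OF assms(1), of y], of x g] assms(2,4) by simp
  then show ?thesis using pd_fst[OF smooth_on_differentiable[OF assms(3,2)]] by simp
qed

lemma pd_snd_on:
  assumes "open S" "(x, y) \<in> S" "smooth_on S f" "\<And>w. (x, w) \<in> S \<Longrightarrow> g w = f (x, w)"
  shows "pd i g y = dy i f (x, y)"
proof -
  have "pd i g y = pd i (\<lambda>w. f (x, w)) y"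
    unfolding pd_def using frechet_derivative_transform_open[OF open_section_snd[OF assms(1), of x], of y g] assms(2,4) by simp
  then show ?thesis using pd_snd[OF smooth_on_differentiable[OF assms(3,2)]] by simp
qed

lemma dx_cong: "open S \<Longrightarrow> p \<in> S \<Longrightarrow> (\<And>q. q \<in> S \<Longrightarrow> f q = g q) \<Longrightarrow> dx i f p = dx i g p"
  unfolding dx_def using frechet_derivative_transform_open by metis

lemma dy_cong: "open S \<Longrightarrow> p \<in> S \<Longrightarrow> (\<And>q. q \<in> S \<Longrightarrow> f q = g q) \<Longrightarrow> dy i f p = dy i g p"
  unfolding dy_def using frechet_derivative_transform_open by metis

lemma smooth_on_dx: "smooth_on S f \<Longrightarrow> smooth_on S (dx i f)"
  unfolding dx_def[abs_def] by (rule smooth_on_dd)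

lemma smooth_on_dy: "smooth_on S f \<Longrightarrow> smooth_on S (dy i f)"
  unfolding dy_def[abs_def] by (rule smooth_on_dd)

lemma dx_dy: "open S \<Longrightarrow> smooth_on S f \<Longrightarrow> p \<in> S \<Longrightarrow> dy j (dx i f) p = dx i (dy j f) p"
  unfolding dy_def[abs_def] dx_def[abs_def] by (rule dd_commute)

lemma dy_dy: "open S \<Longrightarrow> smooth_on S f \<Longrightarrow> p \<in> S \<Longrightarrow> dy j (dy i f) p = dy i (dy j f) p"
  unfolding dy_def[abs_def] by (rule dd_commute)

lemma dx_add: "f differentiable at p \<Longrightarrow> g differentiable at p \<Longrightarrow> dx i (\<lambda>p. f p + g p) p = dx i f p + dx i g p"
  unfolding dx_def by (rule dd_add)

lemma dx_diff: "f differentiable at p \<Longrightarrow> g differentiable at p \<Longrightarrow> dx i (\<lambda>p. f p - g p) p = dx i f p - dx i g p"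
  unfolding dx_def by (rule dd_diff)

lemma dx_mult: "f differentiable at p \<Longrightarrow> g differentiable at p \<Longrightarrow> dx i (\<lambda>p. f p * g p) p = f p * dx i g p + dx i f p * g p"
  unfolding dx_def by (rule dd_mult)

lemma dx_divide: "f differentiable at p \<Longrightarrow> g differentiable at p \<Longrightarrow> g p \<noteq> 0 \<Longrightarrow> dx i (\<lambda>p. f p / g p) p = dx i f p / g p - f p * dx i g p / (g p)\<^sup>2"
  unfolding dx_def by (rule dd_divide)

lemma dx_sum: "(\<And>j. j \<in> J \<Longrightarrow> f j differentiable at p) \<Longrightarrow> dx i (\<lambda>p. \<Sum>j\<in>J. f j p) p = (\<Sum>j\<in>J. dx i (f j) p)"
  unfolding dx_def by (rule dd_sum)

lemma dx_const: "dx i (\<lambda>p. c) p = 0"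
  unfolding dx_def by (rule dd_const)

lemma dy_add: "f differentiable at p \<Longrightarrow> g differentiable at p \<Longrightarrow> dy i (\<lambda>p. f p + g p) p = dy i f p + dy i g p"
  unfolding dy_def by (rule dd_add)

lemma dy_diff: "f differentiable at p \<Longrightarrow> g differentiable at p \<Longrightarrow> dy i (\<lambda>p. f p - g p) p = dy i f p - dy i g p"
  unfolding dy_def by (rule dd_diff)

lemma dy_mult: "f differentiable at p \<Longrightarrow> g differentiable at p \<Longrightarrow> dy i (\<lambda>p. f p * g p) p = f p * dy i g p + dy i f p * g p"
  unfolding dy_def by (rule dd_mult)

lemma dy_divide: "f differentiable at p \<Longrightarrow> g differentiable at p \<Longrightarrow> g p \<noteq> 0 \<Longrightarrow> dy i (\<lambda>p. f p / g p) p = dy i f p / g p - f p * dy i g p / (g p)\<^sup>2"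
  unfolding dy_def by (rule dd_divide)

lemma dy_sum: "(\<And>j. j \<in> J \<Longrightarrow> f j differentiable at p) \<Longrightarrow> dy i (\<lambda>p. \<Sum>j\<in>J. f j p) p = (\<Sum>j\<in>J. dy i (f j) p)"
  unfolding dy_def by (rule dd_sum)

lemma dy_const: "dy i (\<lambda>p. c) p = 0"
  unfolding dy_def by (rule dd_const)

lemmas dx_simps = dx_add dx_diff dx_mult dx_divide dx_sum dx_const
lemmas dy_simps = dy_add dy_diff dy_mult dy_divide dy_sum dy_const

section \<open>The Ricci curvature tensor of a spray\<close>

lemma smooth_on_snd_nth: "smooth_on S (\<lambda>p. snd p $ i)"
  by (rule smooth_on_bounded_linear)
    (rule bounded_linear_compose[OF bounded_linear_vec_nth bounded_linear_snd])

lemma differentiable_snd_nth [simp]: "(\<lambda>p. snd p $ i) differentiable at p"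
  by (rule smooth_on_differentiable[OF smooth_on_snd_nth[of UNIV]]) simp

lemma dd_snd_nth: "dd (\<lambda>p. snd p $ i) p v = snd v $ i"
  by (rule dd_eqI, rule bounded_linear_imp_has_derivative)
    (rule bounded_linear_compose[OF bounded_linear_vec_nth bounded_linear_snd])

lemma dx_snd_nth: "dx j (\<lambda>p. snd p $ i) p = 0"
  by (simp add: dx_def dd_snd_nth)

lemma dy_snd_nth: "dy j (\<lambda>p. snd p $ i) p = (if i = j then 1 else 0)"
  by (simp add: dy_def dd_snd_nth axis_def)

locale smooth_spray =
  fixes \<Omega> :: "((real^'n::finite) \<times> (real^'n)) set" and G :: "'n \<Rightarrow> (real^'n) \<times> (real^'n) \<Rightarrow> real"
  assumes open_dom: "open \<Omega>" and smooth_G: "smooth_on \<Omega> (G i)"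
begin

definition N :: "'n \<Rightarrow> 'n \<Rightarrow> (real^'n) \<times> (real^'n) \<Rightarrow> real" where
  "N i k = dy k (G i)"

definition R :: "'n \<Rightarrow> 'n \<Rightarrow> (real^'n) \<times> (real^'n) \<Rightarrow> real" where
  "R i k p = 2 * dx k (G i) p - (\<Sum>j\<in>UNIV. snd p $ j * dx j (N i k) p)
     + 2 * (\<Sum>j\<in>UNIV. G j p * dy j (N i k) p) - (\<Sum>j\<in>UNIV. N i j p * N j k p)"

text \<open>\<open>X\<close> is the trace of the curvature of the nonlinear connection \<open>N\<close>. It arises as a third of
  \<open>\<partial>R\<^sup>m\<^sub>m/\<partial>y\<^sup>l - \<partial>R\<^sup>m\<^sub>l/\<partial>y\<^sup>m\<close>, in which the second derivatives of \<open>N\<close> cancel.\<close>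

definition X :: "'n \<Rightarrow> (real^'n) \<times> (real^'n) \<Rightarrow> real" where
  "X l p = (\<Sum>m\<in>UNIV. dx m (N m l) p - dx l (N m m) p
     + (\<Sum>j\<in>UNIV. N j l p * dy j (N m m) p - N j m p * dy j (N m l) p))"

lemma smooth_N: "smooth_on \<Omega> (N i k)"
  unfolding N_def by (intro smooth_on_dy smooth_G)

lemmas smooth_intros = smooth_on_sum smooth_on_add smooth_on_diff smooth_on_mult smooth_on_const
  smooth_on_snd_nth smooth_on_dx smooth_on_dy smooth_G smooth_N open_dom

lemma smooth_R: "smooth_on \<Omega> (R i k)"
  unfolding R_def[abs_def] by (intro smooth_intros)

lemma N_commute: "p \<in> \<Omega> \<Longrightarrow> dy l (N i k) p = dy k (N i l) p"
  unfolding N_def by (rule dy_dy[OF open_dom smooth_G])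

text \<open>The factor 3 cancels the 1/3 in the curvature tensor. Each surviving first-order term
  occurs twice in one summand and once, with opposite sign, in the summand with \<open>k\<close> and
  \<open>l\<close> exchanged; all other terms are symmetric in \<open>k\<close> and \<open>l\<close>
  by \<open>N_commute\<close>.\<close>

lemma dy_R_diff:
  assumes p: "p \<in> \<Omega>"
  shows "dy l (R i k) p - dy k (R i l) p = 3 * (dx k (N i l) p - dx l (N i k) p
    + (\<Sum>j\<in>UNIV. N j l p * dy j (N i k) p - N j k p * dy j (N i l) p))"
proof -
  have [simp]: "G i differentiable at p" "N i k differentiable at p" "dx j (N i k) differentiable at p"
    "dy j (N i k) differentiable at p" "dx j (G i) differentiable at p" for i j k
    by (rule smooth_on_differentiable[OF _ p], intro smooth_intros)+
  have [simp]: "dy l (dx j (G i)) p = dx j (N i l) p" for i j l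
    unfolding N_def by (rule dx_dy[OF open_dom smooth_G p])
  have c1: "dy l (dx j (N i k)) p = dx j (dy l (N i k)) p" for i j k l
    by (rule dx_dy[OF open_dom smooth_N p])
  have c2: "dx j (dy l (N i k)) p = dx j (dy k (N i l)) p" for i j k l
    by (rule dx_cong[OF open_dom p N_commute])
  have c3: "dy l (dy j (N i k)) p = dy k (dy j (N i l)) p" for i j k l
  proof -
    have "dy l (dy j (N i k)) p = dy j (dy l (N i k)) p" by (rule dy_dy[OF open_dom smooth_N p])
    also have "\<dots> = dy j (dy k (N i l)) p" by (rule dy_cong[OF open_dom p N_commute])
    also have "\<dots> = dy k (dy j (N i l)) p" by (rule dy_dy[OF open_dom smooth_N p])
    finally show ?thesis .
  qed
  have e: "dy l (R i k) p = 2 * dx k (N i l) p - dx l (N i k) p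
      - (\<Sum>j\<in>UNIV. snd p $ j * dx j (dy l (N i k)) p)
      + 2 * (\<Sum>j\<in>UNIV. G j p * dy l (dy j (N i k)) p) + 2 * (\<Sum>j\<in>UNIV. N j l p * dy j (N i k) p)
      - (\<Sum>j\<in>UNIV. N i j p * dy l (N j k) p) - (\<Sum>j\<in>UNIV. N j k p * dy j (N i l) p)" for i k l
  proof -
    have [simp]: "dy l (G j) = N j l" for j by (simp add: N_def)
    have "dy l (N i j) p = dy j (N i l) p" for j using N_commute[OF p] .
    then show ?thesis unfolding R_def[abs_def]
      by (simp add: dy_simps dy_snd_nth c1 sum.distrib if_distrib[of "\<lambda>x. x * _"] cong: if_cong)
        (simp add: sum.distrib mult.commute)
  qed
  have "(\<Sum>j\<in>UNIV. G j p * dy l (dy j (N i k)) p) = (\<Sum>j\<in>UNIV. G j p * dy k (dy j (N i l)) p)"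
    by (rule sum.cong) (simp_all add: c3[of l])
  moreover have "(\<Sum>j\<in>UNIV. snd p $ j * dx j (dy l (N i k)) p) = (\<Sum>j\<in>UNIV. snd p $ j * dx j (dy k (N i l)) p)"
    by (rule sum.cong) (simp_all add: c2[of _ l])
  moreover have "(\<Sum>j\<in>UNIV. N i j p * dy l (N j k) p) = (\<Sum>j\<in>UNIV. N i j p * dy k (N j l) p)"
    by (rule sum.cong) (simp_all add: N_commute[OF p, of l])
  ultimately show ?thesis unfolding e by (simp add: sum_subtractf)
qed

lemma Ric_bar_eq:
  assumes spray: "\<And>i x y. (x, y) \<in> \<Omega> \<Longrightarrow> spray F i x y = G i (x, y)"
    and p: "(x, y) \<in> \<Omega>"
  shows "Ric_bar F k l x y = dy k (X l) (x, y)"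
proof -
  note D = open_dom
  have N: "pd k (\<lambda>w. spray F i x w) y = N i k (x, y)" if "(x, y) \<in> \<Omega>" for x y i k
    unfolding N_def by (rule pd_snd_on[OF D that smooth_G]) (rule spray)
  have R: "riemann_curvature F i k x y = R i k (x, y)" if p: "(x, y) \<in> \<Omega>" for x y i k
  proof -
    have "pd k (\<lambda>z. spray F i z y) x = dx k (G i) (x, y)"
      by (rule pd_fst_on[OF D p smooth_G]) (rule spray)
    moreover have "pd j (\<lambda>z. pd k (\<lambda>w. spray F i z w) y) x = dx j (N i k) (x, y)" for j
      by (rule pd_fst_on[OF D p smooth_N]) (rule N)
    moreover have "pd j (\<lambda>v. pd k (\<lambda>w. spray F i x w) v) y = dy j (N i k) (x, y)" for j
      by (rule pd_snd_on[OF D p smooth_N]) (rule N)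
    ultimately show ?thesis
      unfolding riemann_curvature_def R_def by (simp add: N[OF p] spray[OF p])
  qed
  have R1: "pd j (\<lambda>w. riemann_curvature F i k x w) y = dy j (R i k) (x, y)"
    if "(x, y) \<in> \<Omega>" for x y i j k
    by (rule pd_snd_on[OF D that smooth_R]) (rule R)
  \<comment> \<open>The two fibre derivatives are exchanged so that the free index \<open>k\<close>
    of \<open>Ric_bar\<close> becomes the outermost one and can be pulled out of the trace.\<close>
  have R2: "pd l (\<lambda>v. pd j (\<lambda>w. riemann_curvature F i k x w) v) y = dy j (dy l (R i k)) (x, y)" for i j k l
  proof -
    have "pd l (\<lambda>v. pd j (\<lambda>w. riemann_curvature F i k x w) v) y = dy l (dy j (R i k)) (x, y)"
      by (rule pd_snd_on[OF D p smooth_on_dy[OF smooth_R]]) (rule R1)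
    then show ?thesis using dy_dy[OF D smooth_R p] by simp
  qed
  have df: "dy j (R i k) differentiable at (x, y)" for i j k
    by (rule smooth_on_differentiable[OF smooth_on_dy[OF smooth_R] p])
  have "Ric_bar F k l x y = (\<Sum>m\<in>UNIV. 1/3 * (dy k (dy l (R m m)) (x, y) - dy k (dy m (R m l)) (x, y)))"
    unfolding Ric_bar_def riemann_curvature_tensor_def R2 by simp
  also have "\<dots> = dy k (\<lambda>q. \<Sum>m\<in>UNIV. 1/3 * (dy l (R m m) q - dy m (R m l) q)) (x, y)"
    using df by (simp add: dy_simps)
  also have "\<dots> = dy k (X l) (x, y)"
    by (rule dy_cong[OF D p]) (simp add: dy_R_diff X_def del: distrib_left_numeral)
  finally show ?thesis .
qed

end

section \<open>Sprays of the form connection plus vertical field\<close>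

lemma differentiable_fst_comp [simp]: "f differentiable at (fst p) \<Longrightarrow> (\<lambda>p. f (fst p)) differentiable at p"
  by (intro differentiable_compose[of f fst]) (auto intro: bounded_linear_imp_differentiable bounded_linear_fst)

lemma dd_fst_comp:
  assumes "f differentiable at (fst p)"
  shows "dd (\<lambda>p. f (fst p)) p v = dd f (fst p) (fst v)"
  by (rule dd_eqI, rule has_derivative_compose[of fst, OF _ assms[unfolded frechet_derivative_works]])
    (auto intro!: derivative_eq_intros)

lemma dx_fst_comp: "f differentiable at (fst p) \<Longrightarrow> dx l (\<lambda>p. f (fst p)) p = pd l f (fst p)"
  by (simp add: dx_def pd_def dd_fst_comp)

lemma dy_fst_comp: "f differentiable at (fst p) \<Longrightarrow> dy l (\<lambda>p. f (fst p)) p = 0"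
  by (simp add: dy_def dd_fst_comp linear_0 linear_frechet_derivative)

definition hcov :: "('n::finite \<Rightarrow> 'n \<Rightarrow> 'n \<Rightarrow> real^'n \<Rightarrow> real) \<Rightarrow>
    'n \<Rightarrow> ((real^'n) \<times> (real^'n) \<Rightarrow> real) \<Rightarrow> (real^'n) \<times> (real^'n) \<Rightarrow> real" where
  "hcov \<Gamma> l f p = dx l f p - (\<Sum>q\<in>UNIV. (\<Sum>j\<in>UNIV. \<Gamma> q l j (fst p) * snd p $ j) * dy q f p)"

locale connection_spray =
  fixes \<Omega> :: "((real^'n::finite) \<times> (real^'n)) set" and U :: "(real^'n) set"
    and \<Gamma> :: "'n \<Rightarrow> 'n \<Rightarrow> 'n \<Rightarrow> real^'n \<Rightarrow> real"
    and Q :: "'n \<Rightarrow> (real^'n) \<times> (real^'n) \<Rightarrow> real"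
  assumes open_dom: "open \<Omega>" and open_base: "open U" and fst_dom: "fst ` \<Omega> \<subseteq> U"
    and smooth_Gamma: "smooth_on U (\<Gamma> i j k)" and Gamma_sym: "z \<in> U \<Longrightarrow> \<Gamma> i j k z = \<Gamma> i k j z"
    and smooth_Q: "smooth_on \<Omega> (Q i)"
begin

definition G :: "'n \<Rightarrow> (real^'n) \<times> (real^'n) \<Rightarrow> real" where
  "G i p = 1/2 * (\<Sum>j\<in>UNIV. \<Sum>k\<in>UNIV. \<Gamma> i j k (fst p) * snd p $ j * snd p $ k) + Q i p"

definition Q1 :: "'n \<Rightarrow> 'n \<Rightarrow> (real^'n) \<times> (real^'n) \<Rightarrow> real" where
  "Q1 i k = dy k (Q i)"

text \<open>Horizontal derivative for the full spray \<open>G\<close>, whereas \<open>hcov\<close> is the one for the connection alone.\<close>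

definition dcov :: "'n \<Rightarrow> ((real^'n) \<times> (real^'n) \<Rightarrow> real) \<Rightarrow> (real^'n) \<times> (real^'n) \<Rightarrow> real" where
  "dcov l f p = hcov \<Gamma> l f p - (\<Sum>q\<in>UNIV. Q1 q l p * dy q f p)"

definition T :: "(real^'n) \<times> (real^'n) \<Rightarrow> real" where
  "T p = (\<Sum>m\<in>UNIV. Q1 m m p)"

text \<open>\<open>hcov\<close> treats each \<open>Q m\<close> as a scalar function. The
  \<Gamma>-term supplies the correction for the upper index and makes the first sum a covariant
  divergence.\<close>

definition W :: "(real^'n) \<times> (real^'n) \<Rightarrow> real" where
  "W p = (\<Sum>m\<in>UNIV. hcov \<Gamma> m (Q m) p + (\<Sum>q\<in>UNIV. \<Gamma> m m q (fst p) * Q q p))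
    - 1/2 * (\<Sum>m\<in>UNIV. \<Sum>q\<in>UNIV. Q1 m q p * Q1 q m p)"

definition ric :: "'n \<Rightarrow> 'n \<Rightarrow> real^'n \<Rightarrow> real" where
  "ric j k z = (\<Sum>i\<in>UNIV. pd i (\<Gamma> i j k) z - pd k (\<Gamma> i i j) z
     + (\<Sum>p\<in>UNIV. \<Gamma> i i p z * \<Gamma> p j k z - \<Gamma> i k p z * \<Gamma> p i j z))"

lemma smooth_Gamma_fst: "smooth_on \<Omega> (\<lambda>p. \<Gamma> i j k (fst p))"
  by (rule smooth_on_fst[OF open_base open_dom fst_dom smooth_Gamma])

lemma smooth_Q1: "smooth_on \<Omega> (Q1 i k)"
  unfolding Q1_def by (rule smooth_on_dy[OF smooth_Q])

lemmas smooth_intros = smooth_on_sum smooth_on_add smooth_on_diff smooth_on_mult smooth_on_const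
  smooth_on_snd_nth smooth_on_dx smooth_on_dy smooth_Gamma_fst smooth_Q smooth_Q1 open_dom

lemma smooth_G: "smooth_on \<Omega> (G i)"
  unfolding G_def[abs_def] by (intro smooth_intros)

lemma smooth_hcov: "smooth_on \<Omega> f \<Longrightarrow> smooth_on \<Omega> (hcov \<Gamma> l f)"
  unfolding hcov_def[abs_def] by (intro smooth_intros)

lemma smooth_dcov: "smooth_on \<Omega> f \<Longrightarrow> smooth_on \<Omega> (dcov l f)"
  unfolding dcov_def[abs_def] by (intro smooth_intros smooth_hcov)

lemma smooth_T: "smooth_on \<Omega> T"
  unfolding T_def[abs_def] by (intro smooth_intros)

lemma smooth_W: "smooth_on \<Omega> W"
  unfolding W_def[abs_def] by (intro smooth_intros smooth_hcov)

sublocale spray: smooth_spray \<Omega> G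
  by standard (rule open_dom smooth_G)+

context
  fixes p assumes p: "p \<in> \<Omega>"
begin

lemma fst_in: "fst p \<in> U"
  using p fst_dom by blast

lemma diff_simps [simp]:
  "\<Gamma> i j k differentiable at (fst p)" "Q i differentiable at p" "Q1 i k differentiable at p"
  "dx j (Q i) differentiable at p" "dy j (Q i) differentiable at p"
  "dx j (Q1 i k) differentiable at p" "dy j (Q1 i k) differentiable at p"
  by (rule smooth_on_differentiable[OF smooth_Gamma fst_in])
    (rule smooth_on_differentiable[OF _ p], intro smooth_intros)+

lemma dx_Gamma: "dx l (\<lambda>p. \<Gamma> i j k (fst p)) p = pd l (\<Gamma> i j k) (fst p)"
  by (simp add: dx_fst_comp)

lemma dy_Gamma: "dy l (\<lambda>p. \<Gamma> i j k (fst p)) p = 0"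
  by (simp add: dy_fst_comp)

lemmas d_simps = dx_simps dy_simps dx_snd_nth dy_snd_nth dx_Gamma dy_Gamma

lemma dy_Q: "dy k (Q i) p = Q1 i k p"
  by (simp add: Q1_def)

lemma dy_dx_Q: "dy l (dx j (Q i)) p = dx j (Q1 i l) p"
  unfolding Q1_def by (rule dx_dy[OF open_dom smooth_Q p])

lemma dy_Q1: "dy l (Q1 i j) p = dy j (Q1 i l) p"
  unfolding Q1_def by (rule dy_dy[OF open_dom smooth_Q p])

end

lemma N_eq:
  assumes p: "p \<in> \<Omega>"
  shows "spray.N i k p = (\<Sum>j\<in>UNIV. \<Gamma> i k j (fst p) * snd p $ j) + Q1 i k p"
proof -
  note [simp] = diff_simps[OF p]
  have aux: "(\<Sum>m\<in>UNIV. f m * (if j = k then h m else 0)) = (if j = k then (\<Sum>m\<in>UNIV. f m * h m) else 0)"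
    for f h :: "'n \<Rightarrow> real" and j by simp
  have "spray.N i k p = 1/2 * (\<Sum>j\<in>UNIV. \<Gamma> i j k (fst p) * snd p $ j) + 1/2 * (\<Sum>j\<in>UNIV. \<Gamma> i k j (fst p) * snd p $ j) + Q1 i k p"
    unfolding spray.N_def unfolding G_def[abs_def]
    by (simp add: d_simps[OF p] dy_Q[OF p] sum.distrib if_distrib[of "\<lambda>x. _ * x"] cong: if_cong)
      (simp add: field_simps sum.distrib aux)
  then show ?thesis using Gamma_sym[OF fst_in[OF p], of i _ k] by simp
qed

lemma dy_N:
  assumes p: "p \<in> \<Omega>"
  shows "dy j (spray.N i k) p = \<Gamma> i k j (fst p) + dy j (Q1 i k) p"
proof -
  note [simp] = diff_simps[OF p]
  have "dy j (spray.N i k) p = dy j (\<lambda>p. (\<Sum>j\<in>UNIV. \<Gamma> i k j (fst p) * snd p $ j) + Q1 i k p) p"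
    by (rule dy_cong[OF open_dom p N_eq])
  then show ?thesis
    by (simp add: d_simps[OF p] if_distrib[of "\<lambda>x. _ * x"] cong: if_cong)
qed

lemma dx_N:
  assumes p: "p \<in> \<Omega>"
  shows "dx m (spray.N i k) p = (\<Sum>j\<in>UNIV. pd m (\<Gamma> i k j) (fst p) * snd p $ j) + dx m (Q1 i k) p"
proof -
  note [simp] = diff_simps[OF p]
  have "dx m (spray.N i k) p = dx m (\<lambda>p. (\<Sum>j\<in>UNIV. \<Gamma> i k j (fst p) * snd p $ j) + Q1 i k p) p"
    by (rule dx_cong[OF open_dom p N_eq])
  then show ?thesis
    by (simp add: d_simps[OF p])
qed

lemma dy_hcov_Q:
  assumes p: "p \<in> \<Omega>"
  shows "dy l (hcov \<Gamma> m (Q i)) p = dx m (Q1 i l) p - (\<Sum>q\<in>UNIV. \<Gamma> q m l (fst p) * Q1 i q p)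
    - (\<Sum>q\<in>UNIV. (\<Sum>j\<in>UNIV. \<Gamma> q m j (fst p) * snd p $ j) * dy q (Q1 i l) p)"
proof -
  note [simp] = diff_simps[OF p]
  have [simp]: "dy q (Q i) = Q1 i q" for q by (simp add: Q1_def)
  show ?thesis unfolding hcov_def[abs_def]
    by (simp add: d_simps[OF p] dy_dx_Q[OF p] dy_Q1[OF p, of l] sum.distrib
        if_distrib[of "\<lambda>x. _ * x"] cong: if_cong)
qed

lemma dy_W:
  assumes p: "p \<in> \<Omega>"
  shows "dy l W p = (\<Sum>m\<in>UNIV. dx m (Q1 m l) p - (\<Sum>q\<in>UNIV. \<Gamma> q m l (fst p) * Q1 m q p)
    - (\<Sum>q\<in>UNIV. (\<Sum>j\<in>UNIV. \<Gamma> q m j (fst p) * snd p $ j) * dy q (Q1 m l) p)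
    + (\<Sum>q\<in>UNIV. \<Gamma> m m q (fst p) * Q1 q l p)) - (\<Sum>m\<in>UNIV. \<Sum>q\<in>UNIV. Q1 q m p * dy q (Q1 m l) p)"
proof -
  note [simp] = diff_simps[OF p]
  have [simp]: "hcov \<Gamma> m (Q i) differentiable at p" for m i
    by (rule smooth_on_differentiable[OF smooth_hcov[OF smooth_Q] p])
  \<comment> \<open>The two factors of the quadratic trace contribute equal double sums, which
    absorbs the factor 1/2.\<close>
  have "(\<Sum>m\<in>UNIV. \<Sum>q\<in>UNIV. Q1 m q p * dy m (Q1 q l) p) = (\<Sum>m\<in>UNIV. \<Sum>q\<in>UNIV. Q1 q m p * dy q (Q1 m l) p)"
    by (rule sum.swap)
  moreover have "(\<Sum>m\<in>UNIV. \<Sum>q\<in>UNIV. dy q (Q1 m l) p * Q1 q m p) = (\<Sum>m\<in>UNIV. \<Sum>q\<in>UNIV. Q1 q m p * dy q (Q1 m l) p)"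
    by (simp add: mult.commute)
  ultimately show ?thesis unfolding W_def[abs_def]
    by (simp add: d_simps[OF p] dy_hcov_Q[OF p] dy_Q[OF p] dy_Q1[OF p, of l] sum.distrib)
qed

lemma dy_T: "p \<in> \<Omega> \<Longrightarrow> dy l T p = (\<Sum>m\<in>UNIV. dy l (Q1 m m) p)"
  unfolding T_def[abs_def] by (simp add: dy_sum diff_simps)

lemma dx_T: "p \<in> \<Omega> \<Longrightarrow> dx l T p = (\<Sum>m\<in>UNIV. dx l (Q1 m m) p)"
  unfolding T_def[abs_def] by (simp add: dx_sum diff_simps)

text \<open>After expanding \<open>N\<close> as \<Gamma> contracted with y plus \<open>Q1\<close>,
  the pure \<Gamma>-terms form \<open>ric\<close>. Terms that differentiate the trace of
  \<open>Q1\<close> form the derivative of \<open>T\<close> along the full spray, and everything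
  else is a y-derivative of \<open>W\<close>.\<close>

lemma X_eq:
  assumes p: "p \<in> \<Omega>"
  shows "spray.X l p = (\<Sum>j\<in>UNIV. ric j l (fst p) * snd p $ j) + dy l W p - dcov l T p"
proof -
  define g where "g i j k = \<Gamma> i j k (fst p)" for i j k
  define c where "c i j = (\<Sum>k\<in>UNIV. g i j k * snd p $ k)" for i j
  have gs: "g i j k = g i k j" for i j k unfolding g_def by (rule Gamma_sym[OF fst_in[OF p]])
  have pg: "pd m (\<Gamma> i j k) (fst p) = pd m (\<Gamma> i k j) (fst p)" for m i j k
    unfolding pd_def by (rule arg_cong[of _ _ "\<lambda>f. f _"])
      (rule frechet_derivative_transform_open[OF open_base fst_in[OF p] Gamma_sym])
  have split: "(\<Sum>j\<in>UNIV. a j - b j + (\<Sum>q\<in>UNIV. c q j))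
      = (\<Sum>j\<in>UNIV. a j) - (\<Sum>j\<in>UNIV. b j) + (\<Sum>q\<in>UNIV. \<Sum>j\<in>UNIV. c q j)"
    for a b :: "'n \<Rightarrow> real" and c :: "'n \<Rightarrow> 'n \<Rightarrow> real"
    by (simp add: sum.distrib sum_subtractf) (rule sum.swap)
  have sw: "(\<Sum>q\<in>UNIV. \<Sum>m\<in>UNIV. f q m) = (\<Sum>m\<in>UNIV. \<Sum>q\<in>UNIV. f q m)" for f :: "'n \<Rightarrow> 'n \<Rightarrow> real"
    by (rule sum.swap)
  have ric: "(\<Sum>j\<in>UNIV. ric j l (fst p) * snd p $ j)
    = (\<Sum>m\<in>UNIV. (\<Sum>j\<in>UNIV. pd m (\<Gamma> m l j) (fst p) * snd p $ j) - (\<Sum>j\<in>UNIV. pd l (\<Gamma> m m j) (fst p) * snd p $ j)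
      + (\<Sum>q\<in>UNIV. g m m q * c q l - g m l q * c q m))"
  proof -
    have "(\<Sum>j\<in>UNIV. ric j l (fst p) * snd p $ j) = (\<Sum>j\<in>UNIV. \<Sum>m\<in>UNIV.
        pd m (\<Gamma> m l j) (fst p) * snd p $ j - pd l (\<Gamma> m m j) (fst p) * snd p $ j
        + (\<Sum>q\<in>UNIV. g m m q * (g q l j * snd p $ j) - g m l q * (g q m j * snd p $ j)))"
      unfolding ric_def g_def[symmetric] pg[of _ _ _ l] gs[of _ _ l]
      by (simp only: sum_distrib_right distrib_right left_diff_distrib mult.assoc)
    also have "\<dots> = (\<Sum>m\<in>UNIV. \<Sum>j\<in>UNIV.
        pd m (\<Gamma> m l j) (fst p) * snd p $ j - pd l (\<Gamma> m m j) (fst p) * snd p $ j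
        + (\<Sum>q\<in>UNIV. g m m q * (g q l j * snd p $ j) - g m l q * (g q m j * snd p $ j)))"
      by (rule sum.swap)
    also have "\<dots> = (\<Sum>m\<in>UNIV. (\<Sum>j\<in>UNIV. pd m (\<Gamma> m l j) (fst p) * snd p $ j) - (\<Sum>j\<in>UNIV. pd l (\<Gamma> m m j) (fst p) * snd p $ j)
      + (\<Sum>q\<in>UNIV. \<Sum>j\<in>UNIV. g m m q * (g q l j * snd p $ j) - g m l q * (g q m j * snd p $ j)))"
      by (simp only: split)
    finally show ?thesis
      by (simp add: c_def sum_subtractf sum_distrib_left)
  qed
  \<comment> \<open>The one mixed term whose match needs both a relabelling and the symmetry of
    \<Gamma>.\<close>
  have swap: "(\<Sum>m\<in>UNIV. \<Sum>q\<in>UNIV. g q m l * Q1 m q p) = (\<Sum>m\<in>UNIV. \<Sum>q\<in>UNIV. Q1 q m p * g m l q)"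
    by (subst sum.swap) (simp add: gs[of _ l] mult.commute)
  have X: "spray.X l p = (\<Sum>m\<in>UNIV. (\<Sum>j\<in>UNIV. pd m (\<Gamma> m l j) (fst p) * snd p $ j) + dx m (Q1 m l) p
      - (\<Sum>j\<in>UNIV. pd l (\<Gamma> m m j) (fst p) * snd p $ j) - dx l (Q1 m m) p
      + (\<Sum>q\<in>UNIV. (c q l + Q1 q l p) * (g m m q + dy q (Q1 m m) p)
          - (c q m + Q1 q m p) * (g m l q + dy q (Q1 m l) p)))"
    unfolding spray.X_def by (simp add: N_eq[OF p] dx_N[OF p] dy_N[OF p] g_def c_def algebra_simps)
  have dT: "dcov l T p = (\<Sum>m\<in>UNIV. dx l (Q1 m m) p) - (\<Sum>m\<in>UNIV. \<Sum>q\<in>UNIV. c q l * dy q (Q1 m m) p)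
      - (\<Sum>m\<in>UNIV. \<Sum>q\<in>UNIV. Q1 q l p * dy q (Q1 m m) p)"
    unfolding dcov_def hcov_def dy_T[OF p] dx_T[OF p] g_def[symmetric] c_def[symmetric] sum_distrib_left
    by (simp only: sw[of "\<lambda>q m. c q l * dy q (Q1 m m) p"] sw[of "\<lambda>q m. Q1 q l p * dy q (Q1 m m) p"])
  show ?thesis
    unfolding X ric dT dy_W[OF p] g_def[symmetric] c_def[symmetric] using swap
    by (simp add: algebra_simps sum.distrib sum_subtractf)
qed

text \<open>Symmetrising in \<open>k\<close> and \<open>l\<close> acts on the \<open>T\<close>-term
  only: \<open>ric\<close> is symmetric by hypothesis, and the contribution of \<open>W\<close> is a
  Hessian.\<close>

lemma Ric_eq:
  assumes spray: "\<And>i x y. (x, y) \<in> \<Omega> \<Longrightarrow> spray F i x y = G i (x, y)"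
    and p: "(x, y) \<in> \<Omega>" and "ric k l x = ric l k x"
  shows "Ric F k l x y = ric k l x + dy k (dy l W) (x, y)
    - 1/2 * (dy k (dcov l T) (x, y) + dy l (dcov k T) (x, y))"
proof -
  have b: "Ric_bar F k l x y = ric k l x + dy k (dy l W) (x, y) - dy k (dcov l T) (x, y)" for k l
  proof -
    have "ric j l differentiable at x" for j
    proof -
      have "smooth_on U (ric j l)"
        unfolding ric_def[abs_def] pd_def
        by (intro smooth_on_sum smooth_on_add smooth_on_diff smooth_on_mult smooth_on_dd smooth_Gamma open_base)
      then show ?thesis
        using smooth_on_differentiable[of U "ric j l" x] fst_in[OF p] by simp
    qed
    then have ricd: "(\<lambda>p. ric j l (fst p)) differentiable at (x, y)"
      and dric: "dy k (\<lambda>p. ric j l (fst p)) (x, y) = 0" for j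
      by (simp_all add: dy_fst_comp)
    have [simp]: "dy l W differentiable at (x, y)" "dcov l T differentiable at (x, y)"
      by (rule smooth_on_differentiable[OF smooth_on_dy[OF smooth_W] p]
          smooth_on_differentiable[OF smooth_dcov[OF smooth_T] p])+
    have "Ric_bar F k l x y = dy k (spray.X l) (x, y)"
      by (rule spray.Ric_bar_eq[OF spray p])
    also have "\<dots> = dy k (\<lambda>p. (\<Sum>j\<in>UNIV. ric j l (fst p) * snd p $ j) + dy l W p - dcov l T p) (x, y)"
      by (rule dy_cong[OF open_dom p X_eq])
    finally show ?thesis
      using ricd by (simp add: dy_simps dy_snd_nth dric if_distrib[of "\<lambda>x. _ * x"] cong: if_cong)
  qed
  have "dy k (dy l W) (x, y) = dy l (dy k W) (x, y)"
    by (rule dy_dy[OF open_dom smooth_W p])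
  then show ?thesis unfolding Ric_def b using assms(3) by (simp add: field_simps)
qed

end

section \<open>Riemannian metrics in coordinates\<close>

lemma smooth_on_pd: "smooth_on S f \<Longrightarrow> smooth_on S (pd i f)"
  unfolding pd_def[abs_def] by (rule smooth_on_dd)

lemma pd_commute: "open S \<Longrightarrow> smooth_on S f \<Longrightarrow> z \<in> S \<Longrightarrow> pd j (pd i f) z = pd i (pd j f) z"
  unfolding pd_def[abs_def] by (rule dd_commute)

lemma pd_cong: "open S \<Longrightarrow> z \<in> S \<Longrightarrow> (\<And>x. x \<in> S \<Longrightarrow> f x = h x) \<Longrightarrow> pd i f z = pd i h z"
  unfolding pd_def using frechet_derivative_transform_open by metis

lemma pd_mult: "f differentiable at z \<Longrightarrow> h differentiable at z \<Longrightarrow> pd i (\<lambda>z. f z * h z) z = f z * pd i h z + pd i f z * h z"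
  unfolding pd_def by (rule dd_mult)

lemma pd_sum: "(\<And>j. j \<in> J \<Longrightarrow> f j differentiable at z) \<Longrightarrow> pd i (\<lambda>z. \<Sum>j\<in>J. f j z) z = (\<Sum>j\<in>J. pd i (f j) z)"
  unfolding pd_def by (rule dd_sum)

lemma pd_cdivide: "f differentiable at z \<Longrightarrow> pd i (\<lambda>z. f z / c) z = pd i f z / c"
  using pd_mult[of f z "\<lambda>z. 1 / c" i] by (simp add: pd_def)

lemma pd_const: "pd i (\<lambda>z. c) z = 0"
  unfolding pd_def by (rule dd_const)

lemma sum_delta_left [simp]: "(\<Sum>j\<in>UNIV. (if i = j then 1 else 0) * f j) = (f i :: real)" for i :: "'n::finite"
  by (simp add: if_distrib[of "\<lambda>x. x * _"] cong: if_cong)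

lemma sum_delta_left' [simp]: "(\<Sum>j\<in>UNIV. (if j = i then 1 else 0) * f j) = (f i :: real)" for i :: "'n::finite"
  by (simp add: if_distrib[of "\<lambda>x. x * _"] cong: if_cong)

lemma sum_delta_right [simp]: "(\<Sum>j\<in>UNIV. f j * (if i = j then 1 else 0)) = (f i :: real)" for i :: "'n::finite"
  by (simp add: if_distrib[of "\<lambda>x. _ * x"] cong: if_cong)

lemma sum_delta_right' [simp]: "(\<Sum>j\<in>UNIV. f j * (if j = i then 1 else 0)) = (f i :: real)" for i :: "'n::finite"
  by (simp add: if_distrib[of "\<lambda>x. _ * x"] cong: if_cong)

lemma sum_swap_mult:
  fixes f h :: "'n::finite \<Rightarrow> real"
  shows "(\<Sum>j\<in>UNIV. f j * (\<Sum>m\<in>UNIV. k j m * h m)) = (\<Sum>m\<in>UNIV. (\<Sum>j\<in>UNIV. f j * k j m) * h m)"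
proof -
  have "(\<Sum>j\<in>UNIV. f j * (\<Sum>m\<in>UNIV. k j m * h m)) = (\<Sum>j\<in>UNIV. \<Sum>m\<in>UNIV. f j * k j m * h m)"
    by (simp add: sum_distrib_left mult.assoc)
  also have "\<dots> = (\<Sum>m\<in>UNIV. \<Sum>j\<in>UNIV. f j * k j m * h m)" by (rule sum.swap)
  finally show ?thesis by (simp add: sum_distrib_right)
qed

lemma sum_swap4:
  "(\<Sum>i\<in>A. \<Sum>m\<in>B. \<Sum>q\<in>C. \<Sum>p\<in>D. f i m q p) = (\<Sum>q\<in>C. \<Sum>p\<in>D. \<Sum>i\<in>A. \<Sum>m\<in>B. f i m q p)"
proof -
  have "(\<Sum>i\<in>A. \<Sum>m\<in>B. \<Sum>q\<in>C. \<Sum>p\<in>D. f i m q p) = (\<Sum>i\<in>A. \<Sum>q\<in>C. \<Sum>m\<in>B. \<Sum>p\<in>D. f i m q p)"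
    by (rule sum.cong[OF refl]) (rule sum.swap)
  also have "\<dots> = (\<Sum>q\<in>C. \<Sum>i\<in>A. \<Sum>m\<in>B. \<Sum>p\<in>D. f i m q p)" by (rule sum.swap)
  also have "\<dots> = (\<Sum>q\<in>C. \<Sum>i\<in>A. \<Sum>p\<in>D. \<Sum>m\<in>B. f i m q p)"
    by (rule sum.cong[OF refl], rule sum.cong[OF refl]) (rule sum.swap)
  also have "\<dots> = (\<Sum>q\<in>C. \<Sum>p\<in>D. \<Sum>i\<in>A. \<Sum>m\<in>B. f i m q p)"
    by (rule sum.cong[OF refl]) (rule sum.swap)
  finally show ?thesis .
qed

locale riemannian_chart =
  fixes U :: "(real^'n::finite) set" and a :: "'n metric_field"
  assumes open_U: "open U" and smooth_a: "smooth_on U a"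
    and a_sym: "z \<in> U \<Longrightarrow> a z $ i $ j = a z $ j $ i"
    and a_pos: "z \<in> U \<Longrightarrow> v \<noteq> 0 \<Longrightarrow> (\<Sum>i\<in>UNIV. \<Sum>j\<in>UNIV. a z $ i $ j * v $ i * v $ j) > 0"
begin

abbreviation "au \<equiv> a_uu a"
abbreviation "ch \<equiv> christoffel a"

lemma smooth_a_nth: "smooth_on U (\<lambda>z. a z $ i $ j)"
  by (intro smooth_on_nth open_U smooth_a)

lemma invertible_a:
  assumes z: "z \<in> U" shows "invertible (a z)"
proof -
  have "v = 0" if "a z *v v = 0" for v
  proof (rule ccontr)
    assume "v \<noteq> 0"
    have "(\<Sum>i\<in>UNIV. \<Sum>j\<in>UNIV. a z $ i $ j * v $ i * v $ j) = (\<Sum>i\<in>UNIV. v $ i * (a z *v v) $ i)"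
      by (simp add: matrix_vector_mult_def sum_distrib_left mult_ac)
    then show False using a_pos[OF z \<open>v \<noteq> 0\<close>] that by simp
  qed
  then show ?thesis
    using matrix_left_invertible_ker invertible_left_inverse by blast
qed

lemma smooth_au: "smooth_on U (au i j)"
  unfolding a_uu_def[abs_def] by (rule smooth_on_matrix_inv[OF open_U smooth_a_nth invertible_a])

lemma smooth_ch: "smooth_on U (ch i j k)"
  unfolding christoffel_def[abs_def]
  by (intro smooth_on_mult smooth_on_sum smooth_on_const smooth_on_add smooth_on_diff smooth_on_pd
      open_U smooth_au smooth_a_nth)

context
  fixes z assumes z: "z \<in> U"
begin

lemma a_au: "(\<Sum>j\<in>UNIV. a z $ i $ j * au j k z) = (if i = k then 1 else 0)"
proof -
  have "(a z ** matrix_inv (a z)) $ i $ k = mat 1 $ i $ k"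
    using matrix_inv_works(1)[OF invertible_a[OF z]] by simp
  then show ?thesis by (simp add: matrix_matrix_mult_def a_uu_def mat_def)
qed

lemma au_a: "(\<Sum>j\<in>UNIV. au i j z * a z $ j $ k) = (if i = k then 1 else 0)"
proof -
  have "(matrix_inv (a z) ** a z) $ i $ k = mat 1 $ i $ k"
    using matrix_inv_works(2)[OF invertible_a[OF z]] by simp
  then show ?thesis by (simp add: matrix_matrix_mult_def a_uu_def mat_def)
qed

lemma au_sym: "au i j z = au j i z"
proof -
  have "au i j z = (\<Sum>m\<in>UNIV. au i m z * (\<Sum>q\<in>UNIV. a z $ m $ q * au q j z))"
    by (simp add: a_au)
  also have "\<dots> = (\<Sum>m\<in>UNIV. (\<Sum>q\<in>UNIV. a z $ m $ q * au q i z) * au m j z)"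
    by (simp add: a_au au_a sum_swap_mult)
  also have "\<dots> = (\<Sum>m\<in>UNIV. au m j z * (\<Sum>q\<in>UNIV. a z $ m $ q * au q i z))"
    by (simp add: mult.commute)
  also have "\<dots> = (\<Sum>q\<in>UNIV. (\<Sum>m\<in>UNIV. au m j z * a z $ m $ q) * au q i z)"
    by (rule sum_swap_mult)
  also have "\<dots> = (\<Sum>q\<in>UNIV. (\<Sum>m\<in>UNIV. a z $ q $ m * au m j z) * au q i z)"
    by (rule sum.cong[OF refl]) (metis (no_types, lifting) a_sym[OF z] mult.commute sum.cong)
  finally show ?thesis by (simp add: a_au)
qed

lemma diff_base [simp]:
  "(\<lambda>z. a z $ i $ j) differentiable at z" "au i j differentiable at z" "ch i j k differentiable at z"
  "pd l (\<lambda>z. a z $ i $ j) differentiable at z"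
  by (rule smooth_on_differentiable[OF smooth_a_nth z] smooth_on_differentiable[OF smooth_au z]
      smooth_on_differentiable[OF smooth_ch z] smooth_on_differentiable[OF smooth_on_pd[OF smooth_a_nth] z])+

lemma pd_a_sym: "pd k (\<lambda>z. a z $ i $ j) z = pd k (\<lambda>z. a z $ j $ i) z"
  by (rule pd_cong[OF open_U z a_sym])

lemma ch_sym: "ch i j k z = ch i k j z"
  unfolding christoffel_def using pd_a_sym[of _ j k] by (simp add: add.commute)

lemma a_ch: "(\<Sum>m\<in>UNIV. a z $ i $ m * ch m j k z)
  = 1/2 * (pd k (\<lambda>z. a z $ i $ j) z + pd j (\<lambda>z. a z $ i $ k) z - pd i (\<lambda>z. a z $ j $ k) z)"
proof -
  let ?d = "\<lambda>m. pd k (\<lambda>z. a z $ m $ j) z + pd j (\<lambda>z. a z $ m $ k) z - pd m (\<lambda>z. a z $ j $ k) z"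
  have "(\<Sum>m\<in>UNIV. a z $ i $ m * ch m j k z) = 1/2 * (\<Sum>m\<in>UNIV. a z $ i $ m * (\<Sum>q\<in>UNIV. au m q z * ?d q))"
    unfolding christoffel_def by (simp add: sum_distrib_left mult_ac)
  also have "(\<Sum>m\<in>UNIV. a z $ i $ m * (\<Sum>q\<in>UNIV. au m q z * ?d q)) = ?d i"
    by (subst sum_swap_mult) (simp add: a_au)
  finally show ?thesis .
qed

text \<open>Metric compatibility of the Levi-Civita connection: two Christoffel symbols of the first
  kind add up to one derivative of the metric.\<close>

lemma pd_a: "pd k (\<lambda>z. a z $ i $ j) z = (\<Sum>m\<in>UNIV. a z $ i $ m * ch m j k z) + (\<Sum>m\<in>UNIV. a z $ j $ m * ch m i k z)"
  unfolding a_ch using pd_a_sym[of k i j] pd_a_sym[of i k j] pd_a_sym[of j k i] by (simp add: field_simps)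

text \<open>From differentiating the product of the metric with its inverse. Derivatives of
  \<open>a\<close> are kept here instead of Christoffel symbols since \<open>pd_trace_ch_sym\<close>
  compares exactly these.\<close>

lemma pd_au_aux: "pd l (au i j) z = - (\<Sum>q\<in>UNIV. \<Sum>m\<in>UNIV. au i q z * pd l (\<lambda>z. a z $ q $ m) z * au m j z)"
proof -
  have e: "(\<Sum>q\<in>UNIV. pd l (au i q) z * a z $ q $ m) = - (\<Sum>q\<in>UNIV. au i q z * pd l (\<lambda>z. a z $ q $ m) z)" for m
  proof -
    have "pd l (\<lambda>z. \<Sum>q\<in>UNIV. au i q z * a z $ q $ m) z = pd l (\<lambda>z. if i = m then 1 else 0) z"
      by (rule pd_cong[OF open_U z]) (rule riemannian_chart.au_a[OF riemannian_chart_axioms])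
    then have "(\<Sum>q\<in>UNIV. au i q z * pd l (\<lambda>z. a z $ q $ m) z + pd l (au i q) z * a z $ q $ m) = 0"
      by (simp add: pd_sum pd_mult pd_const)
    then show ?thesis by (simp add: sum.distrib)
  qed
  have "pd l (au i j) z = (\<Sum>q\<in>UNIV. pd l (au i q) z * (\<Sum>m\<in>UNIV. a z $ q $ m * au m j z))"
    by (simp add: a_au)
  also have "\<dots> = - (\<Sum>m\<in>UNIV. (\<Sum>q\<in>UNIV. au i q z * pd l (\<lambda>z. a z $ q $ m) z) * au m j z)"
    by (simp add: sum_swap_mult e sum_negf)
  also have "\<dots> = - (\<Sum>m\<in>UNIV. \<Sum>q\<in>UNIV. au i q z * pd l (\<lambda>z. a z $ q $ m) z * au m j z)"
    by (simp add: sum_distrib_right)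
  also have "\<dots> = - (\<Sum>q\<in>UNIV. \<Sum>m\<in>UNIV. au i q z * pd l (\<lambda>z. a z $ q $ m) z * au m j z)"
    by (subst sum.swap) (rule refl)
  finally show ?thesis .
qed

lemma pd_au: "pd l (au i j) z = - (\<Sum>m\<in>UNIV. ch i m l z * au m j z) - (\<Sum>m\<in>UNIV. ch j m l z * au i m z)"
proof -
  have 1: "(\<Sum>q\<in>UNIV. au i q z * (\<Sum>m\<in>UNIV. a z $ q $ m * h m)) = h i" for i h
    by (subst sum_swap_mult) (simp add: au_a)
  have "(\<Sum>q\<in>UNIV. \<Sum>m\<in>UNIV. au i q z * pd l (\<lambda>z. a z $ q $ m) z * au m j z)
     = (\<Sum>q\<in>UNIV. \<Sum>m\<in>UNIV. au i q z * (\<Sum>p\<in>UNIV. a z $ q $ p * ch p m l z) * au m j z)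
     + (\<Sum>q\<in>UNIV. \<Sum>m\<in>UNIV. au i q z * (\<Sum>p\<in>UNIV. a z $ m $ p * ch p q l z) * au m j z)"
    unfolding pd_a by (simp add: sum.distrib algebra_simps)
  also have "(\<Sum>q\<in>UNIV. \<Sum>m\<in>UNIV. au i q z * (\<Sum>p\<in>UNIV. a z $ q $ p * ch p m l z) * au m j z)
     = (\<Sum>m\<in>UNIV. (\<Sum>q\<in>UNIV. au i q z * (\<Sum>p\<in>UNIV. a z $ q $ p * ch p m l z)) * au m j z)"
    by (subst sum.swap) (simp add: sum_distrib_right)
  also have "(\<Sum>q\<in>UNIV. \<Sum>m\<in>UNIV. au i q z * (\<Sum>p\<in>UNIV. a z $ m $ p * ch p q l z) * au m j z)
     = (\<Sum>q\<in>UNIV. (\<Sum>m\<in>UNIV. au j m z * (\<Sum>p\<in>UNIV. a z $ m $ p * ch p q l z)) * au i q z)"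
    by (simp add: sum_distrib_right sum_distrib_left au_sym[of j] mult_ac)
  finally show ?thesis unfolding pd_au_aux 1 by simp
qed

end

lemma trace_ch:
  assumes z: "z \<in> U"
  shows "(\<Sum>i\<in>UNIV. ch i i j z) = 1/2 * (\<Sum>i\<in>UNIV. \<Sum>m\<in>UNIV. au i m z * pd j (\<lambda>z. a z $ i $ m) z)"
proof -
  have "(\<Sum>i\<in>UNIV. \<Sum>m\<in>UNIV. au i m z * pd i (\<lambda>z. a z $ m $ j) z) = (\<Sum>i\<in>UNIV. \<Sum>m\<in>UNIV. au i m z * pd m (\<lambda>z. a z $ i $ j) z)"
    by (subst sum.swap) (simp add: au_sym[OF z])
  then show ?thesis
    unfolding christoffel_def sum_distrib_left[symmetric] using pd_a_sym[OF z, of j]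
    by (simp add: sum.distrib sum_subtractf distrib_left right_diff_distrib)
qed

text \<open>The contracted Christoffel symbol is the gradient of log sqrt(det a), so its derivative
  is a Hessian. With \<open>trace_ch\<close> no determinant has to be differentiated: second
  derivatives of \<open>a\<close> commute, and the quadratic remainder is symmetric after
  relabelling.\<close>

lemma pd_trace_ch_sym:
  assumes z: "z \<in> U"
  shows "(\<Sum>i\<in>UNIV. pd k (ch i i j) z) = (\<Sum>i\<in>UNIV. pd j (ch i i k) z)"
proof -
  note [simp] = diff_base[OF z]
  let ?D = "\<lambda>k i m. pd k (\<lambda>z. a z $ i $ m) z"
  have e: "(\<Sum>i\<in>UNIV. pd k (ch i i j) z) = 1/2 * (\<Sum>i\<in>UNIV. \<Sum>m\<in>UNIV. au i m z * pd k (pd j (\<lambda>z. a z $ i $ m)) z)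
     - 1/2 * (\<Sum>i\<in>UNIV. \<Sum>m\<in>UNIV. \<Sum>q\<in>UNIV. \<Sum>p\<in>UNIV. au i q z * ?D k q p * au p m z * ?D j i m)" for j k
  proof -
    have "(\<Sum>i\<in>UNIV. pd k (ch i i j) z) = pd k (\<lambda>z. \<Sum>i\<in>UNIV. ch i i j z) z"
      by (simp add: pd_sum)
    also have "\<dots> = pd k (\<lambda>z. 1/2 * (\<Sum>i\<in>UNIV. \<Sum>m\<in>UNIV. au i m z * pd j (\<lambda>z. a z $ i $ m) z)) z"
      by (rule pd_cong[OF open_U z trace_ch])
    also have "\<dots> = 1/2 * (\<Sum>i\<in>UNIV. \<Sum>m\<in>UNIV. au i m z * pd k (pd j (\<lambda>z. a z $ i $ m)) z)
       + 1/2 * (\<Sum>i\<in>UNIV. \<Sum>m\<in>UNIV. pd k (au i m) z * ?D j i m)"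
      by (simp add: pd_sum pd_mult pd_cdivide sum.distrib add_divide_distrib)
    finally show ?thesis
      by (simp add: pd_au_aux[OF z] sum_negf sum_distrib_right)
  qed
  have "(\<Sum>i\<in>UNIV. \<Sum>m\<in>UNIV. \<Sum>q\<in>UNIV. \<Sum>p\<in>UNIV. au i q z * ?D k q p * au p m z * ?D j i m)
      = (\<Sum>q\<in>UNIV. \<Sum>p\<in>UNIV. \<Sum>i\<in>UNIV. \<Sum>m\<in>UNIV. au i q z * ?D k q p * au p m z * ?D j i m)"
    by (rule sum_swap4)
  also have "\<dots> = (\<Sum>q\<in>UNIV. \<Sum>p\<in>UNIV. \<Sum>i\<in>UNIV. \<Sum>m\<in>UNIV. au q i z * ?D j i m * au m p z * ?D k q p)"
    by (simp add: au_sym[OF z, of _ q] au_sym[OF z] mult_ac)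
  finally show ?thesis unfolding e
    using pd_commute[OF open_U smooth_a_nth z, of k j] by simp
qed

text \<open>The only term whose symmetry needs more than relabelling and \<open>ch_sym\<close> is
  the derivative of the contracted Christoffel symbol. The result discharges the symmetry hypothesis
  of \<open>Ric_eq\<close>.\<close>

lemma Ric_riem_sym:
  assumes z: "z \<in> U"
  shows "Ric_riem a j k z = Ric_riem a k j z"
proof -
  have pg: "pd i (ch i j k) z = pd i (ch i k j) z" for i
    by (rule pd_cong[OF open_U z ch_sym])
  have "(\<Sum>i\<in>UNIV. \<Sum>p\<in>UNIV. ch i k p z * ch p i j z) = (\<Sum>i\<in>UNIV. \<Sum>p\<in>UNIV. ch i j p z * ch p i k z)"
    by (subst sum.swap) (simp add: ch_sym[OF z, of _ k] ch_sym[OF z, of _ j] mult.commute)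
  then show ?thesis
    unfolding Ric_riem_def using pd_trace_ch_sym[OF z, of j k]
    by (simp add: sum.distrib sum_subtractf pg ch_sym[OF z, of _ j k])
qed

end

section \<open>Horizontal derivatives of contracted tensors\<close>

context
  fixes \<Gamma> :: "'n::finite \<Rightarrow> 'n \<Rightarrow> 'n \<Rightarrow> real^'n \<Rightarrow> real"
begin

text \<open>The horizontal lift of the \<open>l\<close>-th coordinate vector. With
  \<open>hcov\<close> as a derivative in this direction, its rules are inherited from those of
  \<open>dd\<close>.\<close>

definition hdir :: "'n \<Rightarrow> (real^'n) \<times> (real^'n) \<Rightarrow> (real^'n) \<times> (real^'n)" where
  "hdir l p = (axis l 1, 0) - (\<Sum>q\<in>UNIV. (\<Sum>j\<in>UNIV. \<Gamma> q l j (fst p) * snd p $ j) *\<^sub>R (0, axis q 1))"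

lemma hcov_eq_dd: "f differentiable at p \<Longrightarrow> hcov \<Gamma> l f p = dd f p (hdir l p)"
  unfolding hcov_def hdir_def dx_def dy_def
  by (simp only: dd_diff_dir dd_sum_dir dd_scale_dir real_scaleR_def)

lemma hcov_add: "f differentiable at p \<Longrightarrow> g differentiable at p \<Longrightarrow>
    hcov \<Gamma> l (\<lambda>p. f p + g p) p = hcov \<Gamma> l f p + hcov \<Gamma> l g p"
  by (simp add: hcov_eq_dd dd_add)

lemma hcov_diff: "f differentiable at p \<Longrightarrow> g differentiable at p \<Longrightarrow>
    hcov \<Gamma> l (\<lambda>p. f p - g p) p = hcov \<Gamma> l f p - hcov \<Gamma> l g p"
  by (simp add: hcov_eq_dd dd_diff)

lemma hcov_mult: "f differentiable at p \<Longrightarrow> g differentiable at p \<Longrightarrow>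
    hcov \<Gamma> l (\<lambda>p. f p * g p) p = f p * hcov \<Gamma> l g p + hcov \<Gamma> l f p * g p"
  by (simp add: hcov_eq_dd dd_mult)

lemma hcov_divide: "f differentiable at p \<Longrightarrow> g differentiable at p \<Longrightarrow> g p \<noteq> 0 \<Longrightarrow>
    hcov \<Gamma> l (\<lambda>p. f p / g p) p = hcov \<Gamma> l f p / g p - f p * hcov \<Gamma> l g p / (g p)\<^sup>2"
  by (simp add: hcov_eq_dd dd_divide)

lemma hcov_sum: "finite J \<Longrightarrow> (\<And>j. j \<in> J \<Longrightarrow> f j differentiable at p) \<Longrightarrow>
    hcov \<Gamma> l (\<lambda>p. \<Sum>j\<in>J. f j p) p = (\<Sum>j\<in>J. hcov \<Gamma> l (f j) p)"
  by (subst hcov_eq_dd) (simp_all add: hcov_eq_dd dd_sum)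

lemma hcov_const: "hcov \<Gamma> l (\<lambda>p. c) p = 0"
  by (simp add: hcov_def dx_const dy_const)

lemma hcov_fst_comp: "f differentiable at (fst p) \<Longrightarrow> hcov \<Gamma> l (\<lambda>p. f (fst p)) p = pd l f (fst p)"
  by (simp add: hcov_def dx_fst_comp dy_fst_comp)

lemma hcov_snd_nth: "hcov \<Gamma> l (\<lambda>p. snd p $ i) p = - (\<Sum>j\<in>UNIV. \<Gamma> i l j (fst p) * snd p $ j)"
  by (simp add: hcov_def dx_snd_nth dy_snd_nth)

lemma hcov_cong: "open S \<Longrightarrow> p \<in> S \<Longrightarrow> (\<And>q. q \<in> S \<Longrightarrow> f q = g q) \<Longrightarrow> hcov \<Gamma> l f p = hcov \<Gamma> l g p"
  by (simp add: hcov_def dx_cong[of S p f g] dy_cong[of S p f g])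

lemmas hcov_simps = hcov_add hcov_diff hcov_mult hcov_divide hcov_sum hcov_const
  hcov_fst_comp hcov_snd_nth

end

section \<open>Tensors contracted with the fibre coordinate\<close>

definition lin :: "('n::finite \<Rightarrow> real^'n \<Rightarrow> real) \<Rightarrow> (real^'n) \<times> (real^'n) \<Rightarrow> real" where
  "lin w p = (\<Sum>i\<in>UNIV. w i (fst p) * snd p $ i)"

definition quad :: "('n::finite \<Rightarrow> 'n \<Rightarrow> real^'n \<Rightarrow> real) \<Rightarrow> (real^'n) \<times> (real^'n) \<Rightarrow> real" where
  "quad t p = (\<Sum>i\<in>UNIV. \<Sum>j\<in>UNIV. t i j (fst p) * snd p $ i * snd p $ j)"

lemma quad_lin: "quad t p = (\<Sum>i\<in>UNIV. snd p $ i * lin (t i) p)"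
  by (simp add: quad_def lin_def sum_distrib_left mult_ac)

lemma lin_diff: "lin (\<lambda>i z. v i z - w i z) p = lin v p - lin w p"
  by (simp add: lin_def sum_subtractf algebra_simps)

lemma lin_contract:
  fixes w :: "'n::finite \<Rightarrow> real" and p :: "(real^'n) \<times> (real^'n)"
  shows "(\<Sum>m\<in>UNIV. w m * lin (t m) p) = lin (\<lambda>k z. \<Sum>m\<in>UNIV. w m * t m k z) p"
  unfolding lin_def by (rule sum_swap_mult)

lemma lin_cong: "(\<And>i. w i (fst p) = v i (fst p)) \<Longrightarrow> lin w p = lin v p"
  by (simp add: lin_def)

lemma lin_differentiable [simp]:
  "(\<And>i. w i differentiable at (fst p)) \<Longrightarrow> lin w differentiable at p"
  unfolding lin_def[abs_def] by simp

lemma quad_differentiable [simp]: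
  "(\<And>i j. t i j differentiable at (fst p)) \<Longrightarrow> quad t differentiable at p"
  unfolding quad_def[abs_def] by simp

lemma dy_lin: "(\<And>i. w i differentiable at (fst p)) \<Longrightarrow> dy k (lin w) p = w k (fst p)"
  unfolding lin_def[abs_def]
  by (simp add: dy_sum dy_mult dy_snd_nth dy_fst_comp)

text \<open>The two contractions stay apart because not every form is symmetric:
  \<open>s_{i|j}\<close> and \<open>r_{mi} s^m_j\<close> occur as well.\<close>

lemma dy_quad:
  assumes "\<And>i j. t i j differentiable at (fst p)"
  shows "dy k (quad t) p = lin (t k) p + lin (\<lambda>i. t i k) p"
proof -
  have "quad t = (\<lambda>p. \<Sum>i\<in>UNIV. snd p $ i * lin (t i) p)" by (simp add: fun_eq_iff quad_lin)
  then show ?thesis using assms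
    by (simp add: dy_sum dy_mult dy_snd_nth dy_lin sum.distrib) (simp add: lin_def mult.commute)
qed

text \<open>The bridge to covariant derivatives: the \<Gamma>-term that \<open>hcov\<close> produces
  on y is shifted by a sum exchange onto the components of \<open>w\<close>.\<close>

lemma hcov_lin:
  assumes "\<And>i. w i differentiable at (fst p)" and s: "\<And>i j k. \<Gamma> i j k (fst p) = \<Gamma> i k j (fst p)"
  shows "hcov \<Gamma> l (lin w) p = lin (\<lambda>i z. pd l (w i) z - (\<Sum>m\<in>UNIV. \<Gamma> m i l z * w m z)) p"
proof -
  have "(\<Sum>i\<in>UNIV. w i (fst p) * (\<Sum>j\<in>UNIV. \<Gamma> i l j (fst p) * snd p $ j))
      = (\<Sum>j\<in>UNIV. (\<Sum>i\<in>UNIV. w i (fst p) * \<Gamma> i l j (fst p)) * snd p $ j)"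
    by (rule sum_swap_mult)
  then show ?thesis using assms(1) unfolding lin_def[abs_def]
    by (simp add: hcov_sum hcov_mult hcov_snd_nth hcov_fst_comp sum.distrib sum_subtractf sum_negf s[of _ l] algebra_simps)
qed

lemma hcov_quad:
  assumes d: "\<And>i j. t i j differentiable at (fst p)" and s: "\<And>i j k. \<Gamma> i j k (fst p) = \<Gamma> i k j (fst p)"
  shows "hcov \<Gamma> l (quad t) p = quad (\<lambda>i j z. pd l (t i j) z - (\<Sum>m\<in>UNIV. \<Gamma> m i l z * t m j z)
    - (\<Sum>m\<in>UNIV. \<Gamma> m j l z * t i m z)) p"
proof -
  have q: "quad t = (\<lambda>p. \<Sum>i\<in>UNIV. snd p $ i * lin (t i) p)" by (simp add: fun_eq_iff quad_lin)
  have "hcov \<Gamma> l (quad t) p = (\<Sum>i\<in>UNIV. snd p $ i * lin (\<lambda>j z. pd l (t i j) z - (\<Sum>m\<in>UNIV. \<Gamma> m j l z * t i m z)) p)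
     - (\<Sum>i\<in>UNIV. lin (t i) p * (\<Sum>j\<in>UNIV. \<Gamma> i l j (fst p) * snd p $ j))"
    unfolding q using d s by (simp add: hcov_sum hcov_mult hcov_snd_nth hcov_lin sum.distrib sum_subtractf sum_negf mult.commute)
  also have "(\<Sum>i\<in>UNIV. lin (t i) p * (\<Sum>j\<in>UNIV. \<Gamma> i l j (fst p) * snd p $ j))
      = (\<Sum>j\<in>UNIV. (\<Sum>i\<in>UNIV. lin (t i) p * \<Gamma> i l j (fst p)) * snd p $ j)"
    by (rule sum_swap_mult)
  also have "\<dots> = (\<Sum>j\<in>UNIV. snd p $ j * lin (\<lambda>i z. \<Sum>m\<in>UNIV. \<Gamma> m j l z * t m i z) p)"
  proof (rule sum.cong[OF refl])
    fix j
    have "(\<Sum>i\<in>UNIV. lin (t i) p * \<Gamma> i l j (fst p)) = lin (\<lambda>i z. \<Sum>m\<in>UNIV. \<Gamma> m j l z * t m i z) p"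
      unfolding lin_def sum_distrib_right by (subst sum.swap) (simp add: s[of _ l] mult_ac)
    then show "(\<Sum>i\<in>UNIV. lin (t i) p * \<Gamma> i l j (fst p)) * snd p $ j
      = snd p $ j * lin (\<lambda>i z. \<Sum>m\<in>UNIV. \<Gamma> m j l z * t m i z) p" by simp
  qed
  finally show ?thesis
    unfolding quad_lin by (simp add: lin_diff sum_subtractf right_diff_distrib)
qed


section \<open>Polynomial identities\<close>

text \<open>The bracket has the shape of \<open>Q1\<close> applied to a vector, so this evaluates
  the covector \<open>d\<close> on such an image term by term.\<close>

lemma sum_combination:
  fixes d :: "'i::finite \<Rightarrow> real"
  shows "(\<Sum>m\<in>UNIV. d m * (X * \<alpha> m - (Y * \<beta> m + f * \<gamma> m) / 2 - V * \<delta> m - c * \<epsilon> m))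
    = X * (\<Sum>m\<in>UNIV. d m * \<alpha> m) - (Y * (\<Sum>m\<in>UNIV. d m * \<beta> m) + f * (\<Sum>m\<in>UNIV. d m * \<gamma> m)) / 2
      - V * (\<Sum>m\<in>UNIV. d m * \<delta> m) - c * (\<Sum>m\<in>UNIV. d m * \<epsilon> m)"
  unfolding sum_distrib_left sum.distrib[symmetric] sum_divide_distrib sum_subtractf[symmetric]
  by (simp add: algebra_simps add_divide_distrib)

text \<open>Here \<open>be\<close> is the value of \<open>\<beta>\<close>. It occurs in both terms of \<open>W\<close> but cancels in their difference, which is
  why \<open>\<beta>\<close> is absent from the Ricci tensor.\<close>

lemma W_algebra:
  fixes F be bb S0 R0 R00 u v tau k s2 ss r tr d0 s0b r00b s00 r000 n C A :: real
  assumes nz: "F \<noteq> 0" "be \<noteq> 0" "bb \<noteq> 0"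
    and C: "C = (S0 + R00 / F) / bb" and A: "A = F * C / 2"
    and Fb: "Fb = 2 - F * bb / be" and Fs: "Fs = - (F * S0 / be)" and FSs: "FSs = - ((2 * k + F * u) / be)"
    and Ab: "Ab = (Fb * S0 + 2 * R0) / (2 * bb)" and As: "As = (Fs * S0 + F * u + 2 * v) / (2 * bb)"
    and AV: "AV = (2 * S0 / be * S0 + F * s2 + 2 * tau) / (2 * bb)"
    and Cb: "Cb = (2 * R0 / F - R00 * Fb / F\<^sup>2) / bb" and Cs: "Cs = (u + 2 * v / F - R00 * Fs / F\<^sup>2) / bb"
    and hFb: "hFb = - (F * (R0 - S0) / be)" and hFs: "hFs = - (F * (v - k) / be)" and hFy: "hFy = - (F * R00 / be)"
  shows "(hFb * S0 + F * s0b + r00b) / (2 * bb) - A * (2 * r) / bb + A * tr - (hFs + F * d0) / 2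
      - ((s00 + r000 / F - R00 * hFy / F\<^sup>2) / bb - C * (2 * (R0 + S0)) / bb)
    - 1/2 * ((Ab * Ab - (Fb * As - F * AV) / 2 - Cb * (F * C) - C * Ab)
      - ((As * Fb - (Fs * Fs + F * FSs) / 2 - Cs * F - C * Fs) + F * (- AV - (FSs + F * ss) / 2 - Cs)) / 2
      - (F * C * Cb - (F * Cs + F * Cs) / 2 - C * C - C * C) - C * ((S0 + R0) / bb - (n + 1) * C))
    = (F * s0b + r00b) / (2 * bb) - F * d0 / 2 + (F * S0 + R00) * (tr / (2 * bb) - r / bb\<^sup>2)
    - (s00 + r000 / F) / bb - F * F * (ss / 8 + s2 / (4 * bb)) - (S0 + R0) * (S0 + R0) / (2 * bb\<^sup>2)
    - F * (tau + u) / (2 * bb) - v / bb - (n + 7) / 2 * (C * C) + 5 * (C * (S0 + R0)) / bb"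
proof -
  \<comment> \<open>\<open>R00\<close> and \<open>C\<close> determine each other. Eliminating
    \<open>R00\<close> turns the quotient \<open>R00 / F\<close> into a polynomial in
    \<open>C\<close> and \<open>S0\<close>.\<close>
  have R: "R00 = F * (bb * C - S0)" using C nz by (simp add: field_simps)
  have e: "R00 * x / F\<^sup>2 = (bb * C - S0) / F * x" for x
    unfolding R using nz by (simp add: power2_eq_square)
  have FCb: "F * Cb = (2 * R0 - (bb * C - S0) * Fb) / bb"
    unfolding Cb e using nz by (simp add: field_simps)
  have FCs: "F * Cs = (F * u + 2 * v - (bb * C - S0) * Fs) / bb"
    unfolding Cs e using nz by (simp add: field_simps)
  have c: "Cb * (F * C) = C * (F * Cb)" "F * C * Cb = C * (F * Cb)" "Cs * F = F * Cs" "F * (- AV - X - Cs) = F * (- AV - X) - F * Cs" for X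
    by (simp_all add: algebra_simps)
  have hFy': "R00 * hFy / F\<^sup>2 = - (F * (bb * C - S0) * (bb * C - S0) / be)"
    unfolding e hFy R using nz by (simp add: power2_eq_square)
  define rF where "rF = r000 / F"
  \<comment> \<open>Once \<open>FSs\<close> and \<open>AV\<close> are multiplied by
    \<open>F\<close>, \<beta> enters only through this ratio, so its cancellation is that of a
    single variable.\<close>
  define x where "x = F / be"
  have Fb': "Fb = 2 - x * bb" and Fs': "Fs = - (x * S0)" and hFb': "hFb = - (x * (R0 - S0))" and hFs': "hFs = - (x * (v - k))"
    unfolding Fb Fs hFb hFs by (simp_all add: x_def)
  have FSs': "F * FSs = - (x * (2 * k + F * u))" unfolding FSs by (simp add: x_def)
  have FAV: "F * AV = (2 * x * S0 * S0 + F * F * s2 + 2 * F * tau) / (2 * bb)"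
    unfolding AV using nz by (simp add: x_def field_simps)
  have hFy2: "R00 * hFy / F\<^sup>2 = - (x * ((bb * C - S0) * (bb * C - S0)))"
    unfolding hFy' by (simp add: x_def)
  have c4: "F * (- AV - (FSs + F * ss) / 2) = - (F * AV) - (F * FSs + F * F * ss) / 2"
    by (simp add: algebra_simps add_divide_distrib)
  show ?thesis
    unfolding hFy2 c c4 FCb FCs FAV FSs' rF_def[symmetric] A
    unfolding R Ab As Fb' Fs' hFb' hFs'
    using nz(3) by (simp add: divide_simps power2_eq_square) (simp add: algebra_simps)
qed

text \<open>The final comparison is multi-affine in \<open>F\<^sub>k\<close>, \<open>F\<^sub>l\<close> and \<open>F\<^sub>k\<^sub>l\<close>. It is split into its coefficients because
  the simplifier does not cope with the expanded identity as a whole.\<close>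

lemma dcov_T_coefficients:
  fixes q j n :: real
  assumes Ck: "Ck = ak - D * Fk" and Cl: "Cl = al - D * Fl"
    and Ckl: "Ckl = e - El * Fk - Ek * Fl - D * Fkl + G * (Fk * Fl)"
    and D0: "D0 = ckl + (Fkl * u + Fl * uk + Fk * ul) / 2 + Ckl * S0 + Cl * sk + Ck * sl"
    and D1: "D1 = gkl - (Fkl * S0 + Fl * sk + Fk * sl + 2 * rkl) * (r * j / 2)
      + (Fkl * rho + Fl * rhok + Fk * rhol) / 2 + Ckl * R0 + Cl * rk + Ck * rl"
    and D2: "D2 = 2 * ekl * q - r00dl * Fk * q * q
      - ((Fkl * q - Fk * Fl * q * q) * S0 + Fl * q * sk + 2 * rkl * q - 2 * Rl * Fk * q * q) * R0 * j
      - (Fl * q * S0 + sl + 2 * Rl * q) * rk * j + (Fkl * q - Fk * Fl * q * q) * v + Fl * q * (v1k + v2k) + vkl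
      + 2 * Ckl * R00 * q + 2 * Cl * (2 * Rk * q - R00 * Fk * q * q) + 2 * Ck * Rl * q + 2 * C * (rkl * q - Rl * Fk * q * q)"
    and DT: "DT = (D0 + D1) * j - (sk + rk) * (2 * (rl + sl)) * j * j
      - (n + 1) * ((D0 + D2) * j - Ck * (2 * (rl + sl)) * j)"
  shows "DT = Fkl * ((u / 2 - D * S0 + (rho / 2 - S0 * r * j / 2 - D * R0)) * j
        - (n + 1) * (u / 2 - D * S0 + (q * v - q * S0 * R0 * j - 2 * D * R00 * q)) * j)
    + Fk * Fl * ((G * S0 + G * R0) * j - (n + 1) * (G * S0 + (q * q * S0 * R0 * j - q * q * v + 2 * G * R00 * q + 2 * D * R00 * q * q)) * j)
    + Fk * ((ul / 2 - El * S0 - D * sl + (rhol / 2 - sl * r * j / 2 - El * R0 - D * rl)) * j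
        - (n + 1) * (ul / 2 - El * S0 - D * sl + (2 * Rl * q * q * R0 * j - r00dl * q * q - 2 * El * R00 * q
            - 2 * al * R00 * q * q - 2 * D * Rl * q - 2 * C * Rl * q * q) + 2 * (rl + sl) * D) * j)
    + Fl * ((uk / 2 - Ek * S0 - D * sk + (rhok / 2 - sk * r * j / 2 - Ek * R0 - D * rk)) * j
        - (n + 1) * (uk / 2 - Ek * S0 - D * sk + (q * (v1k + v2k) - q * sk * R0 * j - q * S0 * rk * j - 2 * Ek * R00 * q - 4 * D * Rk * q)) * j)
    + ((ckl + e * S0 + al * sk + ak * sl + (gkl - rkl * r * j + e * R0 + al * rk + ak * rl)) * j
        - (sk + rk) * (2 * (rl + sl)) * j * j
        - (n + 1) * (ckl + e * S0 + al * sk + ak * sl + (2 * ekl * q - 2 * rkl * q * R0 * j - (sl + 2 * Rl * q) * rk * j + vkl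
            + 2 * e * R00 * q + 4 * al * Rk * q + 2 * ak * Rl * q + 2 * C * rkl * q) - ak * (2 * (rl + sl))) * j)"
proof -
  have 0: "D0 = Fkl * (u / 2 - D * S0) + Fk * Fl * (G * S0) + Fk * (ul / 2 - El * S0 - D * sl)
      + Fl * (uk / 2 - Ek * S0 - D * sk) + (ckl + e * S0 + al * sk + ak * sl)"
    unfolding D0 Ck Cl Ckl by (simp add: algebra_simps add_divide_distrib)
  have 1: "D1 = Fkl * (rho / 2 - S0 * r * j / 2 - D * R0) + Fk * Fl * (G * R0) + Fk * (rhol / 2 - sl * r * j / 2 - El * R0 - D * rl)
      + Fl * (rhok / 2 - sk * r * j / 2 - Ek * R0 - D * rk) + (gkl - rkl * r * j + e * R0 + al * rk + ak * rl)"
    unfolding D1 Ck Cl Ckl by (simp add: algebra_simps add_divide_distrib)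
  have 2: "D2 = Fkl * (q * v - q * S0 * R0 * j - 2 * D * R00 * q)
      + Fk * Fl * (q * q * S0 * R0 * j - q * q * v + 2 * G * R00 * q + 2 * D * R00 * q * q)
      + Fk * (2 * Rl * q * q * R0 * j - r00dl * q * q - 2 * El * R00 * q
            - 2 * al * R00 * q * q - 2 * D * Rl * q - 2 * C * Rl * q * q)
      + Fl * (q * (v1k + v2k) - q * sk * R0 * j - q * S0 * rk * j - 2 * Ek * R00 * q - 4 * D * Rk * q)
      + (2 * ekl * q - 2 * rkl * q * R0 * j - (sl + 2 * Rl * q) * rk * j + vkl
            + 2 * e * R00 * q + 4 * al * Rk * q + 2 * ak * Rl * q + 2 * C * rkl * q)"
    unfolding D2 Ck Cl Ckl by (simp add: algebra_simps)
  \<comment> \<open>Stated for arbitrary coefficients, so that the recombination does not expand the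
    actual ones.\<close>
  have comb: "(Fkl * x1 + Fk * Fl * x2 + Fk * x3 + Fl * x4 + x5 + (Fkl * y1 + Fk * Fl * y2 + Fk * y3 + Fl * y4 + y5)) * j - X
      - (n + 1) * ((Fkl * x1 + Fk * Fl * x2 + Fk * x3 + Fl * x4 + x5 + (Fkl * z1 + Fk * Fl * z2 + Fk * z3 + Fl * z4 + z5)) * j - (ak - D * Fk) * Y * j)
    = Fkl * ((x1 + y1) * j - (n + 1) * (x1 + z1) * j) + Fk * Fl * ((x2 + y2) * j - (n + 1) * (x2 + z2) * j)
      + Fk * ((x3 + y3) * j - (n + 1) * (x3 + z3 + Y * D) * j) + Fl * ((x4 + y4) * j - (n + 1) * (x4 + z4) * j)
      + ((x5 + y5) * j - X - (n + 1) * (x5 + z5 - ak * Y) * j)"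
    for x1 x2 x3 x4 x5 y1 y2 y3 y4 y5 z1 z2 z3 z4 z5 X Y :: real
    by (simp add: algebra_simps)
  show ?thesis unfolding DT 0 1 2 Ck comb ..
qed

text \<open>The final comparison with every tensor value as a real variable. A suffix
  \<open>k\<close> or \<open>l\<close> marks a free index or the corresponding y-derivative. Writing
  \<open>q\<close> and \<open>j\<close> for the inverses of \<open>F\<close> and b^2 turns all
  quotients into monomials.\<close>

lemma Ric_algebra:
  fixes F bb n :: real
  defines "q \<equiv> inverse F" and "j \<equiv> inverse bb"
  assumes bb: "bb \<noteq> 0"
    and C: "C = (S0 + R00 * q) * j"
    and Ck: "Ck = (sk + 2 * Rk * q - R00 * Fk * q * q) * j"
    and Cl: "Cl = (sl + 2 * Rl * q - R00 * Fl * q * q) * j"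
    and Ckl: "Ckl = (2 * rkl * q - 2 * Rl * Fk * q * q - 2 * Rk * Fl * q * q - R00 * Fkl * q * q
      + 2 * R00 * Fl * Fk * q * q * q) * j"
    and W2: "W2 = (Fkl * s0b + Fl * sbk + Fk * sbl + 2 * rbkl) * j / 2 - (Fkl * d0 + Fl * dk + Fk * dl) / 2
      + (Fkl * S0 + Fl * sk + Fk * sl + 2 * rkl) * (tr * j / 2 - r * j * j)
      - (ckl + clk + (2 * ekl + 2 * (zkl + elk)) * q - (r00dl + 2 * rl00) * Fk * q * q
          - (r00dk + 2 * rk00) * Fl * q * q - r000 * Fkl * q * q + 2 * r000 * Fk * Fl * q * q * q) * j
      - 2 * (Fk * Fl + F * Fkl) * (ss / 8 + s2 * j / 4) - (sk + rk) * (sl + rl) * j * j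
      - (Fkl * (tau + u) + Fl * (tauk + uk) + Fk * (taul + ul)) * j / 2 - (vkl + vlk) * j
      - (n + 7) * (Ck * Cl + C * Ckl) + 5 * (Ckl * (S0 + R0) + Cl * (sk + rk) + Ck * (sl + rl)) * j"
    and D0kl: "D0kl = ckl + (Fkl * u + Fl * uk + Fk * ul) / 2 + Ckl * S0 + Cl * sk + Ck * sl"
    and D0lk: "D0lk = clk + (Fkl * u + Fk * ul + Fl * uk) / 2 + Ckl * S0 + Ck * sl + Cl * sk"
    and D1kl: "D1kl = gkl - (Fkl * S0 + Fl * sk + Fk * sl + 2 * rkl) * (r * j / 2)
      + (Fkl * rho + Fl * rhok + Fk * rhol) / 2 + Ckl * R0 + Cl * rk + Ck * rl"
    and D1lk: "D1lk = glk - (Fkl * S0 + Fk * sl + Fl * sk + 2 * rkl) * (r * j / 2)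
      + (Fkl * rho + Fk * rhol + Fl * rhok) / 2 + Ckl * R0 + Ck * rl + Cl * rk"
    and D2kl: "D2kl = 2 * ekl * q - r00dl * Fk * q * q
      - ((Fkl * q - Fk * Fl * q * q) * S0 + Fl * q * sk + 2 * rkl * q - 2 * Rl * Fk * q * q) * R0 * j
      - (Fl * q * S0 + sl + 2 * Rl * q) * rk * j + (Fkl * q - Fk * Fl * q * q) * v + Fl * q * (v1k + v2k) + vkl
      + 2 * Ckl * R00 * q + 2 * Cl * (2 * Rk * q - R00 * Fk * q * q) + 2 * Ck * Rl * q + 2 * C * (rkl * q - Rl * Fk * q * q)"
    and D2lk: "D2lk = 2 * elk * q - r00dk * Fl * q * q
      - ((Fkl * q - Fl * Fk * q * q) * S0 + Fk * q * sl + 2 * rkl * q - 2 * Rk * Fl * q * q) * R0 * j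
      - (Fk * q * S0 + sk + 2 * Rk * q) * rl * j + (Fkl * q - Fl * Fk * q * q) * v + Fk * q * (v1l + v2l) + vlk
      + 2 * Ckl * R00 * q + 2 * Ck * (2 * Rl * q - R00 * Fl * q * q) + 2 * Cl * Rk * q + 2 * C * (rkl * q - Rk * Fl * q * q)"
    and DTkl: "DTkl = (D0kl + D1kl) * j - (sk + rk) * (2 * (rl + sl)) * j * j
      - (n + 1) * ((D0kl + D2kl) * j - Ck * (2 * (rl + sl)) * j)"
    and DTlk: "DTlk = (D0lk + D1lk) * j - (sl + rl) * (2 * (rk + sk)) * j * j
      - (n + 1) * ((D0lk + D2lk) * j - Cl * (2 * (rk + sk)) * j)"
  shows "W2 - 1/2 * (DTkl + DTlk) =
    Fkl * (
        - ((n - 5) / (bb\<^sup>2 * F^3)) * R00\<^sup>2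
        + 2 / (bb\<^sup>2 * F\<^sup>2) * R00 * (S0 - 2 * R0)
        + 1 / (bb * F\<^sup>2) * r000
        + (n - 1) / (2 * bb) * u
        + (bb * tr - r) * S0 / (2 * bb\<^sup>2)
        + (n + 1) / (bb * F) * v
        + 1 / (2 * bb) * (s0b - rho - tau)
        - 1/2 * (d0 + F / bb * s2 + F / 2 * ss)
        - (n + 1) / (bb\<^sup>2 * F) * S0 * R0)
    + Fl * Fk * (
        3 * (n - 5) / (bb\<^sup>2 * F^4) * R00\<^sup>2
        + 4 / (bb\<^sup>2 * F^3) * R00 * (2 * R0 - S0)
        - 2 / (bb * F^3) * r000
        + (n + 1) / (bb\<^sup>2 * F\<^sup>2) * S0 * R0
        - (n + 1) / (bb * F\<^sup>2) * v
        - 1 / (2 * bb) * s2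
        - 1/4 * ss)
    + Fk * (
        - (6 * (n - 3) / (bb\<^sup>2 * F^3)) * R00 * Rl
        + (n - 7) / (bb\<^sup>2 * F\<^sup>2) * Rl * R0
        - (n - 3) / (bb\<^sup>2 * F\<^sup>2) * Rl * S0
        + (n - 3) / (bb\<^sup>2 * F\<^sup>2) * R00 * rl
        + 2 / (bb\<^sup>2 * F\<^sup>2) * R00 * sl
        + 2 / (bb * F\<^sup>2) * rl00
        - (n - 1) / (2 * bb * F\<^sup>2) * r00dl
        + (n - 1) / (2 * bb) * ul
        + (bb * tr - r) / (2 * bb\<^sup>2) * sl
        - rhol / (2 * bb)
        - taul / (2 * bb)
        - dl / 2
        + sbl / (2 * bb)
        - (n + 1) / (2 * bb\<^sup>2 * F) * (sl * R0 + S0 * rl)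
        + (n + 1) / (2 * bb * F) * (v1l + v2l))
    + Fl * (
        - (6 * (n - 3) / (bb\<^sup>2 * F^3)) * R00 * Rk
        + (n - 7) / (bb\<^sup>2 * F\<^sup>2) * Rk * R0
        - (n - 3) / (bb\<^sup>2 * F\<^sup>2) * Rk * S0
        + (n - 3) / (bb\<^sup>2 * F\<^sup>2) * R00 * rk
        + 2 / (bb\<^sup>2 * F\<^sup>2) * R00 * sk
        + 2 / (bb * F\<^sup>2) * rk00
        - (n - 1) / (2 * bb * F\<^sup>2) * r00dk
        + (n - 1) / (2 * bb) * uk
        + (bb * tr - r) / (2 * bb\<^sup>2) * sk
        - rhok / (2 * bb)
        - tauk / (2 * bb)
        - dk / 2
        + sbk / (2 * bb)
        - (n + 1) / (2 * bb\<^sup>2 * F) * (sk * R0 + S0 * rk)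
        + (n + 1) / (2 * bb * F) * (v1k + v2k))
    + (8 * (n - 2) / (bb\<^sup>2 * F\<^sup>2) * Rk * Rl
    + 4 * (n - 2) / (bb\<^sup>2 * F\<^sup>2) * R00 * rkl
    + 2 * (n - 1) / (bb\<^sup>2 * F) * rkl * S0
    - 2 * (n - 3) / (bb\<^sup>2 * F) * rkl * R0
    - (3 * n - 5) / (bb\<^sup>2 * F) * (Rl * rk + Rk * rl)
    + (n - 3) / (bb\<^sup>2 * F) * (Rk * sl + Rl * sk)
    - (3 * n - 7) / (2 * bb\<^sup>2) * (rk * sl + rl * sk)
    - (n - 2) / bb\<^sup>2 * sk * sl
    + rk * rl / bb\<^sup>2
    - 2 * zkl / (bb * F)
    + (n - 1) / (bb * F) * (ekl + elk)
    + (n - 2) / (2 * bb) * (ckl + clk)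
    + (bb * tr - r) / bb\<^sup>2 * rkl
    + rbkl / bb
    - 1 / (2 * bb) * (gkl + glk)
    + (n - 1) / (2 * bb) * (vkl + vlk))"
proof -
  have jj: "bb * j = 1" using bb by (simp add: j_def)
  have t: "(bb * tr - r) / bb\<^sup>2 = tr * j - r * j * j" "(bb * tr - r) / (2 * bb\<^sup>2) = (tr * j - r * j * j) / 2"
    "(bb * tr - r) * S0 / (2 * bb\<^sup>2) = (tr * j - r * j * j) * S0 / 2"
    unfolding j_def using bb by (simp_all add: field_simps power2_eq_square)
  have d: "x / (bb\<^sup>2 * F^3) = x * j * j * q * q * q" "x / (bb\<^sup>2 * F\<^sup>2) = x * j * j * q * q"
    "x / (bb * F\<^sup>2) = x * j * q * q" "x / (2 * bb) = x * j / 2" "x / (bb * F) = x * j * q" "F / bb = F * j"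
    "x / (bb\<^sup>2 * F) = x * j * j * q" "x / (bb\<^sup>2 * F^4) = x * j * j * q * q * q * q" "x / (bb * F^3) = x * j * q * q * q"
    "x / (2 * bb * F\<^sup>2) = x * j * q * q / 2" "x / (2 * bb\<^sup>2 * F) = x * j * j * q / 2" "x / (2 * bb * F) = x * j * q / 2"
    "x / (2 * bb\<^sup>2) = x * j * j / 2" "x / bb\<^sup>2 = x * j * j" "x / bb = x * j" for x
    unfolding q_def j_def divide_inverse power2_eq_square power3_eq_cube power4_eq_xxxx inverse_mult_distrib
    by (simp_all only: mult_ac)
  \<comment> \<open>These names make \<open>Ck\<close> and \<open>Cl\<close> affine in
    \<open>Fk\<close> and \<open>Fl\<close> with atomic coefficients. They are unfolded only after
    the coefficients have been separated.\<close>
  define ak where "ak = (sk + 2 * Rk * q) * j"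
  define al where "al = (sl + 2 * Rl * q) * j"
  define D where "D = R00 * q * q * j"
  define Ek where "Ek = 2 * Rk * q * q * j"
  define El where "El = 2 * Rl * q * q * j"
  define G where "G = 2 * R00 * q * q * q * j"
  define e where "e = 2 * rkl * q * j"
  have Ck': "Ck = ak - D * Fk" and Cl': "Cl = al - D * Fl" and Ckl': "Ckl = e - El * Fk - Ek * Fl - D * Fkl + G * (Fk * Fl)"
    and Ckl'': "Ckl = e - Ek * Fl - El * Fk - D * Fkl + G * (Fl * Fk)"
    unfolding Ck Cl Ckl ak_def al_def D_def Ek_def El_def G_def e_def by (simp_all add: algebra_simps)
  note abbrs = ak_def al_def D_def Ek_def El_def G_def e_def C
  have W: "W2 = Fkl * ((s0b * j - d0) / 2 + S0 * (tr * j / 2 - r * j * j) + r000 * q * q * j - 2 * F * (ss / 8 + s2 * j / 4)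
        - (tau + u) * j / 2 + (n + 7) * C * D - 5 * D * (S0 + R0) * j)
     + Fk * Fl * (5 * G * (S0 + R0) * j - 2 * r000 * q * q * q * j - 2 * (ss / 8 + s2 * j / 4) - (n + 7) * (D * D + C * G))
     + Fk * ((sbl * j - dl) / 2 + sl * (tr * j / 2 - r * j * j) + (r00dl + 2 * rl00) * q * q * j - (taul + ul) * j / 2
        + (n + 7) * (D * al + C * El) - 5 * (El * (S0 + R0) + D * (sl + rl)) * j)
     + Fl * ((sbk * j - dk) / 2 + sk * (tr * j / 2 - r * j * j) + (r00dk + 2 * rk00) * q * q * j - (tauk + uk) * j / 2
        + (n + 7) * (D * ak + C * Ek) - 5 * (Ek * (S0 + R0) + D * (sk + rk)) * j)
     + (rbkl * j + 2 * rkl * (tr * j / 2 - r * j * j) - (ckl + clk + 2 * (ekl + zkl + elk) * q) * j - (sk + rk) * (sl + rl) * j * j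
        - (vkl + vlk) * j - (n + 7) * (ak * al + C * e) + 5 * (e * (S0 + R0) + al * (sk + rk) + ak * (sl + rl)) * j)"
    unfolding W2 Ck' Cl' Ckl' by (simp add: algebra_simps add_divide_distrib diff_divide_distrib)
  note T1 = dcov_T_coefficients[OF Ck' Cl' Ckl' D0kl D1kl D2kl DTkl]
  \<comment> \<open>The same expansion with \<open>k\<close> and \<open>l\<close> exchanged; for
    this reason \<open>z3\<close> and \<open>z4\<close> change places in
    \<open>coll\<close>.\<close>
  note T2 = dcov_T_coefficients[OF Cl' Ck' Ckl'' D0lk D1lk D2lk DTlk]
  have coll: "Fkl * x1 + Fk * Fl * x2 + Fk * x3 + Fl * x4 + x5 - 1 / 2 * (Fkl * y1 + Fk * Fl * y2 + Fk * y3 + Fl * y4 + y5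
        + (Fkl * z1 + Fl * Fk * z2 + Fl * z3 + Fk * z4 + z5))
     = Fkl * (x1 - (y1 + z1) / 2) + Fl * Fk * (x2 - (y2 + z2) / 2) + Fk * (x3 - (y3 + z4) / 2) + Fl * (x4 - (y4 + z3) / 2) + (x5 - (y5 + z5) / 2)"
    for x1 x2 x3 x4 x5 y1 y2 y3 y4 y5 z1 z2 z3 z4 z5 :: real
    by (simp add: algebra_simps add_divide_distrib)
  \<comment> \<open>Agreement of the five coefficients is sufficient, and each of the resulting
    identities is small enough to normalise.\<close>
  have regroup: "x1 = b1 \<Longrightarrow> x2 = b2 \<Longrightarrow> x3 = b3 \<Longrightarrow> x4 = b4 \<Longrightarrow> x5 = b5 \<Longrightarrow>
      Fkl * x1 + Fl * Fk * x2 + Fk * x3 + Fl * x4 + x5 = Fkl * b1 + Fl * Fk * b2 + Fk * b3 + Fl * b4 + b5"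
    for x1 x2 x3 x4 x5 b1 b2 b3 b4 b5 :: real by simp
  show ?thesis
    unfolding t d unfolding power2_eq_square W T1 T2 coll
    by (rule regroup; unfold abbrs; simp add: algebra_simps add_divide_distrib diff_divide_distrib jj)
qed

section \<open>Kropina metrics\<close>

locale kropina_chart = riemannian_chart U a for U :: "(real^'n::finite) set" and a +
  fixes b :: "'n covector_field"
  assumes smooth_b: "smooth_on U b" and b_nonzero: "z \<in> U \<Longrightarrow> b z \<noteq> 0"
begin

abbreviation "bd \<equiv> b_d b"
abbreviation "bu \<equiv> b_u a b"
abbreviation "b2 \<equiv> b_norm2 a b"
abbreviation "rdd \<equiv> r_dd a b"
abbreviation "sdd \<equiv> s_dd a b"
abbreviation "rud \<equiv> r_ud a b"
abbreviation "sud \<equiv> s_ud a b"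
abbreviation "rd \<equiv> r_d a b"
abbreviation "sd \<equiv> s_d a b"
abbreviation "su \<equiv> s_u a b"

lemmas smooth_base = smooth_on_sum smooth_on_add smooth_on_diff smooth_on_mult smooth_on_const
  smooth_on_pd open_U smooth_au smooth_ch smooth_a_nth

lemma smooth_bd: "smooth_on U (bd i)"
  unfolding b_d_def[abs_def] by (intro smooth_on_nth open_U smooth_b)

lemma smooth_bu: "smooth_on U (bu i)"
  unfolding b_u_def[abs_def] by (intro smooth_base smooth_bd)

lemma smooth_b2: "smooth_on U b2"
  unfolding b_norm2_def[abs_def] by (intro smooth_base smooth_bd)

lemma smooth_rdd: "smooth_on U (rdd i j)"
  unfolding r_dd_def[abs_def] cov_d_def by (intro smooth_base smooth_bd)

lemma smooth_sdd: "smooth_on U (sdd i j)"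
  unfolding s_dd_def[abs_def] cov_d_def by (intro smooth_base smooth_bd)

lemma smooth_sud: "smooth_on U (sud i j)"
  unfolding s_ud_def[abs_def] by (intro smooth_base smooth_sdd)

lemma smooth_rd: "smooth_on U (rd i)"
  unfolding r_d_def[abs_def] by (intro smooth_base smooth_rdd smooth_bu)

lemma smooth_sd: "smooth_on U (sd i)"
  unfolding s_d_def[abs_def] by (intro smooth_base smooth_sdd smooth_bu)

lemma rdd_sym: "rdd i j z = rdd j i z"
  by (simp add: r_dd_def add.commute)

lemma sdd_antisym: "sdd i j z = - sdd j i z"
  by (simp add: s_dd_def field_simps)

lemma cov_bd: "cov_d a bd i j z = rdd i j z + sdd i j z"
  by (simp add: r_dd_def s_dd_def field_simps)

context
  fixes z assumes z: "z \<in> U"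
begin

lemma diff_tensor [simp]:
  "bd i differentiable at z" "bu i differentiable at z" "b2 differentiable at z"
  "rdd i j differentiable at z" "sdd i j differentiable at z" "sud i j differentiable at z"
  "rd i differentiable at z" "sd i differentiable at z"
  by (rule smooth_on_differentiable[OF _ z], rule smooth_bd smooth_bu smooth_b2 smooth_rdd smooth_sdd
      smooth_sud smooth_rd smooth_sd)+

lemma a_raise: "(\<Sum>m\<in>UNIV. a z $ i $ m * (\<Sum>q\<in>UNIV. au m q z * h q)) = h i"
  by (subst sum_swap_mult) (simp add: a_au[OF z])

lemma contract_raise: "(\<Sum>m\<in>UNIV. bd m z * (\<Sum>q\<in>UNIV. au m q z * h q)) = (\<Sum>q\<in>UNIV. bu q z * h q)"
  by (subst sum_swap_mult) (simp add: b_u_def au_sym[OF z, of _ q for q] mult.commute)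

lemma a_bu: "(\<Sum>m\<in>UNIV. a z $ i $ m * bu m z) = bd i z"
  unfolding b_u_def by (rule a_raise)

lemma a_sud: "(\<Sum>m\<in>UNIV. a z $ i $ m * sud m k z) = sdd i k z"
  unfolding s_ud_def by (rule a_raise)

lemma a_su: "(\<Sum>m\<in>UNIV. a z $ i $ m * su m z) = sd i z"
  unfolding s_u_def by (rule a_raise)

lemma b2_eq: "b2 z = (\<Sum>i\<in>UNIV. bd i z * bu i z)"
  by (simp add: b_norm2_def b_u_def sum_distrib_left mult_ac)

text \<open>The number \<open>b2\<close> is the square of the raised vector \<open>bu\<close> under
  \<open>a\<close>, so positivity of \<open>a\<close> itself applies rather than positivity of its
  inverse.\<close>

lemma b2_pos: "b2 z > 0"
proof -
  let ?v = "\<chi> i. bu i z"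
  have "b2 z = (\<Sum>i\<in>UNIV. \<Sum>j\<in>UNIV. a z $ i $ j * ?v $ i * ?v $ j)"
    unfolding b2_eq a_bu[symmetric] by (simp add: sum_distrib_right sum_distrib_left mult_ac)
  moreover have "?v \<noteq> 0"
  proof
    assume "?v = 0"
    then have "bu i z = 0" for i by (simp add: vec_eq_iff)
    then have "b z $ i = 0" for i using a_bu[of i] by (simp add: b_d_def)
    then show False using b_nonzero[OF z] by (simp add: vec_eq_iff)
  qed
  ultimately show ?thesis using a_pos[OF z, of ?v] by simp
qed

lemma bd_sud: "(\<Sum>m\<in>UNIV. bd m z * sud m k z) = sd k z"
  unfolding s_ud_def contract_raise s_d_def ..

lemma sd_raise: "(\<Sum>m\<in>UNIV. sd m z * (\<Sum>q\<in>UNIV. au m q z * h q)) = (\<Sum>q\<in>UNIV. su q z * h q)"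
  by (subst sum_swap_mult) (simp add: s_u_def au_sym[OF z, of _ q for q] mult.commute)

lemma sd_bu: "(\<Sum>m\<in>UNIV. sd m z * bu m z) = 0"
proof -
  have "(\<Sum>m\<in>UNIV. sd m z * bu m z) = (\<Sum>m\<in>UNIV. \<Sum>j\<in>UNIV. bu j z * sdd j m z * bu m z)"
    by (simp add: s_d_def sum_distrib_right)
  also have "\<dots> = (\<Sum>j\<in>UNIV. \<Sum>m\<in>UNIV. bu j z * sdd j m z * bu m z)" by (rule sum.swap)
  also have "\<dots> = (\<Sum>j\<in>UNIV. \<Sum>m\<in>UNIV. - (bu m z * sdd m j z * bu j z))"
    by (subst sdd_antisym) (simp add: mult_ac)
  also have "\<dots> = - (\<Sum>m\<in>UNIV. sd m z * bu m z)"
    by (simp add: s_d_def sum_distrib_right sum_negf)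
  finally show ?thesis by simp
qed

lemma bd_su: "(\<Sum>m\<in>UNIV. bd m z * su m z) = 0"
  unfolding s_u_def contract_raise using sd_bu by (simp add: mult.commute)

lemma sud_bu: "(\<Sum>m\<in>UNIV. sud k m z * bu m z) = - su k z"
proof -
  have "(\<Sum>m\<in>UNIV. sud k m z * bu m z) = (\<Sum>q\<in>UNIV. au k q z * (\<Sum>m\<in>UNIV. sdd q m z * bu m z))"
    by (simp add: sum_swap_mult s_ud_def)
  also have "\<dots> = (\<Sum>q\<in>UNIV. au k q z * (- sd q z))"
  proof -
    have "(\<Sum>m\<in>UNIV. sdd q m z * bu m z) = - sd q z" for q
      by (subst sdd_antisym) (simp add: s_d_def sum_negf mult.commute)
    then show ?thesis by simp
  qed
  finally show ?thesis by (simp add: s_u_def sum_negf)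
qed

lemma trace_sud: "(\<Sum>m\<in>UNIV. sud m m z) = 0"
proof -
  have "(\<Sum>m\<in>UNIV. \<Sum>q\<in>UNIV. au m q z * sdd q m z) = (\<Sum>q\<in>UNIV. \<Sum>m\<in>UNIV. au m q z * sdd q m z)"
    by (rule sum.swap)
  also have "\<dots> = (\<Sum>q\<in>UNIV. \<Sum>m\<in>UNIV. - (au q m z * sdd m q z))"
    by (subst sdd_antisym) (simp add: au_sym[OF z])
  finally show ?thesis by (simp add: s_ud_def sum_negf)
qed

lemma rd_bu: "(\<Sum>m\<in>UNIV. rd m z * bu m z) = r_scalar a b z"
  by (simp add: r_scalar_def mult.commute)

lemma rdd_su: "(\<Sum>m\<in>UNIV. rdd l m z * su m z) = (\<Sum>m\<in>UNIV. rud m l z * sd m z)"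
proof -
  have "(\<Sum>m\<in>UNIV. sd m z * (\<Sum>q\<in>UNIV. au m q z * rdd q l z)) = (\<Sum>q\<in>UNIV. su q z * rdd q l z)"
    by (rule sd_raise)
  then show ?thesis by (simp add: r_ud_def mult.commute rdd_sym[of _ l])
qed

text \<open>Raising an index commutes with covariant differentiation because the inverse metric is
  parallel, which is the content of \<open>pd_au\<close>.\<close>

lemma div_bu: "pd l (bu i) z = (\<Sum>q\<in>UNIV. au i q z * (rdd q l z + sdd q l z)) - (\<Sum>m\<in>UNIV. ch i m l z * bu m z)"
proof -
  have "pd l (bu i) z = (\<Sum>q\<in>UNIV. au i q z * pd l (bd q) z) + (\<Sum>q\<in>UNIV. pd l (au i q) z * bd q z)"
    unfolding b_u_def[abs_def] using diff_base[OF z] by (simp add: pd_sum pd_mult sum.distrib)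
  also have "(\<Sum>q\<in>UNIV. pd l (au i q) z * bd q z)
     = - (\<Sum>q\<in>UNIV. bd q z * (\<Sum>m\<in>UNIV. au m q z * ch i m l z)) - (\<Sum>q\<in>UNIV. bd q z * (\<Sum>m\<in>UNIV. ch q m l z * au i m z))"
    unfolding pd_au[OF z] by (simp add: left_diff_distrib right_diff_distrib sum_subtractf sum_negf mult.commute)
  also have "(\<Sum>q\<in>UNIV. bd q z * (\<Sum>m\<in>UNIV. au m q z * ch i m l z)) = (\<Sum>m\<in>UNIV. ch i m l z * bu m z)"
    using contract_raise[of "\<lambda>m. ch i m l z"] by (simp add: au_sym[OF z] mult.commute)
  also have "(\<Sum>q\<in>UNIV. bd q z * (\<Sum>m\<in>UNIV. ch q m l z * au i m z)) = (\<Sum>m\<in>UNIV. (\<Sum>q\<in>UNIV. bd q z * ch q m l z) * au i m z)"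
    by (rule sum_swap_mult)
  finally have "pd l (bu i) z = (\<Sum>q\<in>UNIV. au i q z * (pd l (bd q) z - (\<Sum>m\<in>UNIV. ch m q l z * bd m z))) - (\<Sum>m\<in>UNIV. ch i m l z * bu m z)"
    by (simp add: right_diff_distrib sum_subtractf mult.commute)
  then show ?thesis unfolding cov_bd[symmetric] cov_d_def .
qed

text \<open>The Christoffel terms from \<open>bd\<close> and from \<open>bu\<close> cancel, since
  b^2 is a scalar. Each factor contributes \<open>b^m b_{m|l}\<close>, which is
  \<open>r_l + s_l\<close>.\<close>

lemma pd_b2: "pd l b2 z = 2 * (rd l z + sd l z)"
proof -
  have e: "pd l (bd i) z = rdd i l z + sdd i l z + (\<Sum>m\<in>UNIV. ch m i l z * bd m z)" for i
    unfolding cov_bd[symmetric] cov_d_def by simp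
  have "pd l b2 z = pd l (\<lambda>z. \<Sum>i\<in>UNIV. bd i z * bu i z) z"
    by (rule pd_cong[OF open_U z kropina_chart.b2_eq[OF kropina_chart_axioms]])
  also have "\<dots> = (\<Sum>i\<in>UNIV. bd i z * pd l (bu i) z) + (\<Sum>i\<in>UNIV. pd l (bd i) z * bu i z)"
    by (simp add: pd_sum pd_mult sum.distrib)
  also have "(\<Sum>i\<in>UNIV. pd l (bd i) z * bu i z) = (\<Sum>i\<in>UNIV. bu i z * (rdd i l z + sdd i l z)) + (\<Sum>i\<in>UNIV. bu i z * (\<Sum>m\<in>UNIV. ch m i l z * bd m z))"
    unfolding e by (simp add: distrib_left distrib_right sum.distrib mult.commute)
  also have "(\<Sum>i\<in>UNIV. bd i z * pd l (bu i) z) = (\<Sum>q\<in>UNIV. bu q z * (rdd q l z + sdd q l z)) - (\<Sum>i\<in>UNIV. bd i z * (\<Sum>m\<in>UNIV. ch i m l z * bu m z))"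
    unfolding div_bu right_diff_distrib sum_subtractf contract_raise ..
  also have "(\<Sum>i\<in>UNIV. bd i z * (\<Sum>m\<in>UNIV. ch i m l z * bu m z)) = (\<Sum>i\<in>UNIV. bu i z * (\<Sum>m\<in>UNIV. ch m i l z * bd m z))"
    unfolding sum_distrib_left by (subst sum.swap) (simp add: mult_ac)
  finally show ?thesis
    by (simp add: r_d_def s_d_def sum.distrib distrib_left rdd_sym[of _ l])
qed

end

subsection \<open>The spray\<close>

abbreviation "ad \<equiv> (\<lambda>i j z. a z $ i $ j)"

definition dom :: "((real^'n) \<times> (real^'n)) set" where
  "dom = {p. fst p \<in> U \<and> lin bd p > 0}"

definition F :: "(real^'n) \<times> (real^'n) \<Rightarrow> real" where
  "F p = quad ad p / lin bd p"

definition A :: "(real^'n) \<times> (real^'n) \<Rightarrow> real" where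
  "A p = (F p * lin sd p + quad rdd p) / (2 * b2 (fst p))"

definition C :: "(real^'n) \<times> (real^'n) \<Rightarrow> real" where
  "C p = (lin sd p + quad rdd p / F p) / b2 (fst p)"

definition Q :: "'n \<Rightarrow> (real^'n) \<times> (real^'n) \<Rightarrow> real" where
  "Q i p = A p * bu i (fst p) - F p / 2 * lin (sud i) p - C p * snd p $ i"

lemma smooth_lin:
  assumes "open S" "fst ` S \<subseteq> U" "\<And>i. smooth_on U (w i)" shows "smooth_on S (lin w)"
  unfolding lin_def[abs_def]
  by (intro smooth_on_sum smooth_on_mult smooth_on_snd_nth smooth_on_fst[of U] assms open_U)

lemma smooth_quad:
  assumes "open S" "fst ` S \<subseteq> U" "\<And>i j. smooth_on U (t i j)" shows "smooth_on S (quad t)"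
  unfolding quad_def[abs_def]
  by (intro smooth_on_sum smooth_on_mult smooth_on_snd_nth smooth_on_fst[of U] assms open_U)

lemma open_dom: "open dom"
proof -
  have o: "open (fst -` U :: ((real^'n) \<times> (real^'n)) set)"
    by (intro open_vimage_fst open_U)
  have "smooth_on (fst -` U) (lin bd)"
    by (rule smooth_lin[OF o]) (auto simp: smooth_bd)
  then have "continuous_on (fst -` U) (lin bd)"
    unfolding smooth_on_def using Ck_on.simps(1) by blast
  then have "open (fst -` U \<inter> lin bd -` {0<..})"
    by (intro continuous_open_preimage o) auto
  also have "fst -` U \<inter> lin bd -` {0<..} = dom" by (auto simp: dom_def)
  finally show ?thesis .
qed

lemma fst_dom: "fst ` dom \<subseteq> U"
  by (auto simp: dom_def)

lemma quad_ad_pos: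
  assumes "p \<in> dom" shows "quad ad p > 0"
proof -
  have "snd p \<noteq> 0"
  proof
    assume "snd p = 0"
    then show False using assms by (simp add: dom_def lin_def)
  qed
  then show ?thesis using a_pos[of "fst p" "snd p"] assms by (simp add: dom_def quad_def)
qed

lemma F_pos: "p \<in> dom \<Longrightarrow> F p > 0"
  using quad_ad_pos by (auto simp: F_def dom_def)

lemma smooth_F: "smooth_on dom F"
  unfolding F_def[abs_def]
  by (rule smooth_on_divide[OF open_dom]; (intro smooth_lin smooth_quad open_dom fst_dom smooth_a_nth smooth_bd)?)
    (auto simp: dom_def)

lemma smooth_A: "smooth_on dom A"
  unfolding A_def[abs_def]
  by (rule smooth_on_divide[OF open_dom];
      (intro smooth_lin smooth_quad smooth_on_add smooth_on_mult smooth_on_const open_dom fst_dom smooth_F smooth_sd smooth_rdd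
        smooth_on_fst[OF open_U open_dom fst_dom smooth_b2])?)
    (use b2_pos in \<open>force simp: dom_def\<close>)

lemma smooth_C: "smooth_on dom C"
  unfolding C_def[abs_def]
  by (rule smooth_on_divide[OF open_dom];
      (intro smooth_lin smooth_quad smooth_on_add smooth_on_divide smooth_on_const open_dom fst_dom smooth_F smooth_sd smooth_rdd
        smooth_on_fst[OF open_U open_dom fst_dom smooth_b2])?)
    (use b2_pos F_pos in \<open>force simp: dom_def\<close>)+

lemma smooth_Q: "smooth_on dom (Q i)"
  unfolding Q_def[abs_def]
  by (intro smooth_on_diff smooth_on_mult smooth_on_divide smooth_on_const smooth_A smooth_C smooth_F smooth_lin smooth_sud
      smooth_on_snd_nth open_dom fst_dom smooth_on_fst[OF open_U open_dom fst_dom smooth_bu]) simp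

lemma ch_symmetric: "z \<in> U \<Longrightarrow> ch i j k z = ch i k j z"
  by (rule ch_sym)

sublocale cs: connection_spray dom U ch Q
  by standard (rule open_dom open_U fst_dom smooth_ch ch_symmetric smooth_Q; assumption?)+

context
  fixes p assumes p: "p \<in> dom"
begin

lemma base_in: "fst p \<in> U" and beta_pos: "lin bd p > 0"
  using p by (auto simp: dom_def)

lemma b2_nz [simp]: "b2 (fst p) \<noteq> 0"
  using b2_pos[OF base_in] by simp

lemma F_nz [simp]: "F p \<noteq> 0" and beta_nz [simp]: "lin bd p \<noteq> 0"
  using F_pos[OF p] beta_pos by auto

lemma F_diff [simp]: "F differentiable at p" "A differentiable at p" "C differentiable at p"
  "Q i differentiable at p" "dy k F differentiable at p" "dy k A differentiable at p" "dy k C differentiable at p"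
  by (rule smooth_on_differentiable[OF _ p], (intro smooth_on_dy)?, rule smooth_F smooth_A smooth_C smooth_Q)+

lemmas tensor_differentiable = diff_tensor[OF base_in] diff_base[OF base_in]
declare tensor_differentiable [simp]

lemma quad_ad: "quad ad p = F p * lin bd p"
  by (simp add: F_def)

lemma ad_sym: "lin (\<lambda>i. ad i k) p = lin (ad k) p"
  unfolding lin_def using a_sym[OF base_in] by simp

lemma dy_F: "dy k F p = (2 * lin (ad k) p - F p * bd k (fst p)) / lin bd p"
  unfolding F_def[abs_def]
  by (simp add: dy_divide dy_quad dy_lin ad_sym) (simp add: field_simps power2_eq_square)

lemma hcov_beta: "hcov ch l (lin bd) p = lin (rdd l) p - lin (sdd l) p"
proof -
  have "hcov ch l (lin bd) p = lin (\<lambda>i. cov_d a bd i l) p"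
    by (simp add: hcov_lin ch_sym[OF base_in] cov_d_def lin_def)
  also have "\<dots> = lin (\<lambda>i z. rdd l i z - sdd l i z) p"
    unfolding lin_def cov_bd by (subst rdd_sym, subst sdd_antisym) simp
  finally show ?thesis by (simp add: lin_diff)
qed

text \<open>Metric compatibility makes \<alpha> horizontally constant, so the horizontal derivative
  of \<open>F\<close> comes from \<beta> alone.\<close>

lemma hcov_quad_ad: "hcov ch l (quad ad) p = 0"
  by (simp add: hcov_quad ch_sym[OF base_in] quad_def pd_a[OF base_in] a_sym[OF base_in, of _ j for j] mult.commute)

lemma hcov_lin_ad: "hcov ch l (lin (ad k)) p = (\<Sum>m\<in>UNIV. ch m k l (fst p) * lin (ad m) p)"
proof -
  have "hcov ch l (lin (ad k)) p = lin (\<lambda>i z. \<Sum>m\<in>UNIV. ad i m z * ch m k l z) p"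
    by (simp add: hcov_lin ch_sym[OF base_in] lin_def pd_a[OF base_in] mult.commute)
  also have "\<dots> = (\<Sum>m\<in>UNIV. ch m k l (fst p) * lin (ad m) p)"
    unfolding lin_def sum_distrib_left sum_distrib_right
    by (subst sum.swap) (simp add: a_sym[OF base_in] mult_ac)
  finally show ?thesis .
qed

lemma hcov_F: "hcov ch l F p = - (F p * (lin (rdd l) p - lin (sdd l) p) / lin bd p)"
  unfolding F_def[abs_def]
  by (simp add: hcov_divide hcov_quad_ad hcov_beta power2_eq_square)

lemma y_bd: "(\<Sum>k\<in>UNIV. snd p $ k * bd k (fst p)) = lin bd p"
  by (simp add: lin_def mult.commute)

lemma y_ad: "(\<Sum>k\<in>UNIV. snd p $ k * lin (ad k) p) = F p * lin bd p"
  by (simp add: quad_lin[symmetric] quad_ad)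

lemma y_dy_F: "(\<Sum>k\<in>UNIV. snd p $ k * dy k F p) = F p"
proof -
  have "(\<Sum>k\<in>UNIV. snd p $ k * dy k F p)
    = (2 * (\<Sum>k\<in>UNIV. snd p $ k * lin (ad k) p) - F p * (\<Sum>k\<in>UNIV. snd p $ k * bd k (fst p))) / lin bd p"
    unfolding dy_F sum_divide_distrib sum_distrib_left sum_subtractf[symmetric]
    by (simp add: algebra_simps)
  then show ?thesis by (simp add: y_bd y_ad)
qed

lemma dy_F_contract:
  "(\<Sum>q\<in>UNIV. dy q F p * v q) = (2 * (\<Sum>q\<in>UNIV. lin (ad q) p * v q) - F p * (\<Sum>q\<in>UNIV. bd q (fst p) * v q)) / lin bd p"
  unfolding dy_F sum_divide_distrib sum_distrib_left sum_subtractf[symmetric]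
  by (simp add: algebra_simps)

lemma lin_ad_contract: "(\<Sum>q\<in>UNIV. lin (ad q) p * v q) = (\<Sum>j\<in>UNIV. snd p $ j * (\<Sum>q\<in>UNIV. ad j q (fst p) * v q))"
  unfolding lin_def sum_distrib_left sum_distrib_right
  by (subst sum.swap) (simp add: a_sym[OF base_in] mult_ac)

lemma ad_sig: "(\<Sum>q\<in>UNIV. ad i q (fst p) * lin (sud q) p) = lin (sdd i) p"
  unfolding lin_def sum_swap_mult a_sud[OF base_in] ..

lemma bd_sig: "(\<Sum>q\<in>UNIV. bd q (fst p) * lin (sud q) p) = lin sd p"
  unfolding lin_def sum_swap_mult bd_sud[OF base_in] ..

lemma quad_sdd: "quad sdd p = 0"
proof -
  have "quad sdd p = (\<Sum>i\<in>UNIV. \<Sum>j\<in>UNIV. - (sdd j i (fst p) * snd p $ j * snd p $ i))"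
    unfolding quad_def by (subst sdd_antisym) (simp add: mult_ac)
  also have "\<dots> = - quad sdd p" unfolding quad_def sum_negf by (subst sum.swap) (rule refl)
  finally show ?thesis by simp
qed

lemma yl_sig: "(\<Sum>q\<in>UNIV. lin (ad q) p * lin (sud q) p) = 0"
  unfolding lin_ad_contract ad_sig quad_lin[symmetric] quad_sdd ..

lemma yl_bu: "(\<Sum>q\<in>UNIV. lin (ad q) p * bu q (fst p)) = lin bd p"
  unfolding lin_ad_contract a_bu[OF base_in] y_bd ..

lemma yl_sud: "(\<Sum>q\<in>UNIV. lin (ad q) p * sud q k (fst p)) = - lin (sdd k) p"
  unfolding lin_ad_contract a_sud[OF base_in]
  by (subst sdd_antisym) (simp add: lin_def sum_negf mult.commute)

lemma yl_su: "(\<Sum>q\<in>UNIV. lin (ad q) p * su q (fst p)) = lin sd p"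
  unfolding lin_ad_contract a_su[OF base_in] by (simp add: lin_def mult.commute)

lemma dF_sig: "(\<Sum>q\<in>UNIV. dy q F p * lin (sud q) p) = - (F p * lin sd p / lin bd p)"
  by (simp add: dy_F_contract yl_sig bd_sig)

lemma dF_bu: "(\<Sum>q\<in>UNIV. dy q F p * bu q (fst p)) = 2 - F p * b2 (fst p) / lin bd p"
  by (simp add: dy_F_contract yl_bu b2_eq[OF base_in, symmetric] diff_divide_distrib)

lemma dF_sud: "(\<Sum>q\<in>UNIV. dy q F p * sud q k (fst p)) = - (2 * lin (sdd k) p + F p * sd k (fst p)) / lin bd p"
  by (simp add: dy_F_contract yl_sud bd_sud[OF base_in])

lemma dF_su: "(\<Sum>q\<in>UNIV. dy q F p * su q (fst p)) = 2 * lin sd p / lin bd p"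
  by (simp add: dy_F_contract yl_su bd_su[OF base_in])

lemma dF_y: "(\<Sum>q\<in>UNIV. dy q F p * snd p $ q) = F p"
  using y_dy_F by (simp add: mult.commute)

lemma contract_Q: "(\<Sum>q\<in>UNIV. w q * Q q p) = A p * (\<Sum>q\<in>UNIV. w q * bu q (fst p))
    - F p / 2 * (\<Sum>q\<in>UNIV. w q * lin (sud q) p) - C p * (\<Sum>q\<in>UNIV. w q * snd p $ q)"
  unfolding Q_def by (simp add: right_diff_distrib sum_subtractf sum_distrib_left mult_ac)

lemma C_eq: "C p = 2 * A p / F p"
  by (simp add: C_def A_def field_simps)

lemma quad_rdd: "quad rdd p = 2 * b2 (fst p) * A p - F p * lin sd p"
  by (simp add: A_def)

text \<open>The radial component of the spray equation. The relation \<open>C_eq\<close> makes the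
  y-term cancel the summand 2 of \<open>dF_bu\<close>, and \<open>quad_rdd\<close> collects what
  remains.\<close>

lemma dF_Q: "(\<Sum>q\<in>UNIV. dy q F p * Q q p) = - (F p * quad rdd p / (2 * lin bd p))"
  unfolding contract_Q dF_sig dF_bu dF_y quad_rdd C_eq by (simp add: field_simps)

end

text \<open>One more differentiation of \<open>\<beta> F_k + F b_k = 2 a_{km} y^m\<close>, which is
  \<open>dy_F\<close> cleared of its denominator. Only first derivatives of \<open>F\<close> are
  left on the right.\<close>

lemma dy_dy_F:
  assumes p: "p \<in> dom"
  shows "dy l (dy k F) p = (2 * ad k l (fst p) - dy k F p * bd l (fst p) - dy l F p * bd k (fst p)) / lin bd p"
proof -
  note [simp] = tensor_differentiable[OF p] F_diff[OF p] b2_nz[OF p] F_nz[OF p] beta_nz[OF p]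
  have "dy l (dy k F) p = dy l (\<lambda>p. (2 * lin (ad k) p - F p * bd k (fst p)) / lin bd p) p"
    by (rule dy_cong[OF open_dom p dy_F])
  also have "\<dots> = (2 * ad k l (fst p) - dy l F p * bd k (fst p)) / lin bd p
    - (2 * lin (ad k) p - F p * bd k (fst p)) * bd l (fst p) / (lin bd p)\<^sup>2"
    by (simp add: dy_divide dy_diff dy_mult dy_const dy_lin dy_fst_comp)
  also have "\<dots> = (2 * ad k l (fst p) - dy k F p * bd l (fst p) - dy l F p * bd k (fst p)) / lin bd p"
    unfolding dy_F[OF p, of k] by (simp add: field_simps power2_eq_square)
  finally show ?thesis .
qed

text \<open>The same relation, \<open>\<beta> F_k + F b_k = 2 a_{km} y^m\<close>, differentiated
  horizontally. Its right side is parallel, and the \<Gamma>-sum is the correction for the free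
  index \<open>k\<close>.\<close>

lemma hcov_dy_F:
  assumes p: "p \<in> dom"
  shows "hcov ch l (dy k F) p = (\<Sum>m\<in>UNIV. ch m k l (fst p) * dy m F p)
    - (hcov ch l F p * bd k (fst p) + F p * (rdd k l (fst p) + sdd k l (fst p))
       + dy k F p * hcov ch l (lin bd) p) / lin bd p"
proof -
  note [simp] = tensor_differentiable[OF p] F_diff[OF p] b2_nz[OF p] F_nz[OF p] beta_nz[OF p]
  have e: "pd l (bd k) (fst p) = rdd k l (fst p) + sdd k l (fst p) + (\<Sum>m\<in>UNIV. ch m k l (fst p) * bd m (fst p))"
    unfolding cov_bd[symmetric] cov_d_def by simp
  have "hcov ch l (dy k F) p = hcov ch l (\<lambda>p. (2 * lin (ad k) p - F p * bd k (fst p)) / lin bd p) p"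
    by (rule hcov_cong[OF open_dom p dy_F])
  also have "\<dots> = (2 * (\<Sum>m\<in>UNIV. ch m k l (fst p) * lin (ad m) p) - hcov ch l F p * bd k (fst p) - F p * pd l (bd k) (fst p)) / lin bd p
    - (2 * lin (ad k) p - F p * bd k (fst p)) * hcov ch l (lin bd) p / (lin bd p)\<^sup>2"
    by (simp add: hcov_divide hcov_diff hcov_mult hcov_const hcov_lin_ad[OF p] hcov_fst_comp algebra_simps)
  also have "(2 * lin (ad k) p - F p * bd k (fst p)) * hcov ch l (lin bd) p / (lin bd p)\<^sup>2 = dy k F p * hcov ch l (lin bd) p / lin bd p"
    unfolding dy_F[OF p] by (simp add: power2_eq_square)
  also have "2 * (\<Sum>m\<in>UNIV. ch m k l (fst p) * lin (ad m) p)
     = lin bd p * (\<Sum>m\<in>UNIV. ch m k l (fst p) * dy m F p) + F p * (\<Sum>m\<in>UNIV. ch m k l (fst p) * bd m (fst p))"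
    unfolding sum_distrib_left sum.distrib[symmetric] dy_F[OF p]
    by (rule sum.cong) (auto simp: field_simps)
  also have "(lin bd p * (\<Sum>m\<in>UNIV. ch m k l (fst p) * dy m F p) + F p * (\<Sum>m\<in>UNIV. ch m k l (fst p) * bd m (fst p))
      - hcov ch l F p * bd k (fst p) - F p * pd l (bd k) (fst p)) / lin bd p - dy k F p * hcov ch l (lin bd) p / lin bd p
    = (\<Sum>m\<in>UNIV. ch m k l (fst p) * dy m F p) - (hcov ch l F p * bd k (fst p)
       + F p * (rdd k l (fst p) + sdd k l (fst p)) + dy k F p * hcov ch l (lin bd) p) / lin bd p"
    unfolding e by (simp add: field_simps)
  finally show ?thesis .
qed

lemma ddF_Q:
  assumes p: "p \<in> dom"
  shows "(\<Sum>q\<in>UNIV. dy q (dy k F) p * Q q p) =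
   (2 * A p * bd k (fst p) - F p * lin (sdd k) p - 2 * C p * lin (ad k) p
     - dy k F p * (A p * b2 (fst p) - F p / 2 * lin sd p - C p * lin bd p)
     + F p * quad rdd p / (2 * lin bd p) * bd k (fst p)) / lin bd p"
proof -
  have "(\<Sum>q\<in>UNIV. dy q (dy k F) p * Q q p) = (2 * (\<Sum>q\<in>UNIV. ad k q (fst p) * Q q p)
     - dy k F p * (\<Sum>q\<in>UNIV. bd q (fst p) * Q q p) - bd k (fst p) * (\<Sum>q\<in>UNIV. dy q F p * Q q p)) / lin bd p"
    unfolding dy_dy_F[OF p] sum_divide_distrib sum_distrib_left sum_subtractf[symmetric]
    by (simp add: algebra_simps)
  also have "(\<Sum>q\<in>UNIV. ad k q (fst p) * Q q p) = A p * bd k (fst p) - F p / 2 * lin (sdd k) p - C p * lin (ad k) p"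
    unfolding contract_Q[OF p] ad_sig[OF p] a_bu[OF base_in[OF p]] lin_def[of "ad k"] ..
  also have "(\<Sum>q\<in>UNIV. bd q (fst p) * Q q p) = A p * b2 (fst p) - F p / 2 * lin sd p - C p * lin bd p"
    unfolding contract_Q[OF p] bd_sig[OF p] b2_eq[OF base_in[OF p]] lin_def[of bd] ..
  finally show ?thesis unfolding dF_Q[OF p] by (simp add: algebra_simps)
qed

text \<open>This is the Euler-Lagrange equation of \<open>F\<close> after removal of its Riemannian part.\<close>

lemma spray_identity:
  assumes p: "p \<in> dom"
  shows "(\<Sum>q\<in>UNIV. dy q (dy k F) p * Q q p) = 1/2 * ((\<Sum>j\<in>UNIV. snd p $ j * hcov ch j (dy k F) p)
    - (\<Sum>m\<in>UNIV. (\<Sum>j\<in>UNIV. ch m k j (fst p) * snd p $ j) * dy m F p) - hcov ch k F p)"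
proof -
  note [simp] = b2_nz[OF p] F_nz[OF p] beta_nz[OF p]
  have s1: "(\<Sum>j\<in>UNIV. snd p $ j * (\<Sum>m\<in>UNIV. ch m k j (fst p) * dy m F p))
     = (\<Sum>m\<in>UNIV. (\<Sum>j\<in>UNIV. ch m k j (fst p) * snd p $ j) * dy m F p)"
    unfolding sum_swap_mult by (simp add: mult.commute)
  have hb0: "(\<Sum>j\<in>UNIV. snd p $ j * hcov ch j (lin bd) p) = quad rdd p"
    unfolding hcov_beta[OF p] right_diff_distrib sum_subtractf quad_lin[symmetric] quad_sdd[OF p] by simp
  have hF0: "(\<Sum>j\<in>UNIV. snd p $ j * hcov ch j F p) = - (F p * quad rdd p / lin bd p)"
  proof -
    have "hcov ch j F p = - F p / lin bd p * hcov ch j (lin bd) p" for j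
      by (simp add: hcov_F[OF p] hcov_beta[OF p])
    then have "(\<Sum>j\<in>UNIV. snd p $ j * hcov ch j F p) = (- F p / lin bd p) * (\<Sum>j\<in>UNIV. snd p $ j * hcov ch j (lin bd) p)"
      unfolding sum_distrib_left by (simp add: mult_ac)
    then show ?thesis unfolding hb0 by simp
  qed
  define K where "K j = (\<Sum>m\<in>UNIV. ch m k j (fst p) * dy m F p)" for j
  have "(\<Sum>j\<in>UNIV. snd p $ j * hcov ch j (dy k F) p) = (\<Sum>j\<in>UNIV. snd p $ j * K j)
     - (bd k (fst p) * (\<Sum>j\<in>UNIV. snd p $ j * hcov ch j F p) + F p * (lin (rdd k) p + lin (sdd k) p)
         + dy k F p * (\<Sum>j\<in>UNIV. snd p $ j * hcov ch j (lin bd) p)) / lin bd p"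
    unfolding hcov_dy_F[OF p] K_def[symmetric] lin_def[of "rdd k"] lin_def[of "sdd k"] sum_divide_distrib sum_distrib_left
      sum.distrib[symmetric] sum_subtractf[symmetric]
    by (simp add: algebra_simps add_divide_distrib)
  then have bracket: "(\<Sum>j\<in>UNIV. snd p $ j * hcov ch j (dy k F) p)
    - (\<Sum>m\<in>UNIV. (\<Sum>j\<in>UNIV. ch m k j (fst p) * snd p $ j) * dy m F p) - hcov ch k F p
    = - ((bd k (fst p) * - (F p * quad rdd p / lin bd p) + F p * (lin (rdd k) p + lin (sdd k) p)
         + dy k F p * quad rdd p) / lin bd p) + F p * (lin (rdd k) p - lin (sdd k) p) / lin bd p"
    unfolding K_def s1 hb0 hF0 unfolding hcov_F[OF p] by simp
  \<comment> \<open>Trades \<open>a_{km} y^m\<close> for the derivative of \<open>F\<close>. The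
    multiples of \<beta> in the coefficient of that derivative then cancel, leaving half of
    \<open>quad rdd p\<close>.\<close>
  have "2 * C p * lin (ad k) p = C p * (dy k F p * lin bd p + F p * bd k (fst p))"
    unfolding dy_F[OF p] by simp
  then show ?thesis unfolding bracket ddF_Q[OF p] quad_rdd[OF p]
    by (simp add: C_eq[OF p] field_simps)
qed

lemma kropina_eq: "p \<in> dom \<Longrightarrow> kropina a b (fst p) (snd p) = F p"
  using quad_ad_pos[of p]
  by (simp add: kropina_def alpha_def beta_def F_def quad_def lin_def b_d_def less_imp_le)

section \<open>Invertibility of the fundamental tensor and verification of the spray\<close>

definition gm :: "(real^'n) \<times> (real^'n) \<Rightarrow> real^'n^'n" where
  "gm p = (\<chi> i j. dy i F p * dy j F p + F p * dy j (dy i F) p)"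

lemma gm_mult:
  assumes p: "p \<in> dom"
  shows "(\<Sum>j\<in>UNIV. gm p $ i $ j * v j) = dy i F p * (\<Sum>j\<in>UNIV. dy j F p * v j)
    + F p * (\<Sum>j\<in>UNIV. dy j (dy i F) p * v j)"
  by (simp add: gm_def sum.distrib[symmetric] sum_distrib_left algebra_simps)

text \<open>Trivial kernel by successive contraction: pairing with y shows that dF vanishes on
  \<open>v\<close>, pairing with the raised form shows that \<beta> vanishes on \<open>v\<close>,
  and then \<open>a\<close> itself annihilates \<open>v\<close>.\<close>

lemma invertible_gm:
  assumes p: "p \<in> dom" shows "invertible (gm p)"
proof -
  note z = base_in[OF p]
  note [simp] = b2_nz[OF p] F_nz[OF p] beta_nz[OF p]
  have "v = 0" if "gm p *v v = 0" for v
  proof -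
    define \<phi> where "\<phi> = (\<Sum>j\<in>UNIV. dy j F p * v $ j)"
    define \<beta> where "\<beta> = (\<Sum>j\<in>UNIV. bd j (fst p) * v $ j)"
    define av where "av i = (\<Sum>j\<in>UNIV. ad i j (fst p) * v $ j)" for i
    have e: "(\<Sum>j\<in>UNIV. dy j (dy i F) p * v $ j) = (2 * av i - dy i F p * \<beta> - \<phi> * bd i (fst p)) / lin bd p" for i
      unfolding dy_dy_F[OF p] \<phi>_def \<beta>_def av_def sum_divide_distrib sum_distrib_left sum_distrib_right sum_subtractf[symmetric]
      by (simp add: algebra_simps)
    have eq: "dy i F p * \<phi> + F p * ((2 * av i - dy i F p * \<beta> - \<phi> * bd i (fst p)) / lin bd p) = 0" for i
    proof -
      have "(gm p *v v) $ i = 0" using that by simp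
      then show ?thesis
        using gm_mult[OF p, of i "\<lambda>j. v $ j"] unfolding e \<phi>_def[symmetric] by (simp add: matrix_vector_mult_def)
    qed
    have yav: "2 * (\<Sum>i\<in>UNIV. snd p $ i * av i) = \<phi> * lin bd p + F p * \<beta>"
      using dy_F_contract[OF p, of "\<lambda>j. v $ j"] lin_ad_contract[OF p, of "\<lambda>j. v $ j"]
      unfolding \<phi>_def[symmetric] \<beta>_def[symmetric] av_def by simp
    \<comment> \<open>Pairing with y: by homogeneity the Hessian of \<open>F\<close> drops out and
      dF evaluates to \<open>F\<close>.\<close>
    have "0 = (\<Sum>i\<in>UNIV. snd p $ i * (dy i F p * \<phi> + F p * ((2 * av i - dy i F p * \<beta> - \<phi> * bd i (fst p)) / lin bd p)))"
      unfolding eq by simp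
    also have "\<dots> = (\<Sum>i\<in>UNIV. snd p $ i * dy i F p) * \<phi> + F p * ((2 * (\<Sum>i\<in>UNIV. snd p $ i * av i)
        - (\<Sum>i\<in>UNIV. snd p $ i * dy i F p) * \<beta> - \<phi> * (\<Sum>i\<in>UNIV. snd p $ i * bd i (fst p))) / lin bd p)"
      unfolding sum_divide_distrib sum_distrib_left sum_distrib_right sum_subtractf[symmetric] sum.distrib[symmetric]
      by (simp add: algebra_simps diff_divide_distrib)
    also have "\<dots> = F p * \<phi>" unfolding yav y_dy_F[OF p] y_bd[OF p] by simp
    finally have \<phi>: "\<phi> = 0" by simp
    then have av: "2 * av i = dy i F p * \<beta>" for i using eq[of i] by simp
    have "(\<Sum>i\<in>UNIV. bu i (fst p) * av i) = \<beta>"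
    proof -
      have "(\<Sum>i\<in>UNIV. bu i (fst p) * av i) = (\<Sum>j\<in>UNIV. (\<Sum>i\<in>UNIV. bu i (fst p) * ad i j (fst p)) * v $ j)"
        unfolding av_def by (rule sum_swap_mult)
      also have "\<dots> = (\<Sum>j\<in>UNIV. (\<Sum>i\<in>UNIV. ad j i (fst p) * bu i (fst p)) * v $ j)"
        by (simp add: a_sym[OF z] mult.commute)
      finally show ?thesis unfolding a_bu[OF z] \<beta>_def .
    qed
    moreover have "2 * (\<Sum>i\<in>UNIV. bu i (fst p) * av i) = (\<Sum>i\<in>UNIV. dy i F p * bu i (fst p)) * \<beta>"
    proof -
      have "2 * (bu i (fst p) * av i) = dy i F p * bu i (fst p) * \<beta>" for i
      proof -
        have "2 * (bu i (fst p) * av i) = bu i (fst p) * (2 * av i)" by simp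
        then show ?thesis unfolding av by simp
      qed
      then show ?thesis unfolding sum_distrib_left sum_distrib_right by (simp only:)
    qed
    \<comment> \<open>The two evaluations of the pairing with \<open>bu\<close> differ by this
      multiple of \<open>\<beta>\<close>, whose factor is nonzero because b^2 is.\<close>
    ultimately have "F p * b2 (fst p) / lin bd p * \<beta> = 0"
      unfolding dF_bu[OF p] by (simp add: algebra_simps)
    then have "\<beta> = 0" by simp
    then have "av i = 0" for i using av[of i] by simp
    then have "a (fst p) *v v = 0" by (simp add: vec_eq_iff matrix_vector_mult_def av_def)
    then have "matrix_inv (a (fst p)) *v (a (fst p) *v v) = 0" by simp
    then show ?thesis
      using matrix_inv_works(2)[OF invertible_a[OF z]] by (simp add: matrix_vector_mul_assoc)
  qed
  then show ?thesis using matrix_left_invertible_ker invertible_left_inverse by blast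
qed

text \<open>The linear system for the spray splits along \<open>gm\<close>: the rank-one part needs
  the radial identity \<open>dF_Q\<close>, the Hessian part needs \<open>spray_identity\<close>.
  Invertibility of \<open>gm\<close> then identifies the solution.\<close>

lemma spray_eq:
  assumes p: "(x, y) \<in> dom"
  shows "spray (kropina a b) i x y = cs.G i (x, y)"
proof -
  define L where "L p = F p * F p" for p
  have sL: "smooth_on dom L"
    unfolding L_def[abs_def] by (intro smooth_on_mult smooth_F open_dom)
  have kL: "(kropina a b z w)\<^sup>2 = L (z, w)" if "(z, w) \<in> dom" for z w
    using kropina_eq[OF that] by (simp add: L_def power2_eq_square)
  have y1: "pd k (\<lambda>w. (kropina a b z w)\<^sup>2) w = dy k L (z, w)" if "(z, w) \<in> dom" for k z w
    by (rule pd_snd_on[OF open_dom that sL]) (rule kL)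
  have x1: "pd k (\<lambda>z. (kropina a b z y)\<^sup>2) x = dx k L (x, y)" for k
    by (rule pd_fst_on[OF open_dom p sL]) (rule kL)
  have xy: "pd j (\<lambda>z. pd k (\<lambda>w. (kropina a b z w)\<^sup>2) y) x = dx j (dy k L) (x, y)" for j k
    by (rule pd_fst_on[OF open_dom p smooth_on_dy[OF sL]]) (rule y1)
  have yy: "pd j (\<lambda>v. pd k (\<lambda>w. (kropina a b x w)\<^sup>2) v) y = dy j (dy k L) (x, y)" for j k
    by (rule pd_snd_on[OF open_dom p smooth_on_dy[OF sL]]) (rule y1)
  have dL: "dy k L q = 2 * F q * dy k F q" if "q \<in> dom" for k q
    unfolding L_def[abs_def] using F_diff[OF that] by (simp add: dy_mult)
  note [simp] = F_diff[OF p]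
  have dxL: "dx k L (x, y) = 2 * F (x, y) * dx k F (x, y)" for k
    unfolding L_def[abs_def] by (simp add: dx_mult)
  have ddL: "dy j (dy k L) (x, y) = 2 * (dy k F (x, y) * dy j F (x, y) + F (x, y) * dy j (dy k F) (x, y))" for j k
  proof -
    have "dy j (dy k L) (x, y) = dy j (\<lambda>q. 2 * F q * dy k F q) (x, y)"
      by (rule dy_cong[OF open_dom p dL])
    then show ?thesis by (simp add: dy_mult dy_const algebra_simps)
  qed
  have dxdL: "dx j (dy k L) (x, y) = 2 * (F (x, y) * dx j (dy k F) (x, y) + dx j F (x, y) * dy k F (x, y))" for j k
  proof -
    have "dx j (dy k L) (x, y) = dx j (\<lambda>q. 2 * F q * dy k F q) (x, y)"
      by (rule dx_cong[OF open_dom p dL])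
    then show ?thesis by (simp add: dx_mult dx_const algebra_simps)
  qed
  have gm: "fundamental_tensor (kropina a b) x y = gm (x, y)"
    unfolding fundamental_tensor_def gm_def yy ddL by (simp add: add_divide_distrib)
  define c where "c q l = (\<Sum>j\<in>UNIV. ch q l j x * y $ j)" for q l
  define \<gamma> where "\<gamma> q = (\<Sum>j\<in>UNIV. y $ j * c q j)" for q
  have dxh: "dx l f (x, y) = hcov ch l f (x, y) + (\<Sum>q\<in>UNIV. c q l * dy q f (x, y))" for l f
    by (simp add: hcov_def c_def)
  have dx0: "(\<Sum>j\<in>UNIV. y $ j * dx j f (x, y)) = (\<Sum>j\<in>UNIV. y $ j * hcov ch j f (x, y)) + (\<Sum>q\<in>UNIV. \<gamma> q * dy q f (x, y))" for f
    unfolding dxh distrib_left sum.distrib sum_swap_mult \<gamma>_def ..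
  have G: "cs.G q (x, y) = 1/2 * \<gamma> q + Q q (x, y)" for q
    by (simp add: cs.G_def \<gamma>_def c_def sum_distrib_left mult_ac)
  \<comment> \<open>Horizontality of \<open>F\<close> contracted with y; this settles the rank-one
    part.\<close>
  have hF0: "(\<Sum>j\<in>UNIV. y $ j * hcov ch j F (x, y)) = 2 * (\<Sum>q\<in>UNIV. dy q F (x, y) * Q q (x, y))"
  proof -
    have "(\<Sum>j\<in>UNIV. y $ j * hcov ch j F (x, y)) = - (F (x, y) / lin bd (x, y)) * (quad rdd (x, y) - quad sdd (x, y))"
      unfolding hcov_F[OF p] quad_lin right_diff_distrib sum_distrib_left sum_subtractf[symmetric]
      by (simp add: algebra_simps diff_divide_distrib)
    then show ?thesis by (simp add: dF_Q[OF p] quad_sdd[OF p])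
  qed
  define T where "T k = (\<Sum>j\<in>UNIV. dx j (dy k L) (x, y) * y $ j) - dx k L (x, y)" for k
  have T: "1/4 * T k = (\<Sum>q\<in>UNIV. gm (x, y) $ k $ q * cs.G q (x, y))" for k
  proof -
    have sL: "(\<Sum>j\<in>UNIV. dx j (dy k L) (x, y) * y $ j) = 2 * (F (x, y) * (\<Sum>j\<in>UNIV. y $ j * dx j (dy k F) (x, y))
        + dy k F (x, y) * (\<Sum>j\<in>UNIV. y $ j * dx j F (x, y)))"
      unfolding dxdL by (simp add: sum_distrib_left sum.distrib algebra_simps)
    have sG: "(\<Sum>q\<in>UNIV. h q * cs.G q (x, y)) = 1/2 * (\<Sum>q\<in>UNIV. \<gamma> q * h q) + (\<Sum>q\<in>UNIV. h q * Q q (x, y))" for h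
      unfolding G by (simp add: distrib_left sum.distrib sum_distrib_left mult_ac)
    show ?thesis
      unfolding T_def sL dx0 dxL dxh[of k F] gm_mult[OF p] sG spray_identity[OF p] hF0
      by (simp add: c_def algebra_simps)
  qed
  have "spray (kropina a b) i x y = (\<Sum>k\<in>UNIV. matrix_inv (gm (x, y)) $ i $ k * (1/4 * T k))"
    unfolding spray_def gm xy x1 T_def by (simp add: sum_distrib_left mult_ac)
  also have "\<dots> = (matrix_inv (gm (x, y)) *v (gm (x, y) *v (\<chi> q. cs.G q (x, y)))) $ i"
    unfolding T by (simp add: matrix_vector_mult_def)
  also have "\<dots> = cs.G i (x, y)"
    using matrix_inv_works(2)[OF invertible_gm[OF p]] by (simp add: matrix_vector_mul_assoc)
  finally show ?thesis .
qed

subsection \<open>Derivatives along the spray\<close>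

abbreviation "rs \<equiv> r_scalar a b"

definition "s_sq z = (\<Sum>m\<in>UNIV. sd m z * su m z)"
definition "s_tr z = (\<Sum>t\<in>UNIV. \<Sum>m\<in>UNIV. sud t m z * sud m t z)"
definition "r_tr z = (\<Sum>m\<in>UNIV. rud m m z)"
definition "s_sud k z = (\<Sum>m\<in>UNIV. sd m z * sud m k z)"
definition "r_sud k z = (\<Sum>m\<in>UNIV. rd m z * sud m k z)"
definition "rdd_su k z = (\<Sum>m\<in>UNIV. rdd k m z * su m z)"
definition "rdd_sud i j z = (\<Sum>m\<in>UNIV. rdd m i z * sud m j z)"

context
  fixes p assumes p: "p \<in> dom"
begin

lemma dom_simps [simp]: "b2 (fst p) \<noteq> 0" "F p \<noteq> 0" "lin bd p \<noteq> 0"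
  "F differentiable at p" "A differentiable at p" "C differentiable at p"
  "Q i differentiable at p" "dy k F differentiable at p" "dy k A differentiable at p" "dy k C differentiable at p"
  using b2_nz[OF p] F_nz[OF p] beta_nz[OF p] F_diff[OF p] by auto

declare tensor_differentiable[OF p, simp]

lemma dy_quad_rdd: "dy k (quad rdd) p = 2 * lin (rdd k) p"
proof -
  have "lin (\<lambda>i. rdd i k) p = lin (rdd k) p" unfolding lin_def by (subst rdd_sym) (rule refl)
  then show ?thesis by (simp add: dy_quad)
qed

lemma dy_A: "dy k A p = (dy k F p * lin sd p + F p * sd k (fst p) + 2 * lin (rdd k) p) / (2 * b2 (fst p))"
  unfolding A_def[abs_def]
  by (simp add: dy_simps dy_quad_rdd dy_lin dy_fst_comp)

lemma dy_C: "dy k C p = (sd k (fst p) + 2 * lin (rdd k) p / F p - quad rdd p * dy k F p / (F p)\<^sup>2) / b2 (fst p)"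
  unfolding C_def[abs_def]
  by (simp add: dy_simps dy_quad_rdd dy_lin dy_fst_comp)

lemma Q1_eq: "cs.Q1 i k p = dy k A p * bu i (fst p) - (dy k F p * lin (sud i) p + F p * sud i k (fst p)) / 2
    - dy k C p * snd p $ i - (if i = k then C p else 0)"
  unfolding cs.Q1_def unfolding Q_def[abs_def]
  by (simp add: dy_simps dy_lin dy_fst_comp dy_snd_nth)

lemma rl_bu: "(\<Sum>q\<in>UNIV. lin (rdd q) p * bu q (fst p)) = lin rd p"
proof -
  have "(\<Sum>q\<in>UNIV. bu q (fst p) * lin (rdd q) p) = lin (\<lambda>k z. \<Sum>m\<in>UNIV. bu m (fst p) * rdd m k z) p"
    by (rule lin_contract)
  also have "\<dots> = lin rd p" by (simp add: lin_def r_d_def rdd_sym)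
  finally show ?thesis by (simp add: mult.commute)
qed

lemma rl_y: "(\<Sum>q\<in>UNIV. lin (rdd q) p * snd p $ q) = quad rdd p"
  by (simp add: quad_lin mult.commute)

lemma rl_su: "(\<Sum>q\<in>UNIV. lin (rdd q) p * su q (fst p)) = lin rdd_su p"
proof -
  have "(\<Sum>q\<in>UNIV. su q (fst p) * lin (rdd q) p) = lin (\<lambda>k z. \<Sum>m\<in>UNIV. su m (fst p) * rdd m k z) p"
    by (rule lin_contract)
  also have "\<dots> = lin rdd_su p" unfolding lin_def rdd_su_def by (subst rdd_sym) (simp add: mult.commute)
  finally show ?thesis by (simp add: mult.commute)
qed

lemma rl_sud: "(\<Sum>q\<in>UNIV. lin (rdd q) p * sud q k (fst p)) = lin (\<lambda>i. rdd_sud i k) p"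
  unfolding lin_def rdd_sud_def sum_distrib_right by (subst sum.swap) (simp add: mult_ac)

lemma rl_sig: "(\<Sum>q\<in>UNIV. lin (rdd q) p * lin (sud q) p) = quad rdd_sud p"
proof -
  have "(\<Sum>q\<in>UNIV. lin (rdd q) p * lin (sud q) p) = (\<Sum>j\<in>UNIV. (\<Sum>q\<in>UNIV. lin (rdd q) p * sud q j (fst p)) * snd p $ j)"
    unfolding lin_def[of "sud _"] by (rule sum_swap_mult)
  also have "\<dots> = (\<Sum>j\<in>UNIV. \<Sum>i\<in>UNIV. rdd_sud i j (fst p) * snd p $ i * snd p $ j)"
    unfolding rl_sud by (simp add: lin_def sum_distrib_right)
  also have "\<dots> = quad rdd_sud p" unfolding quad_def by (rule sum.swap)
  finally show ?thesis .
qed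

lemma sd_y: "(\<Sum>q\<in>UNIV. sd q (fst p) * snd p $ q) = lin sd p"
  by (simp add: lin_def)

lemma rd_y: "(\<Sum>q\<in>UNIV. rd q (fst p) * snd p $ q) = lin rd p"
  by (simp add: lin_def)

lemma sd_sud: "(\<Sum>q\<in>UNIV. sd q (fst p) * sud q k (fst p)) = s_sud k (fst p)"
  by (simp add: s_sud_def)

lemma rd_sud: "(\<Sum>q\<in>UNIV. rd q (fst p) * sud q k (fst p)) = r_sud k (fst p)"
  by (simp add: r_sud_def)

lemma sd_sig: "(\<Sum>q\<in>UNIV. sd q (fst p) * lin (sud q) p) = lin s_sud p"
  unfolding lin_contract by (simp add: lin_def s_sud_def)

lemma rd_sig: "(\<Sum>q\<in>UNIV. rd q (fst p) * lin (sud q) p) = lin r_sud p"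
  unfolding lin_contract by (simp add: lin_def r_sud_def)

lemma sd_su: "(\<Sum>q\<in>UNIV. sd q (fst p) * su q (fst p)) = s_sq (fst p)"
  by (simp add: s_sq_def)

lemmas contractions = dF_sig[OF p] dF_bu[OF p] dF_y[OF p] dF_su[OF p] dF_sud[OF p]
  rl_bu rl_y rl_su rl_sud rl_sig sd_bu[OF base_in[OF p]] rd_bu[OF base_in[OF p]]
  sd_y rd_y sd_sud rd_sud sd_sig rd_sig sd_su

lemma A_contract: "(\<Sum>q\<in>UNIV. dy q A p * v q) = ((\<Sum>q\<in>UNIV. dy q F p * v q) * lin sd p
    + F p * (\<Sum>q\<in>UNIV. sd q (fst p) * v q) + 2 * (\<Sum>q\<in>UNIV. lin (rdd q) p * v q)) / (2 * b2 (fst p))"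
  unfolding dy_A sum_divide_distrib sum_distrib_left sum_distrib_right sum.distrib[symmetric]
  by (simp add: algebra_simps)

lemma C_contract: "(\<Sum>q\<in>UNIV. dy q C p * v q) = ((\<Sum>q\<in>UNIV. sd q (fst p) * v q)
    + 2 * (\<Sum>q\<in>UNIV. lin (rdd q) p * v q) / F p - quad rdd p * (\<Sum>q\<in>UNIV. dy q F p * v q) / (F p)\<^sup>2) / b2 (fst p)"
  unfolding dy_C sum_divide_distrib sum_distrib_left sum_distrib_right sum.distrib[symmetric] sum_subtractf[symmetric]
  by (simp add: algebra_simps diff_divide_distrib add_divide_distrib)

lemma Q1_covector: "(\<Sum>q\<in>UNIV. cs.Q1 q l p * w q) = dy l A p * (\<Sum>q\<in>UNIV. w q * bu q (fst p))
    - (dy l F p * (\<Sum>q\<in>UNIV. w q * lin (sud q) p) + F p * (\<Sum>q\<in>UNIV. w q * sud q l (fst p))) / 2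
    - dy l C p * (\<Sum>q\<in>UNIV. w q * snd p $ q) - C p * w l"
proof -
  have "(\<Sum>q\<in>UNIV. (if q = l then C p else 0) * w q) = C p * w l"
    by (simp add: if_distrib[of "\<lambda>x. x * _"] cong: if_cong)
  then show ?thesis
    unfolding Q1_eq left_diff_distrib sum_subtractf
    by (simp add: sum_distrib_left sum_divide_distrib sum.distrib[symmetric] algebra_simps add_divide_distrib)
qed

lemma Q1_vector: "(\<Sum>q\<in>UNIV. cs.Q1 i q p * v q) = (\<Sum>q\<in>UNIV. dy q A p * v q) * bu i (fst p)
    - ((\<Sum>q\<in>UNIV. dy q F p * v q) * lin (sud i) p + F p * (\<Sum>q\<in>UNIV. sud i q (fst p) * v q)) / 2
    - (\<Sum>q\<in>UNIV. dy q C p * v q) * snd p $ i - C p * v i"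
proof -
  have "(\<Sum>q\<in>UNIV. (if i = q then C p else 0) * v q) = C p * v i"
    by (simp add: if_distrib[of "\<lambda>x. x * _"] cong: if_cong)
  then show ?thesis
    unfolding Q1_eq left_diff_distrib sum_subtractf
    by (simp add: sum_distrib_left sum_distrib_right sum_divide_distrib sum.distrib[symmetric] algebra_simps add_divide_distrib)
qed

text \<open>The \<beta>-term of dA on \<open>bu\<close> cancels against that of dF on
  \<open>s^i_0\<close>, and the trace of \<open>sud\<close> vanishes. The number n+1 is n from the
  identity part of \<open>Q1\<close> plus 1 from the derivative of \<open>C\<close> along y.\<close>

lemma T_eq: "cs.T p = (lin sd p + lin rd p) / b2 (fst p) - (real CARD('n) + 1) * C p"
proof -
  have "cs.T p = (\<Sum>q\<in>UNIV. dy q A p * bu q (fst p)) - ((\<Sum>q\<in>UNIV. dy q F p * lin (sud q) p)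
      + F p * (\<Sum>q\<in>UNIV. sud q q (fst p))) / 2 - (\<Sum>q\<in>UNIV. dy q C p * snd p $ q) - real CARD('n) * C p"
    unfolding cs.T_def Q1_eq by (simp add: sum_subtractf sum.distrib sum_distrib_left sum_divide_distrib[symmetric])
  also have "\<dots> = (lin sd p + lin rd p) / b2 (fst p) - (real CARD('n) + 1) * C p"
    unfolding A_contract C_contract contractions trace_sud[OF base_in[OF p]] C_def
    by (simp add: field_simps power2_eq_square)
  finally show ?thesis .
qed

text \<open>A Finsler metric is constant along the horizontal directions of its own spray; here this
  is checked on the explicit \<open>Q1\<close>.\<close>

lemma dcov_F: "cs.dcov l F p = 0"
  unfolding cs.dcov_def Q1_covector contractions hcov_F[OF p] dy_A dy_C C_def
  by (simp add: field_simps power2_eq_square)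

end

section \<open>Calculus of the horizontal derivative of the full spray\<close>

lemma smooth_s_sud: "smooth_on U (s_sud k)"
  unfolding s_sud_def[abs_def] by (intro smooth_base smooth_sd smooth_sud)

definition cdir :: "'n \<Rightarrow> (real^'n) \<times> (real^'n) \<Rightarrow> (real^'n) \<times> (real^'n)" where
  "cdir l p = hdir ch l p - (\<Sum>q\<in>UNIV. cs.Q1 q l p *\<^sub>R (0, axis q 1))"

lemma dcov_eq_dd: "f differentiable at p \<Longrightarrow> cs.dcov l f p = dd f p (cdir l p)"
  unfolding cs.dcov_def cdir_def dy_def
  by (simp only: hcov_eq_dd dd_diff_dir dd_sum_dir dd_scale_dir real_scaleR_def)

lemma dcov_add: "f differentiable at p \<Longrightarrow> g differentiable at p \<Longrightarrow>
    cs.dcov l (\<lambda>p. f p + g p) p = cs.dcov l f p + cs.dcov l g p"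
  by (simp add: dcov_eq_dd dd_add)

lemma dcov_diff: "f differentiable at p \<Longrightarrow> g differentiable at p \<Longrightarrow>
    cs.dcov l (\<lambda>p. f p - g p) p = cs.dcov l f p - cs.dcov l g p"
  by (simp add: dcov_eq_dd dd_diff)

lemma dcov_mult: "f differentiable at p \<Longrightarrow> g differentiable at p \<Longrightarrow>
    cs.dcov l (\<lambda>p. f p * g p) p = f p * cs.dcov l g p + cs.dcov l f p * g p"
  by (simp add: dcov_eq_dd dd_mult)

lemma dcov_divide: "f differentiable at p \<Longrightarrow> g differentiable at p \<Longrightarrow> g p \<noteq> 0 \<Longrightarrow>
    cs.dcov l (\<lambda>p. f p / g p) p = cs.dcov l f p / g p - f p * cs.dcov l g p / (g p)\<^sup>2"
  by (simp add: dcov_eq_dd dd_divide)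

lemma dcov_const: "cs.dcov l (\<lambda>p. c) p = 0"
  by (simp add: cs.dcov_def hcov_const dy_const)

lemma dcov_cong: "p \<in> dom \<Longrightarrow> (\<And>q. q \<in> dom \<Longrightarrow> f q = g q) \<Longrightarrow> cs.dcov l f p = cs.dcov l g p"
  by (simp add: cs.dcov_def hcov_cong[OF open_dom, of p f g] dy_cong[OF open_dom, of p f g])

context
  fixes p assumes p: "p \<in> dom"
begin

declare tensor_differentiable[OF p, simp] dom_simps[OF p, simp]

lemma hcov_lin_cov: "(\<And>i. w i differentiable at (fst p)) \<Longrightarrow> hcov ch l (lin w) p = lin (\<lambda>i. cov_d a w i l) p"
  by (simp add: hcov_lin ch_sym[OF base_in[OF p]]) (simp add: lin_def cov_d_def)

lemma hcov_quad_cov: "(\<And>i j. t i j differentiable at (fst p)) \<Longrightarrow>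
    hcov ch l (quad t) p = quad (\<lambda>i j. cov_dd a t i j l) p"
  by (simp add: hcov_quad ch_sym[OF base_in[OF p]]) (simp add: quad_def cov_dd_def)

lemma hcov_b2: "hcov ch l (\<lambda>p. b2 (fst p)) p = 2 * (rd l (fst p) + sd l (fst p))"
  by (simp add: hcov_fst_comp pd_b2[OF base_in[OF p]])

lemma dcov_b2: "cs.dcov l (\<lambda>p. b2 (fst p)) p = 2 * (rd l (fst p) + sd l (fst p))"
  by (simp add: cs.dcov_def hcov_b2 dy_fst_comp)

lemma dcov_sd: "cs.dcov l (lin sd) p = lin (\<lambda>i. cov_d a sd i l) p
    + (dy l F p * lin s_sud p + F p * s_sud l (fst p)) / 2 + dy l C p * lin sd p + C p * sd l (fst p)"
  by (simp add: cs.dcov_def hcov_lin_cov dy_lin Q1_covector[OF p] contractions[OF p])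

lemma dcov_rd: "cs.dcov l (lin rd) p = lin (\<lambda>i. cov_d a rd i l) p - dy l A p * rs (fst p)
    + (dy l F p * lin r_sud p + F p * r_sud l (fst p)) / 2 + dy l C p * lin rd p + C p * rd l (fst p)"
  by (simp add: cs.dcov_def hcov_lin_cov dy_lin Q1_covector[OF p] contractions[OF p])

lemma dcov_rdd: "cs.dcov l (quad rdd) p = quad (\<lambda>i j. cov_dd a rdd i j l) p - 2 * (dy l A p * lin rd p
    - (dy l F p * quad rdd_sud p + F p * lin (\<lambda>i. rdd_sud i l) p) / 2 - dy l C p * quad rdd p - C p * lin (rdd l) p)"
proof -
  have "(\<Sum>q\<in>UNIV. cs.Q1 q l p * (2 * lin (rdd q) p)) = 2 * (\<Sum>q\<in>UNIV. cs.Q1 q l p * lin (rdd q) p)"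
    by (simp add: sum_distrib_left mult_ac)
  then show ?thesis
    by (simp add: cs.dcov_def hcov_quad_cov dy_quad_rdd[OF p] Q1_covector[OF p] contractions[OF p])
qed

text \<open>By \<open>dcov_F\<close> the denominator \<open>F\<close> acts as a constant, so only
  \<open>s_0\<close>, \<open>r_{00}\<close> and b^2 are differentiated.\<close>

lemma dcov_C: "cs.dcov l C p = (cs.dcov l (lin sd) p + cs.dcov l (quad rdd) p / F p) / b2 (fst p)
    - C p * (2 * (rd l (fst p) + sd l (fst p))) / b2 (fst p)"
proof -
  have "cs.dcov l C p = (cs.dcov l (lin sd) p + cs.dcov l (quad rdd) p / F p) / b2 (fst p)
     - (lin sd p + quad rdd p / F p) * (2 * (rd l (fst p) + sd l (fst p))) / (b2 (fst p))\<^sup>2"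
    unfolding C_def[abs_def] by (simp add: dcov_divide dcov_add dcov_F[OF p] dcov_b2)
  then show ?thesis by (simp add: C_def power2_eq_square)
qed

lemma dcov_T: "cs.dcov l cs.T p = (cs.dcov l (lin sd) p + cs.dcov l (lin rd) p) / b2 (fst p)
    - (lin sd p + lin rd p) * (2 * (rd l (fst p) + sd l (fst p))) / (b2 (fst p))\<^sup>2 - (real CARD('n) + 1) * cs.dcov l C p"
proof -
  have "cs.dcov l cs.T p = cs.dcov l (\<lambda>p. (lin sd p + lin rd p) / b2 (fst p) - (real CARD('n) + 1) * C p) p"
    by (rule dcov_cong[OF p T_eq])
  then show ?thesis by (simp add: dcov_diff dcov_divide dcov_add dcov_mult dcov_const dcov_b2)
qed

end

subsection \<open>The function \<open>W\<close>\<close>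

definition "divs l z = (\<Sum>m\<in>UNIV. cov_ud a sud m l m z)"
definition "sd_b i z = (\<Sum>m\<in>UNIV. cov_d a sd i m z * bu m z)"
definition "rdd_b i j z = (\<Sum>m\<in>UNIV. cov_dd a rdd i j m z * bu m z)"
definition "r000 p = (\<Sum>m\<in>UNIV. quad (\<lambda>i j. cov_dd a rdd i j m) p * snd p $ m)"

definition W_formula :: "(real^'n) \<times> (real^'n) \<Rightarrow> real" where
  "W_formula p = (F p * lin sd_b p + quad rdd_b p) / (2 * b2 (fst p)) - F p * lin divs p / 2
    + (F p * lin sd p + quad rdd p) * (r_tr (fst p) / (2 * b2 (fst p)) - rs (fst p) / (b2 (fst p))\<^sup>2)
    - (quad (cov_d a sd) p + r000 p / F p) / b2 (fst p)
    - F p * F p * (s_tr (fst p) / 8 + s_sq (fst p) / (4 * b2 (fst p)))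
    - (lin sd p + lin rd p) * (lin sd p + lin rd p) / (2 * (b2 (fst p))\<^sup>2)
    - F p * (lin rdd_su p + lin s_sud p) / (2 * b2 (fst p)) - quad rdd_sud p / b2 (fst p)
    - (real CARD('n) + 7) / 2 * (C p * C p) + 5 * (C p * (lin sd p + lin rd p)) / b2 (fst p)"

context
  fixes p assumes p: "p \<in> dom"
begin

declare tensor_differentiable[OF p, simp] dom_simps[OF p, simp]

lemma sl_bu: "(\<Sum>q\<in>UNIV. lin (sdd q) p * bu q (fst p)) = lin sd p"
proof -
  have "(\<Sum>q\<in>UNIV. bu q (fst p) * lin (sdd q) p) = lin (\<lambda>k z. \<Sum>m\<in>UNIV. bu m (fst p) * sdd m k z) p"
    by (rule lin_contract)
  also have "\<dots> = lin sd p" by (simp add: lin_def s_d_def)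
  finally show ?thesis by (simp add: mult.commute)
qed

lemma sl_y: "(\<Sum>q\<in>UNIV. lin (sdd q) p * snd p $ q) = 0"
  using quad_sdd[OF p] by (simp add: quad_lin mult.commute)

lemma sig_y: "(\<Sum>q\<in>UNIV. sud m q (fst p) * snd p $ q) = lin (sud m) p"
  by (simp add: lin_def)

lemma dF_sud_sig: "(\<Sum>m\<in>UNIV. dy m F p * (\<Sum>q\<in>UNIV. sud m q (fst p) * lin (sud q) p))
  = - ((2 * (\<Sum>q\<in>UNIV. lin (sdd q) p * lin (sud q) p) + F p * lin s_sud p) / lin bd p)"
  unfolding sum_swap_mult dF_sud[OF p] sd_sig[OF p, symmetric]
  unfolding sum_distrib_left sum.distrib[symmetric] sum_divide_distrib sum_negf[symmetric]
  by (simp add: algebra_simps add_divide_distrib diff_divide_distrib)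

lemma sud_swap: "(\<Sum>m\<in>UNIV. (\<Sum>q\<in>UNIV. d q * sud q m (fst p)) * v m) = (\<Sum>q\<in>UNIV. d q * (\<Sum>m\<in>UNIV. sud q m (fst p) * v m))"
  by (rule sum_swap_mult[symmetric])

lemma hcov_A: "hcov ch m A p = (hcov ch m F p * lin sd p + F p * lin (\<lambda>i. cov_d a sd i m) p
    + quad (\<lambda>i j. cov_dd a rdd i j m) p) / (2 * b2 (fst p)) - A p * (2 * (rd m (fst p) + sd m (fst p))) / b2 (fst p)"
  unfolding A_def[abs_def]
  by (simp add: hcov_divide hcov_add hcov_mult hcov_const hcov_lin_cov[OF p] hcov_quad_cov[OF p] hcov_b2[OF p])
    (simp add: field_simps power2_eq_square)

lemma hcov_C: "hcov ch m C p = (lin (\<lambda>i. cov_d a sd i m) p + quad (\<lambda>i j. cov_dd a rdd i j m) p / F p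
    - quad rdd p * hcov ch m F p / (F p)\<^sup>2) / b2 (fst p) - C p * (2 * (rd m (fst p) + sd m (fst p))) / b2 (fst p)"
  unfolding C_def[abs_def]
  by (simp add: hcov_divide hcov_add hcov_mult hcov_const hcov_lin_cov[OF p] hcov_quad_cov[OF p] hcov_b2[OF p])
    (simp add: field_simps power2_eq_square)

text \<open>The left side is the covariant horizontal derivative of the vector \<open>Q\<close>. The
  connection terms arising from \<open>bu\<close>, from \<open>s^i_0\<close> and from y are those of
  \<open>contract_Q\<close>, so only tensors survive.\<close>

lemma hcov_Q: "hcov ch m (Q i) p + (\<Sum>q\<in>UNIV. ch i m q (fst p) * Q q p) = hcov ch m A p * bu i (fst p)
    + A p * (\<Sum>q\<in>UNIV. au i q (fst p) * (rdd q m (fst p) + sdd q m (fst p)))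
    - (hcov ch m F p * lin (sud i) p + F p * lin (\<lambda>k. cov_ud a sud i k m) p) / 2 - hcov ch m C p * snd p $ i"
proof -
  have s: "hcov ch m (lin (sud i)) p = lin (\<lambda>k. cov_ud a sud i k m) p - (\<Sum>q\<in>UNIV. ch i m q (fst p) * lin (sud q) p)"
    unfolding lin_contract lin_diff[symmetric]
    by (simp add: hcov_lin ch_sym[OF base_in[OF p]]) (simp add: lin_def cov_ud_def ch_sym[OF base_in[OF p], of _ m])
  have "hcov ch m (Q i) p = hcov ch m A p * bu i (fst p) + A p * pd m (bu i) (fst p)
     - (hcov ch m F p * lin (sud i) p + F p * hcov ch m (lin (sud i)) p) / 2 - hcov ch m C p * snd p $ i
     + C p * (\<Sum>q\<in>UNIV. ch i m q (fst p) * snd p $ q)"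
    unfolding Q_def[abs_def]
    by (simp add: hcov_simps)
  then show ?thesis
    unfolding contract_Q[OF p] s div_bu[OF base_in[OF p]]
    by (simp add: ch_sym[OF base_in[OF p], of _ m] algebra_simps diff_divide_distrib add_divide_distrib)
qed

lemma E_eq: "(\<Sum>m\<in>UNIV. hcov ch m (Q m) p + (\<Sum>q\<in>UNIV. ch m m q (fst p) * Q q p))
  = (\<Sum>m\<in>UNIV. hcov ch m A p * bu m (fst p)) + A p * r_tr (fst p)
    - ((\<Sum>m\<in>UNIV. hcov ch m F p * lin (sud m) p) + F p * lin divs p) / 2 - (\<Sum>m\<in>UNIV. hcov ch m C p * snd p $ m)"
proof -
  have "(\<Sum>m\<in>UNIV. \<Sum>q\<in>UNIV. au m q (fst p) * (rdd q m (fst p) + sdd q m (fst p))) = r_tr (fst p) + (\<Sum>m\<in>UNIV. sud m m (fst p))"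
    by (simp add: r_tr_def r_ud_def s_ud_def distrib_left sum.distrib)
  moreover have "(\<Sum>m\<in>UNIV. lin (\<lambda>k. cov_ud a sud m k m) p) = lin divs p"
    unfolding lin_def divs_def sum_distrib_right by (rule sum.swap)
  ultimately show ?thesis
    unfolding hcov_Q by (simp add: trace_sud[OF base_in[OF p]] sum.distrib sum_subtractf sum_distrib_left[symmetric] sum_divide_distrib[symmetric])
qed

lemma hcov_F_contract: "(\<Sum>m\<in>UNIV. hcov ch m F p * v m)
  = - (F p * ((\<Sum>m\<in>UNIV. lin (rdd m) p * v m) - (\<Sum>m\<in>UNIV. lin (sdd m) p * v m)) / lin bd p)"
  unfolding hcov_F[OF p] sum_subtractf[symmetric] sum_distrib_left sum_divide_distrib sum_negf[symmetric]
  by (simp add: algebra_simps)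

lemma hcov_A_contract: "(\<Sum>m\<in>UNIV. hcov ch m A p * v m) = ((\<Sum>m\<in>UNIV. hcov ch m F p * v m) * lin sd p
    + F p * (\<Sum>m\<in>UNIV. lin (\<lambda>i. cov_d a sd i m) p * v m)
    + (\<Sum>m\<in>UNIV. quad (\<lambda>i j. cov_dd a rdd i j m) p * v m)) / (2 * b2 (fst p))
    - A p * (2 * ((\<Sum>m\<in>UNIV. rd m (fst p) * v m) + (\<Sum>m\<in>UNIV. sd m (fst p) * v m))) / b2 (fst p)"
  unfolding hcov_A sum_divide_distrib sum_distrib_left sum_distrib_right sum.distrib[symmetric] sum_subtractf[symmetric]
  by (simp add: algebra_simps add_divide_distrib)

lemma hcov_C_contract: "(\<Sum>m\<in>UNIV. hcov ch m C p * v m) = ((\<Sum>m\<in>UNIV. lin (\<lambda>i. cov_d a sd i m) p * v m)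
    + (\<Sum>m\<in>UNIV. quad (\<lambda>i j. cov_dd a rdd i j m) p * v m) / F p
    - quad rdd p * (\<Sum>m\<in>UNIV. hcov ch m F p * v m) / (F p)\<^sup>2) / b2 (fst p)
    - C p * (2 * ((\<Sum>m\<in>UNIV. rd m (fst p) * v m) + (\<Sum>m\<in>UNIV. sd m (fst p) * v m))) / b2 (fst p)"
  unfolding hcov_C sum_divide_distrib sum_distrib_left sum_distrib_right sum.distrib[symmetric] sum_subtractf[symmetric]
  by (simp add: algebra_simps add_divide_distrib diff_divide_distrib)

lemma cov_sd_bu: "(\<Sum>m\<in>UNIV. lin (\<lambda>i. cov_d a sd i m) p * bu m (fst p)) = lin sd_b p"
  unfolding lin_def sd_b_def sum_distrib_right by (subst sum.swap) (simp add: mult_ac)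

lemma cov_sd_y: "(\<Sum>m\<in>UNIV. lin (\<lambda>i. cov_d a sd i m) p * snd p $ m) = quad (cov_d a sd) p"
  unfolding lin_def quad_def sum_distrib_right by (subst sum.swap) (simp add: mult_ac)

lemma cov_rdd_bu: "(\<Sum>m\<in>UNIV. quad (\<lambda>i j. cov_dd a rdd i j m) p * bu m (fst p)) = quad rdd_b p"
proof -
  have "(\<Sum>m\<in>UNIV. quad (\<lambda>i j. cov_dd a rdd i j m) p * bu m (fst p))
    = (\<Sum>m\<in>UNIV. \<Sum>i\<in>UNIV. \<Sum>j\<in>UNIV. cov_dd a rdd i j m (fst p) * bu m (fst p) * snd p $ i * snd p $ j)"
    by (simp add: quad_def sum_distrib_right sum_distrib_left mult_ac)
  also have "\<dots> = (\<Sum>i\<in>UNIV. \<Sum>m\<in>UNIV. \<Sum>j\<in>UNIV. cov_dd a rdd i j m (fst p) * bu m (fst p) * snd p $ i * snd p $ j)"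
    by (rule sum.swap)
  also have "\<dots> = (\<Sum>i\<in>UNIV. \<Sum>j\<in>UNIV. \<Sum>m\<in>UNIV. cov_dd a rdd i j m (fst p) * bu m (fst p) * snd p $ i * snd p $ j)"
    by (rule sum.cong[OF refl]) (rule sum.swap)
  finally show ?thesis by (simp add: quad_def rdd_b_def sum_distrib_right)
qed

text \<open>\<open>Q1\<close> consists of three rank-one terms, a multiple of \<open>sud\<close> and
  a multiple of the identity. The trace of its square is thus found by applying \<open>Q1\<close> to
  the vectors of the rank-one terms and evaluating the matching covectors; the \<open>sud\<close>
  part and the identity part contribute traces.\<close>

lemma trace_Q1_Q1:
  defines "dA \<equiv> \<lambda>v. \<Sum>q\<in>UNIV. dy q A p * v q" and "dC \<equiv> \<lambda>v. \<Sum>q\<in>UNIV. dy q C p * v q"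
    and "dF \<equiv> \<lambda>v. \<Sum>q\<in>UNIV. dy q F p * v q"
    and "B \<equiv> \<lambda>q. bu q (fst p)" and "Y \<equiv> \<lambda>q. snd p $ q" and "S \<equiv> \<lambda>q. lin (sud q) p" and "V \<equiv> \<lambda>q. su q (fst p)"
    and "SS \<equiv> \<lambda>m. \<Sum>q\<in>UNIV. sud m q (fst p) * lin (sud q) p"
  shows "(\<Sum>m\<in>UNIV. \<Sum>q\<in>UNIV. cs.Q1 m q p * cs.Q1 q m p) =
    (dA B * dA B - (dF B * dA S - F p * dA V) / 2 - dC B * dA Y - C p * dA B)
    - ((dA S * dF B - (dF S * dF S + F p * dF SS) / 2 - dC S * dF Y - C p * dF S)
       + F p * (- dA V - (dF SS + F p * s_tr (fst p)) / 2 - dC S)) / 2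
    - (dA Y * dC B - (dF Y * dC S + F p * dC S) / 2 - dC Y * dC Y - C p * dC Y) - C p * cs.T p"
proof -
  note z = base_in[OF p]
  let ?q = "\<lambda>v m. \<Sum>q\<in>UNIV. cs.Q1 m q p * v q"
  have "(\<Sum>m\<in>UNIV. \<Sum>q\<in>UNIV. cs.Q1 m q p * cs.Q1 q m p) = (\<Sum>m\<in>UNIV. \<Sum>q\<in>UNIV. cs.Q1 q m p * cs.Q1 m q p)"
    by (simp add: mult.commute)
  also have "\<dots> = (\<Sum>m\<in>UNIV. dy m A p * ?q B m) - ((\<Sum>m\<in>UNIV. dy m F p * ?q S m)
       + F p * (\<Sum>m\<in>UNIV. ?q (\<lambda>q. sud q m (fst p)) m)) / 2 - (\<Sum>m\<in>UNIV. dy m C p * ?q Y m) - C p * cs.T p"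
    unfolding Q1_covector[OF p] cs.T_def B_def S_def Y_def
    by (simp add: sum.distrib sum_subtractf sum_distrib_left[symmetric] sum_divide_distrib[symmetric])
  also have "(\<Sum>m\<in>UNIV. dy m A p * ?q B m) = dA B * dA B - (dF B * dA S - F p * dA V) / 2 - dC B * dA Y - C p * dA B"
    unfolding Q1_vector[OF p] dA_def dC_def dF_def B_def S_def Y_def V_def sum_combination sud_bu[OF z]
    by (simp add: sum_negf)
  also have "(\<Sum>m\<in>UNIV. dy m F p * ?q S m) = dA S * dF B - (dF S * dF S + F p * dF SS) / 2 - dC S * dF Y - C p * dF S"
    unfolding Q1_vector[OF p] dA_def dC_def dF_def B_def S_def Y_def SS_def sum_combination ..
  also have "(\<Sum>m\<in>UNIV. dy m C p * ?q Y m) = dA Y * dC B - (dF Y * dC S + F p * dC S) / 2 - dC Y * dC Y - C p * dC Y"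
    unfolding Q1_vector[OF p] dA_def dC_def dF_def B_def S_def Y_def sum_combination sig_y ..
  also have "(\<Sum>m\<in>UNIV. ?q (\<lambda>q. sud q m (fst p)) m) = - dA V - (dF SS + F p * s_tr (fst p)) / 2 - dC S"
  proof -
    have "(\<Sum>m\<in>UNIV. ?q (\<lambda>q. sud q m (fst p)) m) = (\<Sum>m\<in>UNIV. (\<Sum>q\<in>UNIV. dy q A p * sud q m (fst p)) * B m)
       - ((\<Sum>m\<in>UNIV. (\<Sum>q\<in>UNIV. dy q F p * sud q m (fst p)) * S m) + F p * s_tr (fst p)) / 2
       - (\<Sum>m\<in>UNIV. (\<Sum>q\<in>UNIV. dy q C p * sud q m (fst p)) * Y m) - C p * (\<Sum>m\<in>UNIV. sud m m (fst p))"
      unfolding Q1_vector[OF p] B_def S_def Y_def s_tr_def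
      by (simp add: sum.distrib sum_subtractf sum_distrib_left[symmetric] sum_divide_distrib[symmetric])
    then show ?thesis
      unfolding sud_swap B_def S_def Y_def sud_bu[OF z] sig_y trace_sud[OF z] dA_def dC_def dF_def V_def SS_def
      by (simp add: sum_negf)
  qed
  finally show ?thesis .
qed

end

lemma W_eq:
  assumes p: "p \<in> dom"
  shows "cs.W p = W_formula p"
proof -
  note [simp] = dom_simps[OF p]
  \<comment> \<open>The scalar \<open>s_{q0} s^q_0\<close> has no place in \<open>W_formula\<close>.
    It enters through the horizontal derivative of \<open>F\<close> and through
    \<open>dF_sud_sig\<close>, and the two contributions cancel.\<close>
  let ?k = "\<Sum>q\<in>UNIV. lin (sdd q) p * lin (sud q) p"
  have C: "C p = (lin sd p + quad rdd p / F p) / b2 (fst p)" by (simp add: C_def)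
  have A: "A p = F p * C p / 2" by (simp add: C_eq[OF p])
  have dAy: "(\<Sum>q\<in>UNIV. dy q A p * snd p $ q) = F p * C p"
    unfolding A_contract[OF p] contractions[OF p] C by (simp add: field_simps)
  have dCy: "(\<Sum>q\<in>UNIV. dy q C p * snd p $ q) = C p"
    unfolding C_contract[OF p] contractions[OF p] C by (simp add: field_simps power2_eq_square)
  have dAsu: "(\<Sum>q\<in>UNIV. dy q A p * su q (fst p)) = (2 * lin sd p / lin bd p * lin sd p + F p * s_sq (fst p) + 2 * lin rdd_su p) / (2 * b2 (fst p))"
    unfolding A_contract[OF p] contractions[OF p] ..
  have dAb: "(\<Sum>q\<in>UNIV. dy q A p * bu q (fst p)) = ((2 - F p * b2 (fst p) / lin bd p) * lin sd p + 2 * lin rd p) / (2 * b2 (fst p))"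
    unfolding A_contract[OF p] contractions[OF p] by simp
  have dAs: "(\<Sum>q\<in>UNIV. dy q A p * lin (sud q) p) = (- (F p * lin sd p / lin bd p) * lin sd p + F p * lin s_sud p + 2 * quad rdd_sud p) / (2 * b2 (fst p))"
    unfolding A_contract[OF p] contractions[OF p] ..
  have dCb: "(\<Sum>q\<in>UNIV. dy q C p * bu q (fst p)) = (2 * lin rd p / F p - quad rdd p * (2 - F p * b2 (fst p) / lin bd p) / (F p)\<^sup>2) / b2 (fst p)"
    unfolding C_contract[OF p] contractions[OF p] by simp
  have dCs: "(\<Sum>q\<in>UNIV. dy q C p * lin (sud q) p) = (lin s_sud p + 2 * quad rdd_sud p / F p - quad rdd p * - (F p * lin sd p / lin bd p) / (F p)\<^sup>2) / b2 (fst p)"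
    unfolding C_contract[OF p] contractions[OF p] ..
  have hFb: "(\<Sum>m\<in>UNIV. hcov ch m F p * bu m (fst p)) = - (F p * (lin rd p - lin sd p) / lin bd p)"
    unfolding hcov_F_contract[OF p] contractions[OF p] sl_bu[OF p] ..
  have hFs: "(\<Sum>m\<in>UNIV. hcov ch m F p * lin (sud m) p) = - (F p * (quad rdd_sud p - ?k) / lin bd p)"
    unfolding hcov_F_contract[OF p] contractions[OF p] ..
  have hFy: "(\<Sum>m\<in>UNIV. hcov ch m F p * snd p $ m) = - (F p * quad rdd p / lin bd p)"
    unfolding hcov_F_contract[OF p] contractions[OF p] sl_y[OF p] by simp
  have E: "(\<Sum>m\<in>UNIV. hcov ch m (Q m) p + (\<Sum>q\<in>UNIV. ch m m q (fst p) * Q q p))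
    = (- (F p * (lin rd p - lin sd p) / lin bd p) * lin sd p + F p * lin sd_b p + quad rdd_b p) / (2 * b2 (fst p))
      - A p * (2 * rs (fst p)) / b2 (fst p) + A p * r_tr (fst p)
      - (- (F p * (quad rdd_sud p - ?k) / lin bd p) + F p * lin divs p) / 2
      - ((quad (cov_d a sd) p + r000 p / F p - quad rdd p * - (F p * quad rdd p / lin bd p) / (F p)\<^sup>2) / b2 (fst p)
         - C p * (2 * (lin rd p + lin sd p)) / b2 (fst p))"
    unfolding E_eq[OF p] hcov_A_contract[OF p] hcov_C_contract[OF p] hFb hFs hFy contractions[OF p]
      cov_sd_bu[OF p] cov_sd_y[OF p] cov_rdd_bu[OF p] r000_def[symmetric] by simp
  show ?thesis
    unfolding cs.W_def E trace_Q1_Q1[OF p] dAy dCy dAsu dAb dAs dCb dCs dF_sud_sig[OF p] contractions[OF p] T_eq[OF p]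
      W_formula_def
    by (rule W_algebra[where be = "lin bd p" and n = "real CARD('n)" and k = ?k,
          OF dom_simps(2,3,1)[OF p] C A refl refl refl refl refl refl refl refl refl refl refl])
qed

subsection \<open>Second derivatives\<close>

lemma smooth_rud: "smooth_on U (rud i j)"
  unfolding r_ud_def[abs_def] by (intro smooth_base smooth_rdd)

lemma smooth_su: "smooth_on U (su i)"
  unfolding s_u_def[abs_def] by (intro smooth_base smooth_sd)

lemma smooth_cov_sd: "smooth_on U (cov_d a sd i l)"
  unfolding cov_d_def[abs_def] by (intro smooth_base smooth_sd)

lemma smooth_cov_rd: "smooth_on U (cov_d a rd i l)"
  unfolding cov_d_def[abs_def] by (intro smooth_base smooth_rd)

lemma smooth_cov_rdd: "smooth_on U (cov_dd a rdd i j l)"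
  unfolding cov_dd_def[abs_def] by (intro smooth_base smooth_rdd)

lemma smooth_cov_sud: "smooth_on U (cov_ud a sud i j l)"
  unfolding cov_ud_def[abs_def] by (intro smooth_base smooth_sud)

lemma smooth_r_sud: "smooth_on U (r_sud k)"
  unfolding r_sud_def[abs_def] by (intro smooth_base smooth_rd smooth_sud)

lemma smooth_rdd_su: "smooth_on U (rdd_su k)"
  unfolding rdd_su_def[abs_def] by (intro smooth_base smooth_rdd smooth_su)

lemma smooth_rdd_sud: "smooth_on U (rdd_sud i j)"
  unfolding rdd_sud_def[abs_def] by (intro smooth_base smooth_rdd smooth_sud)

lemma smooth_divs: "smooth_on U (divs l)"
  unfolding divs_def[abs_def] by (intro smooth_base smooth_cov_sud)

lemma smooth_sd_b: "smooth_on U (sd_b i)"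
  unfolding sd_b_def[abs_def] by (intro smooth_base smooth_cov_sd smooth_bu)

lemma smooth_rdd_b: "smooth_on U (rdd_b i j)"
  unfolding rdd_b_def[abs_def] by (intro smooth_base smooth_cov_rdd smooth_bu)

lemma smooth_constants: "smooth_on U s_sq" "smooth_on U s_tr" "smooth_on U r_tr" "smooth_on U rs"
  unfolding s_sq_def[abs_def] s_tr_def[abs_def] r_tr_def[abs_def] r_scalar_def[abs_def]
  by (intro smooth_base smooth_sd smooth_su smooth_sud smooth_rud smooth_rd smooth_bu)+

lemma cov_dd_sym: "cov_dd a rdd i j l z = cov_dd a rdd j i l z"
proof -
  have "rdd i j = rdd j i" by (rule ext) (rule rdd_sym)
  then have "pd l (rdd i j) z = pd l (rdd j i) z" by (rule arg_cong)
  moreover have "(\<Sum>m\<in>UNIV. ch m i l z * rdd m j z) = (\<Sum>m\<in>UNIV. ch m i l z * rdd j m z)" for i j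
    by (subst rdd_sym) (rule refl)
  ultimately show ?thesis unfolding cov_dd_def by simp
qed

lemma rdd_b_sym: "rdd_b i j z = rdd_b j i z"
  unfolding rdd_b_def by (subst cov_dd_sym) (rule refl)

definition W1 :: "'n \<Rightarrow> (real^'n) \<times> (real^'n) \<Rightarrow> real" where
  "W1 l p = (dy l F p * lin sd_b p + F p * sd_b l (fst p) + 2 * lin (rdd_b l) p) / (2 * b2 (fst p))
    - (dy l F p * lin divs p + F p * divs l (fst p)) / 2
    + (dy l F p * lin sd p + F p * sd l (fst p) + 2 * lin (rdd l) p) * (r_tr (fst p) / (2 * b2 (fst p)) - rs (fst p) / (b2 (fst p))\<^sup>2)
    - (lin (cov_d a sd l) p + lin (\<lambda>i. cov_d a sd i l) p
       + ((quad (\<lambda>i j. cov_dd a rdd i j l) p + 2 * quad (cov_dd a rdd l) p) / F p - r000 p / F p * dy l F p / F p)) / b2 (fst p)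
    - 2 * (F p * dy l F p) * (s_tr (fst p) / 8 + s_sq (fst p) / (4 * b2 (fst p)))
    - (lin sd p + lin rd p) * (sd l (fst p) + rd l (fst p)) / (b2 (fst p))\<^sup>2
    - (dy l F p * (lin rdd_su p + lin s_sud p) + F p * (rdd_su l (fst p) + s_sud l (fst p))) / (2 * b2 (fst p))
    - (lin (rdd_sud l) p + lin (\<lambda>i. rdd_sud i l) p) / b2 (fst p)
    - (real CARD('n) + 7) * (C p * dy l C p)
    + 5 * (dy l C p * (lin sd p + lin rd p) + C p * (sd l (fst p) + rd l (fst p))) / b2 (fst p)"

text \<open>\<open>D0\<close> and \<open>D1\<close> are \<open>dcov\<close> of \<open>s\<^sub>0\<close> and \<open>r\<^sub>0\<close>; \<open>D2\<close> is \<open>dcov\<close> of \<open>r\<^sub>0\<^sub>0\<close> divided by \<open>F\<close>. Together with \<open>W1\<close> they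
  are arranged so that no product of \<open>F\<close> and \<open>1/F\<close> appears on differentiation.\<close>

definition D0 :: "'n \<Rightarrow> (real^'n) \<times> (real^'n) \<Rightarrow> real" where
  "D0 l p = lin (\<lambda>i. cov_d a sd i l) p + (dy l F p * lin s_sud p + F p * s_sud l (fst p)) / 2
    + dy l C p * lin sd p + C p * sd l (fst p)"

definition D1 :: "'n \<Rightarrow> (real^'n) \<times> (real^'n) \<Rightarrow> real" where
  "D1 l p = lin (\<lambda>i. cov_d a rd i l) p
    - (dy l F p * lin sd p + F p * sd l (fst p) + 2 * lin (rdd l) p) * (rs (fst p) / (2 * b2 (fst p)))
    + (dy l F p * lin r_sud p + F p * r_sud l (fst p)) / 2 + dy l C p * lin rd p + C p * rd l (fst p)"

definition D2 :: "'n \<Rightarrow> (real^'n) \<times> (real^'n) \<Rightarrow> real" where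
  "D2 l p = quad (\<lambda>i j. cov_dd a rdd i j l) p / F p
    - (dy l F p * lin sd p / F p + sd l (fst p) + 2 * lin (rdd l) p / F p) * lin rd p / b2 (fst p)
    + dy l F p * quad rdd_sud p / F p + lin (\<lambda>i. rdd_sud i l) p
    + 2 * (dy l C p * quad rdd p / F p) + 2 * (C p * lin (rdd l) p / F p)"

definition DT :: "'n \<Rightarrow> (real^'n) \<times> (real^'n) \<Rightarrow> real" where
  "DT l p = (D0 l p + D1 l p) / b2 (fst p) - (lin sd p + lin rd p) * (2 * (rd l (fst p) + sd l (fst p))) / (b2 (fst p))\<^sup>2
    - (real CARD('n) + 1) * ((D0 l p + D2 l p) / b2 (fst p) - C p * (2 * (rd l (fst p) + sd l (fst p))) / b2 (fst p))"

context
  fixes p assumes p: "p \<in> dom"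
begin

declare tensor_differentiable[OF p, simp] dom_simps[OF p, simp]

lemma derived_tensor_differentiable [simp]:
  "cov_d a sd i l differentiable at (fst p)" "cov_d a rd i l differentiable at (fst p)"
  "cov_dd a rdd i j l differentiable at (fst p)"
  "s_sud k differentiable at (fst p)" "r_sud k differentiable at (fst p)" "rdd_su k differentiable at (fst p)"
  "rdd_sud i j differentiable at (fst p)" "divs k differentiable at (fst p)" "sd_b k differentiable at (fst p)"
  "rdd_b i j differentiable at (fst p)"
  "s_sq differentiable at (fst p)" "s_tr differentiable at (fst p)" "r_tr differentiable at (fst p)" "rs differentiable at (fst p)"
  by (rule smooth_on_differentiable[OF _ base_in[OF p]], rule smooth_cov_sd smooth_cov_rd smooth_cov_rdd smooth_s_sud smooth_r_sud
      smooth_rdd_su smooth_rdd_sud smooth_divs smooth_sd_b smooth_rdd_b smooth_constants)+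

lemma diff_r000 [simp]: "r000 differentiable at p"
  unfolding r000_def[abs_def] by simp

text \<open>The tensor \<open>r_{ij|k}\<close> is symmetric in its first two indices only, hence
  \<open>r_{00|l}\<close> once and \<open>r_{l0|0}\<close> twice.\<close>

lemma dy_r000: "dy l r000 p = quad (\<lambda>i j. cov_dd a rdd i j l) p + 2 * quad (cov_dd a rdd l) p"
proof -
  have e: "dy l (quad (\<lambda>i j. cov_dd a rdd i j m)) p = 2 * lin (\<lambda>j. cov_dd a rdd l j m) p" for m
    using lin_cong[of "\<lambda>i. cov_dd a rdd i l m" p "\<lambda>j. cov_dd a rdd l j m", OF cov_dd_sym] by (simp add: dy_quad)
  have "(\<Sum>m\<in>UNIV. lin (\<lambda>j. cov_dd a rdd l j m) p * snd p $ m) = quad (cov_dd a rdd l) p"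
    unfolding lin_def quad_def sum_distrib_right by (subst sum.swap) (simp add: mult_ac)
  then show ?thesis unfolding r000_def[abs_def]
    by (simp add: dy_sum dy_mult dy_snd_nth e sum.distrib sum_distrib_left[symmetric] mult.assoc)
qed

lemma dy_cov_quad: "dy k (quad (\<lambda>i j. cov_dd a rdd i j l)) p = 2 * lin (\<lambda>j. cov_dd a rdd k j l) p"
  using lin_cong[of "\<lambda>i. cov_dd a rdd i k l" p "\<lambda>j. cov_dd a rdd k j l", OF cov_dd_sym] by (simp add: dy_quad)

lemma dy_quad_rdd_b: "dy k (quad rdd_b) p = 2 * lin (rdd_b k) p"
  using lin_cong[of "\<lambda>i. rdd_b i k" p "rdd_b k", OF rdd_b_sym] by (simp add: dy_quad)

lemmas dy_atoms = dy_simps dy_r000 dy_cov_quad dy_quad_rdd_b dy_quad_rdd[OF p] dy_quad dy_lin dy_fst_comp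

lemma dy_W_formula: "dy l W_formula p = W1 l p"
  unfolding W_formula_def[abs_def] W1_def power2_eq_square
  by (simp add: dy_atoms) (simp add: algebra_simps add_divide_distrib diff_divide_distrib power2_eq_square)

lemma dcov_T_eq: "cs.dcov l cs.T p = DT l p"
proof -
  \<comment> \<open>The factor \<open>F\<close> inside the derivative of \<open>A\<close> is
    cancelled before dividing, which gives \<open>D2\<close> its shape.\<close>
  have A: "2 * dy l A p * lin rd p / F p = (dy l F p * lin sd p / F p + sd l (fst p) + 2 * lin (rdd l) p / F p) * lin rd p / b2 (fst p)"
    unfolding dy_A[OF p] by (simp add: field_simps)
  have "cs.dcov l (quad rdd) p / F p = quad (\<lambda>i j. cov_dd a rdd i j l) p / F p - 2 * dy l A p * lin rd p / F p
     + (dy l F p * quad rdd_sud p / F p + lin (\<lambda>i. rdd_sud i l) p) + 2 * (dy l C p * quad rdd p / F p) + 2 * (C p * lin (rdd l) p / F p)"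
    unfolding dcov_rdd[OF p] by (simp add: field_simps)
  then have "cs.dcov l (quad rdd) p / F p = D2 l p"
    unfolding A D2_def by simp
  moreover have "cs.dcov l (lin rd) p = D1 l p"
    unfolding dcov_rd[OF p] D1_def dy_A[OF p] by simp
  moreover have "cs.dcov l (lin sd) p = D0 l p"
    unfolding dcov_sd[OF p] D0_def ..
  ultimately show ?thesis unfolding dcov_T[OF p] dcov_C[OF p] DT_def by simp
qed

lemma dy_dy_C: "dy k (dy l C) p = (2 * rdd l k (fst p) / F p - 2 * lin (rdd l) p * dy k F p / (F p * F p)
    - 2 * lin (rdd k) p * dy l F p / (F p * F p) - quad rdd p * dy k (dy l F) p / (F p * F p)
    + 2 * quad rdd p * dy l F p * dy k F p / (F p * F p * F p)) / b2 (fst p)"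
proof -
  have "dy k (dy l C) p = dy k (\<lambda>p. (sd l (fst p) + 2 * lin (rdd l) p / F p - quad rdd p * dy l F p / (F p * F p)) / b2 (fst p)) p"
    by (rule dy_cong[OF open_dom p]) (simp add: dy_C power2_eq_square)
  also have "\<dots> = (2 * rdd l k (fst p) / F p - 2 * lin (rdd l) p * dy k F p / (F p * F p)
    - 2 * lin (rdd k) p * dy l F p / (F p * F p) - quad rdd p * dy k (dy l F) p / (F p * F p)
    + 2 * quad rdd p * dy l F p * dy k F p / (F p * F p * F p)) / b2 (fst p)"
    by (simp add: dy_atoms) (simp add: algebra_simps add_divide_distrib diff_divide_distrib power2_eq_square)
  finally show ?thesis .
qed

end

context
  fixes p and k l :: 'n and q j :: real assumes p: "p \<in> dom" and q: "q = inverse (F p)" and j: "j = inverse (b2 (fst p))"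
begin

declare tensor_differentiable[OF p, simp] dom_simps[OF p, simp] derived_tensor_differentiable[OF p, simp] diff_r000[OF p, simp]

text \<open>Rules that merge nested quotients are switched off so that the quotients keep the shape
  left by differentiation. They can then be rewritten as monomials in \<open>q\<close> and
  \<open>j\<close>, the form in which \<open>Ric_algebra\<close> expects its data.\<close>

lemma dy_W1: "dy k (W1 l) p = (dy k (dy l F) p * lin sd_b p + dy l F p * sd_b k (fst p) + dy k F p * sd_b l (fst p)
      + 2 * rdd_b l k (fst p)) * j / 2
    - (dy k (dy l F) p * lin divs p + dy l F p * divs k (fst p) + dy k F p * divs l (fst p)) / 2
    + (dy k (dy l F) p * lin sd p + dy l F p * sd k (fst p) + dy k F p * sd l (fst p) + 2 * rdd l k (fst p))
       * (r_tr (fst p) * j / 2 - rs (fst p) * j * j)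
    - (cov_d a sd k l (fst p) + cov_d a sd l k (fst p)
       + (2 * lin (\<lambda>j. cov_dd a rdd k j l) p + 2 * (lin (cov_dd a rdd l k) p + lin (\<lambda>i. cov_dd a rdd l i k) p)) * q
       - (quad (\<lambda>i j. cov_dd a rdd i j l) p + 2 * quad (cov_dd a rdd l) p) * dy k F p * q * q
       - (quad (\<lambda>i j. cov_dd a rdd i j k) p + 2 * quad (cov_dd a rdd k) p) * dy l F p * q * q
       - r000 p * dy k (dy l F) p * q * q + 2 * r000 p * dy k F p * dy l F p * q * q * q) * j
    - 2 * (dy k F p * dy l F p + F p * dy k (dy l F) p) * (s_tr (fst p) / 8 + s_sq (fst p) * j / 4)
    - (sd k (fst p) + rd k (fst p)) * (sd l (fst p) + rd l (fst p)) * j * j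
    - (dy k (dy l F) p * (lin rdd_su p + lin s_sud p) + dy l F p * (rdd_su k (fst p) + s_sud k (fst p))
       + dy k F p * (rdd_su l (fst p) + s_sud l (fst p))) * j / 2
    - (rdd_sud k l (fst p) + rdd_sud l k (fst p)) * j
    - (real CARD('n) + 7) * (dy k C p * dy l C p + C p * dy k (dy l C) p)
    + 5 * (dy k (dy l C) p * (lin sd p + lin rd p) + dy l C p * (sd k (fst p) + rd k (fst p))
       + dy k C p * (sd l (fst p) + rd l (fst p))) * j"
  unfolding W1_def[abs_def] power2_eq_square
  by (simp add: dy_atoms[OF p]
        del: times_divide_eq_left times_divide_eq_right divide_divide_eq_left divide_divide_eq_right times_divide_times_eq,
      simp only: divide_inverse inverse_mult_distrib power_inverse[symmetric] power2_eq_square q[symmetric] j[symmetric],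
      simp add: algebra_simps)

lemma dy_D0: "dy k (D0 l) p = cov_d a sd k l (fst p)
    + (dy k (dy l F) p * lin s_sud p + dy l F p * s_sud k (fst p) + dy k F p * s_sud l (fst p)) / 2
    + dy k (dy l C) p * lin sd p + dy l C p * sd k (fst p) + dy k C p * sd l (fst p)"
  unfolding D0_def[abs_def]
  by (simp add: dy_atoms[OF p])

lemma dy_D1: "dy k (D1 l) p = cov_d a rd k l (fst p)
    - (dy k (dy l F) p * lin sd p + dy l F p * sd k (fst p) + dy k F p * sd l (fst p) + 2 * rdd l k (fst p)) * (rs (fst p) * j / 2)
    + (dy k (dy l F) p * lin r_sud p + dy l F p * r_sud k (fst p) + dy k F p * r_sud l (fst p)) / 2
    + dy k (dy l C) p * lin rd p + dy l C p * rd k (fst p) + dy k C p * rd l (fst p)"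
  unfolding D1_def[abs_def]
  by (simp add: dy_atoms[OF p]
        del: times_divide_eq_left times_divide_eq_right divide_divide_eq_left divide_divide_eq_right times_divide_times_eq,
      simp only: divide_inverse inverse_mult_distrib power_inverse[symmetric] power2_eq_square q[symmetric] j[symmetric],
      simp add: algebra_simps)

lemma dy_D2: "dy k (D2 l) p = 2 * lin (\<lambda>j. cov_dd a rdd k j l) p * q
    - quad (\<lambda>i j. cov_dd a rdd i j l) p * dy k F p * q * q
    - ((dy k (dy l F) p * q - dy k F p * dy l F p * q * q) * lin sd p + dy l F p * q * sd k (fst p)
       + 2 * rdd l k (fst p) * q - 2 * lin (rdd l) p * dy k F p * q * q) * lin rd p * j
    - (dy l F p * q * lin sd p + sd l (fst p) + 2 * lin (rdd l) p * q) * rd k (fst p) * j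
    + (dy k (dy l F) p * q - dy k F p * dy l F p * q * q) * quad rdd_sud p
    + dy l F p * q * (lin (rdd_sud k) p + lin (\<lambda>i. rdd_sud i k) p) + rdd_sud k l (fst p)
    + 2 * dy k (dy l C) p * quad rdd p * q
    + 2 * dy l C p * (2 * lin (rdd k) p * q - quad rdd p * dy k F p * q * q)
    + 2 * dy k C p * lin (rdd l) p * q + 2 * C p * (rdd l k (fst p) * q - lin (rdd l) p * dy k F p * q * q)"
  unfolding D2_def[abs_def]
  by (simp add: dy_atoms[OF p]
        del: times_divide_eq_left times_divide_eq_right divide_divide_eq_left divide_divide_eq_right times_divide_times_eq,
      simp only: divide_inverse inverse_mult_distrib power_inverse[symmetric] power2_eq_square q[symmetric] j[symmetric],
      simp add: algebra_simps)

lemma diff_D [simp]: "D0 l differentiable at p" "D1 l differentiable at p" "D2 l differentiable at p"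
  unfolding D0_def[abs_def] D1_def[abs_def] D2_def[abs_def] by simp_all

lemma dy_DT: "dy k (DT l) p = (dy k (D0 l) p + dy k (D1 l) p) * j
    - (sd k (fst p) + rd k (fst p)) * (2 * (rd l (fst p) + sd l (fst p))) * j * j
    - (real CARD('n) + 1) * ((dy k (D0 l) p + dy k (D2 l) p) * j - dy k C p * (2 * (rd l (fst p) + sd l (fst p))) * j)"
  unfolding DT_def[abs_def] power2_eq_square
  by (simp add: dy_atoms[OF p]
        del: times_divide_eq_left times_divide_eq_right divide_divide_eq_left divide_divide_eq_right times_divide_times_eq,
      simp only: divide_inverse inverse_mult_distrib power_inverse[symmetric] power2_eq_square q[symmetric] j[symmetric])

end

end

section \<open>The Ricci curvature tensor\<close>

theorem proposition3p1:
  fixes M :: "'m topology" and \<A> :: "('m, 'n::finite) chart set"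
    and a :: "('m, 'n) chart \<Rightarrow> 'n metric_field" and b :: "('m, 'n) chart \<Rightarrow> 'n covector_field"
    and c :: "('m, 'n) chart" and x y :: "real^'n" and k l :: 'n
    and n F Fk Fkl b2 b4 bu rdd rud sud rd sd su r r00 rd0 r0d r0 s0 sud0
      rdd_d rdd_0 rd0_d rd0_0 r00_d r00_0 rd_d sd_d s0_d divs divs0
  assumes "smooth_manifold M \<A>"
    and "riemannian_metric \<A> a"
    and "one_form \<A> b" and "nowhere_vanishing \<A> b"
    and "c \<in> \<A>" and "x \<in> chart_image c" and "beta (b c) x y > 0"
    \<comment> \<open>Abbreviations for the quantities at \<open>(x, y)\<close> in the chart \<open>c\<close>; \<open>0\<close> marks contraction with \<open>y\<close>,
      and what follows the last underscore comes after the bar of covariant differentiation.\<close>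
    and "n = real CARD('n)"
    and "F = kropina (a c) (b c) x y"
    and "Fk = (\<lambda>k. pd k (\<lambda>w. kropina (a c) (b c) x w) y)"
    and "Fkl = (\<lambda>k l. pd l (\<lambda>v. pd k (\<lambda>w. kropina (a c) (b c) x w) v) y)"
    and "b2 = b_norm2 (a c) (b c) x" and "b4 = b2\<^sup>2"
    and "bu = (\<lambda>i. b_u (a c) (b c) i x)"
    and "rdd = (\<lambda>i j. r_dd (a c) (b c) i j x)"
    and "rud = (\<lambda>i j. r_ud (a c) (b c) i j x)"
    and "sud = (\<lambda>i j. s_ud (a c) (b c) i j x)"
    and "rd = (\<lambda>i. r_d (a c) (b c) i x)"
    and "sd = (\<lambda>i. s_d (a c) (b c) i x)"
    and "su = (\<lambda>i. s_u (a c) (b c) i x)"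
    and "r = r_scalar (a c) (b c) x"
    and "rd0 = (\<lambda>k. \<Sum>j\<in>UNIV. rdd k j * y $ j)"
    and "r0d = (\<lambda>k. \<Sum>j\<in>UNIV. rdd j k * y $ j)"
    and "r00 = (\<Sum>i\<in>UNIV. \<Sum>j\<in>UNIV. rdd i j * y $ i * y $ j)"
    and "r0 = (\<Sum>i\<in>UNIV. rd i * y $ i)"
    and "s0 = (\<Sum>i\<in>UNIV. sd i * y $ i)"
    and "sud0 = (\<lambda>i. \<Sum>k\<in>UNIV. sud i k * y $ k)"
    and "rdd_d = (\<lambda>i j k. cov_dd (a c) (r_dd (a c) (b c)) i j k x)"
    and "rdd_0 = (\<lambda>k l. \<Sum>m\<in>UNIV. rdd_d k l m * y $ m)"
    and "rd0_d = (\<lambda>k l. \<Sum>j\<in>UNIV. rdd_d k j l * y $ j)"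
    and "rd0_0 = (\<lambda>l. \<Sum>j\<in>UNIV. \<Sum>k\<in>UNIV. rdd_d l j k * y $ j * y $ k)"
    and "r00_d = (\<lambda>l. \<Sum>i\<in>UNIV. \<Sum>j\<in>UNIV. rdd_d i j l * y $ i * y $ j)"
    and "r00_0 = (\<Sum>i\<in>UNIV. \<Sum>j\<in>UNIV. \<Sum>k\<in>UNIV. rdd_d i j k * y $ i * y $ j * y $ k)"
    and "rd_d = (\<lambda>k l. cov_d (a c) (r_d (a c) (b c)) k l x)"
    and "sd_d = (\<lambda>k l. cov_d (a c) (s_d (a c) (b c)) k l x)"
    and "s0_d = (\<lambda>m. \<Sum>j\<in>UNIV. sd_d j m * y $ j)"
    and "divs = (\<lambda>l. \<Sum>m\<in>UNIV. cov_ud (a c) (s_ud (a c) (b c)) m l m x)"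
    and "divs0 = (\<Sum>j\<in>UNIV. divs j * y $ j)"
  shows "Ric (kropina (a c) (b c)) k l x y =
    Ric_riem (a c) k l x
    + Fkl k l * (
        - ((n - 5) / (b4 * F^3)) * r00\<^sup>2
        + 2 / (b4 * F\<^sup>2) * r00 * (s0 - 2 * r0)
        + 1 / (b2 * F\<^sup>2) * r00_0
        + (n - 1) / (2 * b2) * (\<Sum>m\<in>UNIV. sd m * sud0 m)
        + (b2 * (\<Sum>m\<in>UNIV. rud m m) - r) * s0 / (2 * b4)
        + (n + 1) / (b2 * F) * (\<Sum>m\<in>UNIV. r0d m * sud0 m)
        + 1 / (2 * b2) * ((\<Sum>m\<in>UNIV. s0_d m * bu m) - (\<Sum>m\<in>UNIV. rd m * sud0 m)
            - (\<Sum>m\<in>UNIV. r0d m * su m))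
        - 1/2 * (divs0 + F / b2 * (\<Sum>m\<in>UNIV. sd m * su m)
            + F / 2 * (\<Sum>t\<in>UNIV. \<Sum>m\<in>UNIV. sud t m * sud m t))
        - (n + 1) / (b4 * F) * s0 * r0)
    + Fk l * Fk k * (
        3 * (n - 5) / (b4 * F^4) * r00\<^sup>2
        + 4 / (b4 * F^3) * r00 * (2 * r0 - s0)
        - 2 / (b2 * F^3) * r00_0
        + (n + 1) / (b4 * F\<^sup>2) * s0 * r0
        - (n + 1) / (b2 * F\<^sup>2) * (\<Sum>m\<in>UNIV. r0d m * sud0 m)
        - 1 / (2 * b2) * (\<Sum>m\<in>UNIV. su m * sd m)
        - 1/4 * (\<Sum>t\<in>UNIV. \<Sum>m\<in>UNIV. sud t m * sud m t))
    + Fk k * (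
        - (6 * (n - 3) / (b4 * F^3)) * r00 * rd0 l
        + (n - 7) / (b4 * F\<^sup>2) * r0d l * r0
        - (n - 3) / (b4 * F\<^sup>2) * r0d l * s0
        + (n - 3) / (b4 * F\<^sup>2) * r00 * rd l
        + 2 / (b4 * F\<^sup>2) * r00 * sd l
        + 2 / (b2 * F\<^sup>2) * rd0_0 l
        - (n - 1) / (2 * b2 * F\<^sup>2) * r00_d l
        + (n - 1) / (2 * b2) * (\<Sum>m\<in>UNIV. sd m * sud m l)
        + (b2 * (\<Sum>m\<in>UNIV. rud m m) - r) / (2 * b4) * sd l
        - (\<Sum>m\<in>UNIV. rd m * sud m l) / (2 * b2)
        - (\<Sum>m\<in>UNIV. rud m l * sd m) / (2 * b2)
        - divs l / 2
        + (\<Sum>m\<in>UNIV. sd_d l m * bu m) / (2 * b2)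
        - (n + 1) / (2 * b4 * F) * (sd l * r0 + s0 * rd l)
        + (n + 1) / (2 * b2 * F) * ((\<Sum>m\<in>UNIV. rdd l m * sud0 m) + (\<Sum>m\<in>UNIV. r0d m * sud m l)))
    + Fk l * (
        - (6 * (n - 3) / (b4 * F^3)) * r00 * rd0 k
        + (n - 7) / (b4 * F\<^sup>2) * rd0 k * r0
        - (n - 3) / (b4 * F\<^sup>2) * rd0 k * s0
        + (n - 3) / (b4 * F\<^sup>2) * r00 * rd k
        + 2 / (b4 * F\<^sup>2) * r00 * sd k
        + 2 / (b2 * F\<^sup>2) * rd0_0 k
        - (n - 1) / (2 * b2 * F\<^sup>2) * r00_d k
        + (n - 1) / (2 * b2) * (\<Sum>m\<in>UNIV. sd m * sud m k)
        + (b2 * (\<Sum>m\<in>UNIV. rud m m) - r) / (2 * b4) * sd k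
        - (\<Sum>m\<in>UNIV. rd m * sud m k) / (2 * b2)
        - (\<Sum>m\<in>UNIV. rdd k m * su m) / (2 * b2)
        - divs k / 2
        + (\<Sum>m\<in>UNIV. sd_d k m * bu m) / (2 * b2)
        - (n + 1) / (2 * b4 * F) * (sd k * r0 + s0 * rd k)
        + (n + 1) / (2 * b2 * F) * ((\<Sum>m\<in>UNIV. rdd k m * sud0 m) + (\<Sum>m\<in>UNIV. r0d m * sud m k)))
    + 8 * (n - 2) / (b4 * F\<^sup>2) * rd0 k * rd0 l
    + 4 * (n - 2) / (b4 * F\<^sup>2) * r00 * rdd k l
    + 2 * (n - 1) / (b4 * F) * rdd k l * s0
    - 2 * (n - 3) / (b4 * F) * rdd k l * r0
    - (3 * n - 5) / (b4 * F) * (rd0 l * rd k + rd0 k * rd l)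
    + (n - 3) / (b4 * F) * (rd0 k * sd l + rd0 l * sd k)
    - (3 * n - 7) / (2 * b4) * (rd k * sd l + rd l * sd k)
    - (n - 2) / b4 * sd k * sd l
    + rd k * rd l / b4
    - 2 * rdd_0 k l / (b2 * F)
    + (n - 1) / (b2 * F) * (rd0_d k l + rd0_d l k)
    + (n - 2) / (2 * b2) * (sd_d k l + sd_d l k)
    + (b2 * (\<Sum>m\<in>UNIV. rud m m) - r) / b4 * rdd k l
    + (\<Sum>m\<in>UNIV. bu m * rdd_d k l m) / b2
    - 1 / (2 * b2) * (rd_d k l + rd_d l k)
    + (n - 1) / (2 * b2) * ((\<Sum>m\<in>UNIV. rdd k m * sud m l) + (\<Sum>m\<in>UNIV. rdd l m * sud m k))"
proof -
  interpret K: kropina_chart "chart_image c" "a c" "b c"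
    using assms(1-5)
    by unfold_locales (auto simp: smooth_manifold_def riemannian_metric_def one_form_def nowhere_vanishing_def)
  let ?p = "(x, y)"
  have p: "?p \<in> K.dom"
    using assms(6,7) by (simp add: K.dom_def lin_def beta_def b_d_def)
  note z = K.base_in[OF p, simplified] and nz = K.dom_simps(1,2)[OF p, simplified]
  \<comment> \<open>\<open>Ric_algebra\<close> uses one variable for each of \<open>Fkl\<close>,
    \<open>Ckl\<close> and \<open>rkl\<close>, so both index orders have to be reduced to
    one.\<close>
  have Fsym: "dy l (dy k K.F) ?p = dy k (dy l K.F) ?p"
    by (rule dy_dy[OF K.open_dom K.smooth_F p])
  have Csym: "dy l (dy k K.C) ?p = dy k (dy l K.C) ?p"
    by (rule dy_dy[OF K.open_dom K.smooth_C p])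
  have rsym: "K.rdd k l x = K.rdd l k x"
    by (rule K.rdd_sym)
  have Ric: "Ric (kropina (a c) (b c)) k l x y = Ric_riem (a c) k l x
      + (dy k (K.W1 l) ?p - 1/2 * (dy k (K.DT l) ?p + dy l (K.DT k) ?p))"
  proof -
    have ric: "K.cs.ric k l x = Ric_riem (a c) k l x" for k l
      by (simp add: K.cs.ric_def Ric_riem_def)
    have dW: "dy l K.cs.W q = K.W1 l q" if "q \<in> K.dom" for q
      using dy_cong[OF K.open_dom that K.W_eq] K.dy_W_formula[OF that] by simp
    have "Ric (kropina (a c) (b c)) k l x y = K.cs.ric k l x + dy k (dy l K.cs.W) ?p
      - 1/2 * (dy k (K.cs.dcov l K.cs.T) ?p + dy l (K.cs.dcov k K.cs.T) ?p)"
      by (rule K.cs.Ric_eq[OF K.spray_eq p]) (simp_all add: ric K.Ric_riem_sym[OF z])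
    also have "dy k (dy l K.cs.W) ?p = dy k (K.W1 l) ?p"
      by (rule dy_cong[OF K.open_dom p dW])
    also have "dy k (K.cs.dcov l K.cs.T) ?p = dy k (K.DT l) ?p"
      by (rule dy_cong[OF K.open_dom p K.dcov_T_eq])
    also have "dy l (K.cs.dcov k K.cs.T) ?p = dy l (K.DT k) ?p"
      by (rule dy_cong[OF K.open_dom p K.dcov_T_eq])
    finally show ?thesis unfolding ric by simp
  qed
  have C: "K.C ?p = (lin K.sd ?p + quad K.rdd ?p * inverse (K.F ?p)) * inverse (K.b2 x)"
    by (simp add: K.C_def divide_inverse)
  have dC: "dy k K.C ?p = (K.sd k x + 2 * lin (K.rdd k) ?p * inverse (K.F ?p)
      - quad K.rdd ?p * dy k K.F ?p * inverse (K.F ?p) * inverse (K.F ?p)) * inverse (K.b2 x)" for k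
    unfolding K.dy_C[OF p] by (simp add: divide_inverse power2_eq_square)
  have ddC: "dy k (dy l K.C) ?p = (2 * K.rdd l k x * inverse (K.F ?p) - 2 * lin (K.rdd l) ?p * dy k K.F ?p * inverse (K.F ?p) * inverse (K.F ?p)
      - 2 * lin (K.rdd k) ?p * dy l K.F ?p * inverse (K.F ?p) * inverse (K.F ?p)
      - quad K.rdd ?p * dy k (dy l K.F) ?p * inverse (K.F ?p) * inverse (K.F ?p)
      + 2 * quad K.rdd ?p * dy l K.F ?p * dy k K.F ?p * inverse (K.F ?p) * inverse (K.F ?p) * inverse (K.F ?p)) * inverse (K.b2 x)"
    unfolding K.dy_dy_C[OF p] by (simp add: divide_inverse)
  \<comment> \<open>The two \<open>refl\<close> fix \<open>q\<close> and \<open>j\<close> as the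
    actual inverses of \<open>F\<close> and b^2.\<close>
  note D0 = K.dy_D0[OF p refl refl, unfolded fst_conv] and D1 = K.dy_D1[OF p refl refl, unfolded fst_conv]
    and D2 = K.dy_D2[OF p refl refl, unfolded fst_conv] and DT = K.dy_DT[OF p refl refl, unfolded fst_conv]
    and W = K.dy_W1[OF p refl refl, unfolded fst_conv]
  note alg = Ric_algebra[OF nz(1) C dC[of k] dC[of l] ddC W
      D0[of k l] D0[of l k, unfolded Fsym Csym] D1[of k l] D1[of l k, unfolded Fsym Csym rsym]
      D2[of k l] D2[of l k, unfolded Fsym Csym rsym] DT[of k l] DT[of l k]]
  \<comment> \<open>The formula distinguishes \<open>r_{0k}\<close> from \<open>r_{k0}\<close>; by
    symmetry both become the same contraction.\<close>
  have rdd_r: "(\<Sum>j\<in>UNIV. r_dd (a c) (b c) j i x * y $ j) = lin (K.rdd i) ?p" for i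
    unfolding lin_def by (simp add: K.rdd_sym[of _ i])
  have pd_F: "pd i (\<lambda>w. kropina (a c) (b c) x w) w = dy i K.F (x, w)" if "(x, w) \<in> K.dom" for i w
    by (rule pd_snd_on[OF K.open_dom that K.smooth_F]) (use K.kropina_eq in force)
  have atoms:
    "rd0 i = lin (K.rdd i) ?p" "r0d i = lin (K.rdd i) ?p" "r00 = quad K.rdd ?p" "r0 = lin K.rd ?p" "s0 = lin K.sd ?p"
    "sud0 i = lin (K.sud i) ?p" "rdd i m = K.rdd i m x" "rud i m = K.rud i m x" "sud i m = K.sud i m x"
    "rd i = K.rd i x" "sd i = K.sd i x" "su i = K.su i x" "bu i = K.bu i x" "r = K.rs x"
    "rdd_0 i m = lin (cov_dd (a c) K.rdd i m) ?p" "rd0_d i m = lin (\<lambda>j. cov_dd (a c) K.rdd i j m) ?p"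
    "rd0_0 i = quad (cov_dd (a c) K.rdd i) ?p" "r00_d i = quad (\<lambda>m j. cov_dd (a c) K.rdd m j i) ?p"
    "rdd_d i m t = cov_dd (a c) K.rdd i m t x" "rd_d i m = cov_d (a c) K.rd i m x" "sd_d i m = cov_d (a c) K.sd i m x"
    "s0_d m = lin (\<lambda>i. cov_d (a c) K.sd i m) ?p" "divs i = K.divs i x" "divs0 = lin K.divs ?p" for i m t
    unfolding assms(8-) rdd_r by (simp_all add: lin_def quad_def K.divs_def)
  have r000: "r00_0 = K.r000 ?p"
  proof -
    have "K.r000 ?p = (\<Sum>k\<in>UNIV. \<Sum>i\<in>UNIV. \<Sum>j\<in>UNIV. cov_dd (a c) K.rdd i j k x * y $ i * y $ j * y $ k)"
      by (simp add: K.r000_def quad_def sum_distrib_right)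
    also have "\<dots> = (\<Sum>i\<in>UNIV. \<Sum>k\<in>UNIV. \<Sum>j\<in>UNIV. cov_dd (a c) K.rdd i j k x * y $ i * y $ j * y $ k)"
      by (rule sum.swap)
    also have "\<dots> = (\<Sum>i\<in>UNIV. \<Sum>j\<in>UNIV. \<Sum>k\<in>UNIV. cov_dd (a c) K.rdd i j k x * y $ i * y $ j * y $ k)"
      by (rule sum.cong[OF refl]) (rule sum.swap)
    finally show ?thesis unfolding assms(8-) by simp
  qed
  have F_atoms: "F = K.F ?p" "Fk i = dy i K.F ?p" "Fkl k l = dy k (dy l K.F) ?p" "b2 = K.b2 x" "n = real CARD('n)" "b4 = (K.b2 x)\<^sup>2" for i
  proof -
    show "F = K.F ?p" using K.kropina_eq[OF p] unfolding assms(8-) by simp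
    show "Fk i = dy i K.F ?p" unfolding assms(8-) by (rule pd_F[OF p])
    \<comment> \<open>\<open>Fkl k l\<close> differentiates in direction \<open>k\<close> first,
      opposite to the order used in \<open>Ric_algebra\<close>, so \<open>Fsym\<close> is applied
      afterwards.\<close>
    have "pd l (\<lambda>v. pd k (\<lambda>w. kropina (a c) (b c) x w) v) y = dy l (dy k K.F) ?p"
      by (rule pd_snd_on[OF K.open_dom p smooth_on_dy[OF K.smooth_F]]) (rule pd_F)
    then show "Fkl k l = dy k (dy l K.F) ?p" unfolding assms(8-) Fsym by simp
  qed (simp_all add: assms(8-))
  have rdd_sud: "(\<Sum>m\<in>UNIV. K.rdd i m x * K.sud m t x) = K.rdd_sud i t x" for i t
    by (simp add: K.rdd_sud_def K.rdd_sym[of i])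
  have rdd_sig: "(\<Sum>m\<in>UNIV. K.rdd i m x * lin (K.sud m) ?p) = lin (K.rdd_sud i) ?p" for i
    unfolding lin_contract fst_conv rdd_sud by (simp add: lin_def rdd_sud)
  \<comment> \<open>The order \<open>l\<close>, \<open>k\<close> is the one that
    \<open>dy_W1\<close> delivers; the next fact aligns \<open>r_{kl|0}\<close> in the same
    way.\<close>
  have bu_cov: "(\<Sum>m\<in>UNIV. K.bu m x * cov_dd (a c) K.rdd k l m x) = K.rdd_b l k x"
    unfolding K.rdd_b_def K.cov_dd_sym[of k l] by (simp add: mult.commute)
  have cov_kl: "lin (cov_dd (a c) K.rdd k l) ?p = lin (cov_dd (a c) K.rdd l k) ?p"
    by (rule lin_cong) (rule K.cov_dd_sym)
  have s_sq: "(\<Sum>m\<in>UNIV. K.su m x * K.sd m x) = K.s_sq x"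
    by (simp add: K.s_sq_def mult.commute)
  have s_cov: "(\<Sum>m\<in>UNIV. cov_d (a c) K.sd i m x * K.bu m x) = K.sd_b i x" for i
    by (simp add: K.sd_b_def)
  have rud_sd: "(\<Sum>m\<in>UNIV. K.rud m i x * K.sd m x) = K.rdd_su i x"
    and rdd_su: "(\<Sum>m\<in>UNIV. K.rdd i m x * K.su m x) = K.rdd_su i x" for i
    by (simp_all add: K.rdd_su_def K.rdd_su[OF z])
  have traces: "(\<Sum>m\<in>UNIV. K.rud m m x) = K.r_tr x" "(\<Sum>t\<in>UNIV. \<Sum>m\<in>UNIV. K.sud t m x * K.sud m t x) = K.s_tr x"
    by (simp_all add: K.r_tr_def K.s_tr_def)
  note sums = K.sd_sig[OF p, unfolded fst_conv] K.rd_sig[OF p, unfolded fst_conv] K.rl_sig[OF p] K.rl_su[OF p, unfolded fst_conv]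
    K.rl_sud[OF p, unfolded fst_conv] K.sd_sud[OF p, unfolded fst_conv] K.rd_sud[OF p, unfolded fst_conv]
    K.sd_su[OF p, unfolded fst_conv] K.cov_sd_bu[OF p, unfolded fst_conv]
    rdd_sud rdd_sig bu_cov cov_kl s_sq s_cov rud_sd rdd_su traces
  show ?thesis
    unfolding Ric alg atoms r000 F_atoms sums rsym
    by (simp only: add.assoc[symmetric] add_diff_eq)
qed

end
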